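(* Let $(M,g)$ be a Riemannian manifold of dimension $n$. For all even $n\ge8$ and all odd $n\ge3$, the GJMS-operator $P_8$ is given by the formula $$P_8=\mathcal M_2^4+3(\mathcal M_2^2\mathcal M_4+\mathcal M_4\mathcal M_2^2)+4\mathcal M_2\mathcal M_4\mathcal M_2+9\mathcal M_4^2+3(\mathcal M_2\mathcal M_6+\mathcal M_6\mathcal M_2)-96\,\delta\left(\left[\Omega^{(2)}-4(\mathsf P\,\Omega^{(1)}+\Omega^{(1)}\mathsf P)+12\,\mathsf P^3\right]d\right)+\mu_8,$$ where $$\mu_8=\left(\tfrac n2-4\right)3!\,4!\,2^8\,w_8-48^2\mathcal M_2(w_6)-24^2\mathcal M_4(w_4)-6^2\mathcal M_6(w_2)$$ acts as a multiplication operator.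
   Context: $\delta$ is the formal adjoint of $d$ with respect to $g$, $\Delta=-\delta d$. $\mathsf J=\frac{\mathrm{scal}}{2(n-1)}$; $\mathsf P$ is the Schouten tensor, $(n-2)\mathsf P=\mathrm{Ric}-\mathsf Jg$. Symmetric 2-tensors are regarded, using $g$, as endomorphisms of one-forms (products are compositions). Poincaré–Einstein metric: on $M\times(0,\varepsilon)$, $g_+=r^{-2}(dr^2+g_r)$, $g_0=g$, $g_r$ even in $r$, with $\mathrm{Ric}(g_+)+ng_+=0$ asymptotically at $r=0$ (to infinite order for odd $n$; for even $n$: $O(r^{n-2})$ with vanishing $g$-trace of the coefficient of $r^{n-2}$). Set $w(r)=\sqrt{\mathrm{vol}(g_r)/\mathrm{vol}(g)}=1+w_2r^2+w_4r^4+w_6r^6+w_8r^8+\cdots$. Ambient metric: $\tilde g=2t\,dt\,d\rho+2\rho\,dt^2+t^2g(\rho)$ with $g(\rho)=g_r$ for $\rho=-r^2/2$. GJMS-operators: $P_{2N}u=\Delta_{\tilde g}^N(t^{N-n/2}\tilde u)|_{\rho=0,t=1}$ for any smooth extension $\tilde u(x,\rho)$ of $u\in C^\infty(M)$ (all $N\ge1$ for odd $n$, $2N\le n$ for even $n$). Extended obstruction tensors: $\Omega^{(k)}_{ij}=-\tilde\nabla_\infty^{(k-1)}(\tilde R)_{\infty ij\infty}|_{t=1,\rho=0}$, $k\ge1$, where $\tilde R$ is the curvature tensor of $\tilde g$, the index $\infty$ refers to $\partial/\partial\rho$, and the sign convention for curvature is such that $\mathrm{Ric}_{jk}=R^{i}{}_{jki}$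 (opposite to Fefferman–Graham). With this normalization $\Omega^{(1)}=-\mathcal B/(n-4)$, where $\mathcal B_{ij}=\Delta(\mathsf P)_{ij}-\nabla^k\nabla_j(\mathsf P)_{ik}+\mathsf P^{kl}W_{kijl}$ is the Bach tensor ($W$ the Weyl tensor in the same sign convention). Operators: $\mathcal M_2=P_2$, $\mathcal M_4=P_4-P_2^2$, $\mathcal M_6=P_6-2P_2P_4-2P_4P_2+3P_2^3$. *)

theory Defs
  imports "HOL-Analysis.Analysis" "HOL-Library.Landau_Symbols"
begin

section \<open>Partial derivatives and smoothness in coordinates\<close>

definition pd :: "'k::finite \<Rightarrow> (real^'k \<Rightarrow> real) \<Rightarrow> real^'k \<Rightarrow> real" where
  "pd i f x = frechet_derivative f (at x) (axis i 1)"

text \<open>On an open set, all iterated partial derivatives being (totally) differentiable is the same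
  as being of class $C^\infty$.\<close>

definition smooth_on :: "(real^'k::finite) set \<Rightarrow> (real^'k \<Rightarrow> real) \<Rightarrow> bool" where
  "smooth_on S f \<longleftrightarrow> open S \<and> (\<forall>ks. foldr pd ks f differentiable_on S)"


section \<open>Pseudo-Riemannian geometry in coordinates\<close>

text \<open>A metric on an open subset of \<open>real^'k\<close> is given by its matrix of components, a one-form by its
  vector of components.\<close>

definition metric_inv :: "(real^'k::finite \<Rightarrow> real^'k^'k) \<Rightarrow> real^'k \<Rightarrow> real^'k^'k" where
  "metric_inv G x = matrix_inv (G x)"

definition vol_density :: "(real^'k::finite \<Rightarrow> real^'k^'k) \<Rightarrow> real^'k \<Rightarrow> real" where
  "vol_density G x = sqrt \<bar>det (G x)\<bar>"

definition dform :: "(real^'k::finite \<Rightarrow> real) \<Rightarrow> real^'k \<Rightarrow> real^'k" where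
  "dform f x = (\<chi> i. pd i f x)"

text \<open>The formal adjoint \<open>\<delta>\<close> of \<open>d\<close> on one-forms, with the coefficients obtained by integrating
  by parts against the volume density; that it is the formal adjoint is \<open>codiff_formal_adjoint\<close>
  below.\<close>

definition codiff :: "(real^'k::finite \<Rightarrow> real^'k^'k) \<Rightarrow> (real^'k \<Rightarrow> real^'k) \<Rightarrow> real^'k \<Rightarrow> real" where
  "codiff G \<omega> x = - (1 / vol_density G x) *
     (\<Sum>i\<in>UNIV. pd i (\<lambda>y. vol_density G y * (metric_inv G y *v \<omega> y) $ i) x)"

definition laplacian :: "(real^'k::finite \<Rightarrow> real^'k^'k) \<Rightarrow> (real^'k \<Rightarrow> real) \<Rightarrow> real^'k \<Rightarrow> real" where
  "laplacian G f x = - codiff G (dform f) x"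

text \<open>Proof that \<open>codiff\<close> is the formal adjoint of \<open>d\<close>; \<open>c1_on\<close> is only used for this.\<close>

lemma pd_eqI: "(f has_derivative f') (at x) \<Longrightarrow> pd i f x = f' (axis i 1)"
  unfolding pd_def using frechet_derivative_at by metis

definition c1_on :: "(real^'k::finite) set \<Rightarrow> (real^'k \<Rightarrow> real) \<Rightarrow> bool" where
  "c1_on S f \<longleftrightarrow> (\<forall>x\<in>S. f differentiable (at x)) \<and> (\<forall>i. continuous_on S (pd i f))"

lemma c1_onI:
  assumes "\<And>x. x \<in> S \<Longrightarrow> (f has_derivative f' x) (at x)"
    and "\<And>i. continuous_on S (\<lambda>x. f' x (axis i 1))"
  shows "c1_on S f"
  unfolding c1_on_def differentiable_def
  using assms pd_eqI[OF assms(1)] by (auto cong: continuous_on_cong)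

lemma c1_on_continuous: "c1_on S f \<Longrightarrow> continuous_on S f"
  unfolding c1_on_def
  by (meson continuous_at_imp_continuous_on differentiable_imp_continuous_within)

lemma c1_on_hd:
  "c1_on S f \<Longrightarrow> x \<in> S \<Longrightarrow> (f has_derivative frechet_derivative f (at x)) (at x)"
  unfolding c1_on_def using frechet_derivative_works by blast

lemma c1_on_const: "c1_on S (\<lambda>x. c)"
  by (rule c1_onI[where f' = "\<lambda>x v. 0"]) auto

lemma c1_on_add:
  assumes "c1_on S f" "c1_on S g" shows "c1_on S (\<lambda>x. f x + g x)"
  by (rule c1_onI[OF has_derivative_add[OF c1_on_hd[OF assms(1)] c1_on_hd[OF assms(2)]]])
     (use assms in \<open>auto simp: c1_on_def pd_def[abs_def] intro!: continuous_on_add\<close>)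

lemma c1_on_mult:
  assumes "c1_on S f" "c1_on S g" shows "c1_on S (\<lambda>x. f x * g x)"
  by (rule c1_onI[OF has_derivative_mult[OF c1_on_hd[OF assms(1)] c1_on_hd[OF assms(2)]]])
     (use assms in \<open>auto simp: c1_on_def pd_def[abs_def]
        intro!: continuous_on_add continuous_on_mult c1_on_continuous[OF assms(1)]
          c1_on_continuous[OF assms(2)]\<close>)

lemma c1_on_sum: "(\<And>a. a \<in> I \<Longrightarrow> c1_on S (f a)) \<Longrightarrow> c1_on S (\<lambda>x. \<Sum>a\<in>I. f a x)"
  by (induction I rule: infinite_finite_induct) (auto simp: c1_on_const c1_on_add)

lemma c1_on_prod: "(\<And>a. a \<in> I \<Longrightarrow> c1_on S (f a)) \<Longrightarrow> c1_on S (\<lambda>x. \<Prod>a\<in>I. f a x)"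
  by (induction I rule: infinite_finite_induct) (auto simp: c1_on_const c1_on_mult)

lemma c1_on_compose:
  fixes \<phi> \<phi>' :: "real \<Rightarrow> real"
  assumes f: "c1_on S f" and d: "\<And>x. x \<in> S \<Longrightarrow> (\<phi> has_real_derivative \<phi>' (f x)) (at (f x))"
    and c: "continuous_on S (\<lambda>x. \<phi>' (f x))"
  shows "c1_on S (\<lambda>x. \<phi> (f x))"
  by (rule c1_onI[OF has_derivative_compose[OF c1_on_hd[OF f] d[unfolded has_field_derivative_def]]])
     (use f c in \<open>auto simp: c1_on_def pd_def[abs_def] intro!: continuous_on_mult\<close>)

lemma c1_on_inverse:
  assumes "c1_on S f" "\<And>x. x \<in> S \<Longrightarrow> f x \<noteq> 0" shows "c1_on S (\<lambda>x. inverse (f x))"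
  by (rule c1_on_compose[OF assms(1) DERIV_inverse[OF assms(2)]])
     (use assms(2) in \<open>auto intro!: continuous_intros c1_on_continuous[OF assms(1)]\<close>)

lemma c1_on_sqrt:
  assumes "c1_on S f" "\<And>x. x \<in> S \<Longrightarrow> f x > 0" shows "c1_on S (\<lambda>x. sqrt (f x))"
  by (rule c1_on_compose[OF assms(1) DERIV_real_sqrt[OF assms(2)]])
     (use assms(2) in \<open>fastforce intro!: continuous_intros c1_on_continuous[OF assms(1)]\<close>)+

lemma c1_on_cong:
  assumes "open S" "c1_on S f" "\<And>x. x \<in> S \<Longrightarrow> f x = g x" shows "c1_on S g"
  by (rule c1_onI[OF has_derivative_transform_within_open[OF c1_on_hd[OF assms(2)] assms(1) _ assms(3)]])
     (use assms(2) in \<open>auto simp: c1_on_def pd_def[abs_def]\<close>)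

lemma c1_on_det:
  fixes B :: "real^'k::finite \<Rightarrow> real^'m^'m::finite"
  assumes "\<And>i j. c1_on S (\<lambda>x. B x $ i $ j)" shows "c1_on S (\<lambda>x. det (B x))"
  unfolding det_def by (intro c1_on_sum c1_on_mult c1_on_const c1_on_prod assms)

lemma smooth_on_imp_c1_on:
  assumes "smooth_on S f" shows "c1_on S f"
proof -
  have op: "open S" and d: "\<And>ks. foldr pd ks f differentiable_on S"
    using assms by (auto simp: smooth_on_def)
  show ?thesis unfolding c1_on_def
    using d[of "[]"] differentiable_imp_continuous_on[OF d[of "[_]"]] op
    by (auto simp: differentiable_on_eq_differentiable_at)
qed

lemma c1_on_flux:
  fixes G :: "real^'k::finite \<Rightarrow> real^'k^'k"
  assumes op: "open S" and G: "\<And>i j. c1_on S (\<lambda>x. G x $ i $ j)" and det: "\<And>x. x \<in> S \<Longrightarrow> det (G x) \<noteq> 0"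
    and om: "\<And>i. c1_on S (\<lambda>x. \<omega> x $ i)"
  shows "c1_on S (\<lambda>y. vol_density G y * (metric_inv G y *v \<omega> y) $ i)"
proof -
  have D: "c1_on S (\<lambda>x. det (G x))" by (rule c1_on_det[OF G])
  have 1: "c1_on S (\<lambda>x. sqrt (sqrt (det (G x) * det (G x))))"
    using det by (intro c1_on_sqrt c1_on_mult D) (auto simp: zero_less_mult_iff linorder_neq_iff)
  let ?N = "\<lambda>x. \<chi> a b. if b = i then \<omega> x $ a else G x $ a $ b"
  have N: "c1_on S (\<lambda>x. ?N x $ a $ b)" for a b
    using G om by (cases "b = i") auto
  have 2: "c1_on S (\<lambda>x. det (?N x) * inverse (det (G x)))"
    using det by (intro c1_on_mult c1_on_inverse D c1_on_det) (simp_all add: N del: vec_lambda_beta)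
  have eq: "det (?N x) * inverse (det (G x)) = (metric_inv G x *v \<omega> x) $ i" if "x \<in> S" for x
  proof -
    have "invertible (G x)" using det[OF that] by (simp add: invertible_det_nz)
    then have "G x ** matrix_inv (G x) = mat 1"
      unfolding invertible_def matrix_inv_def by (rule someI2_ex) blast
    then have "G x *v (metric_inv G x *v \<omega> x) = \<omega> x"
      by (simp add: matrix_vector_mul_assoc metric_inv_def)
    then have "metric_inv G x *v \<omega> x = (\<chi> m. det (\<chi> a b. if b = m then \<omega> x $ a else G x $ a $ b) / det (G x))"
      using cramer[OF det[OF that]] by blast
    then show ?thesis by (simp add: divide_inverse)
  qed
  show ?thesis
    by (rule c1_on_cong[OF op c1_on_mult[OF 1 2]]) (simp add: eq vol_density_def)
qed

lemma integral_pd_eq_0: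
  fixes F :: "real^'k::finite \<Rightarrow> real"
  assumes F: "c1_on UNIV F" and K: "compact K" and Z: "\<And>x. x \<notin> K \<Longrightarrow> F x = 0"
  shows "integrable lborel (pd i F) \<and> integral\<^sup>L lborel (pd i F) = 0"
proof -
  let ?e = "axis i 1 :: real^'k"
  have cF: "continuous_on UNIV F" and cp: "continuous_on UNIV (pd i F)"
    using F c1_on_continuous by (auto simp: c1_on_def)
  have pz: "pd i F x = 0" if "x \<notin> K" for x
  proof -
    have "(F has_derivative (\<lambda>_. 0)) (at x)"
      by (rule has_derivative_transform_within_open[of "\<lambda>_. 0" _ _ _ "- K"])
         (use that Z K in \<open>auto simp: compact_imp_closed open_Compl\<close>)
    then show ?thesis by (rule pd_eqI)
  qed
  obtain R where R: "\<And>x. x \<in> K \<Longrightarrow> norm x \<le> R" "R > 0"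
    using compact_imp_bounded[OF K] by (auto simp: bounded_pos)
  obtain B where B: "\<And>x. x \<in> K \<Longrightarrow> \<bar>pd i F x\<bar> \<le> B" "B > 0"
    using compact_imp_bounded[OF compact_continuous_image[OF continuous_on_subset[OF cp] K]]
    by (auto simp: bounded_pos)
  have B': "\<bar>pd i F x\<bar> \<le> B" for x using B pz by (cases "x \<in> K") auto
  define h where "h m = inverse (real (Suc m))" for m
  have h: "0 < h m" "h m \<le> 1" for m by (auto simp: h_def divide_simps)
  define D where "D m x = (F (h m *\<^sub>R ?e + x) - F x) / h m" for m x
  have der: "((\<lambda>s. F (s *\<^sub>R ?e + x)) has_real_derivative pd i F (s *\<^sub>R ?e + x)) (at s)" for s x
  proof -
    have "((\<lambda>s. F (s *\<^sub>R ?e + x)) has_derivative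
        (\<lambda>v. frechet_derivative F (at (s *\<^sub>R ?e + x)) (v *\<^sub>R ?e))) (at s)"
      by (rule has_derivative_compose[of "\<lambda>s. s *\<^sub>R ?e + x" _ _ _ F])
         (auto intro!: derivative_eq_intros c1_on_hd[OF F])
    moreover have "frechet_derivative F (at (s *\<^sub>R ?e + x)) (v *\<^sub>R ?e) = pd i F (s *\<^sub>R ?e + x) * v" for v
      using linear_scale[OF has_derivative_linear[OF c1_on_hd[OF F]]]
      by (simp add: pd_def mult.commute)
    ultimately show ?thesis by (simp add: has_field_derivative_def)
  qed
  have supp: "integrable lborel f"
    if "continuous_on UNIV f" "\<And>x. x \<notin> K \<Longrightarrow> f x = 0" for f :: "real^'k \<Rightarrow> real"
  proof -
    have "integrable lborel (\<lambda>x. indicator K x *\<^sub>R f x)"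
      using borel_integrable_compact[OF K continuous_on_subset[OF that(1)]] by simp
    moreover have "(\<lambda>x. indicator K x *\<^sub>R f x) = f"
      using that(2) by (intro ext) (simp add: indicator_def, metis)
    ultimately show ?thesis by simp
  qed
  have iF: "integrable lborel F" and ip: "integrable lborel (pd i F)"
    using supp cF cp Z pz by blast+
  have tr: "(\<integral>x. F (c + x) \<partial>lborel) = integral\<^sup>L lborel F"
    and tri: "integrable lborel (\<lambda>x. F (c + x))" for c
  proof -
    have m: "F \<in> borel_measurable borel" using cF by (rule borel_measurable_continuous_onI)
    show "(\<integral>x. F (c + x) \<partial>lborel) = integral\<^sup>L lborel F"
      using integral_distr[of "(+) c" lborel borel F] m by (simp add: lborel_distr_plus)
    show "integrable lborel (\<lambda>x. F (c + x))"
      using integrable_distr_eq[of "(+) c" lborel borel F] m iF by (simp add: lborel_distr_plus)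
  qed
  have D0: "integral\<^sup>L lborel (D m) = 0" for m
    unfolding D_def using tr tri iF by (simp add: Bochner_Integration.integral_diff)
  have bd: "norm (D m x) \<le> B * indicator (cball 0 (R + 1)) x" for m x
  proof (cases "x \<in> cball 0 (R + 1)")
    case True
    have "\<exists>s. 0 < s \<and> s < h m \<and> F (h m *\<^sub>R ?e + x) - F (0 *\<^sub>R ?e + x) = (h m - 0) * pd i F (s *\<^sub>R ?e + x)"
      by (rule MVT2[OF h(1) der])
    then obtain s where "F (h m *\<^sub>R ?e + x) - F x = h m * pd i F (s *\<^sub>R ?e + x)" by auto
    then have "D m x = pd i F (s *\<^sub>R ?e + x)" using h(1)[of m] by (simp add: D_def)
    then show ?thesis using True B' by simp
  next
    case False
    then have "norm x > R + 1" by simp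
    moreover have "norm x \<le> norm (h m *\<^sub>R ?e + x) + norm (h m *\<^sub>R ?e)"
      by (metis add_diff_cancel_left' norm_triangle_ineq4)
    moreover have "norm (h m *\<^sub>R ?e) \<le> 1" using h[of m] by (simp add: norm_axis_1)
    ultimately have "x \<notin> K" "h m *\<^sub>R ?e + x \<notin> K" using R(1) by (force, force)
    then show ?thesis using Z False by (simp add: D_def)
  qed
  have lim: "(\<lambda>m. D m x) \<longlonglongrightarrow> pd i F x" for x
  proof -
    have "((\<lambda>s. (F (s *\<^sub>R ?e + x) - F x) / s) \<longlongrightarrow> pd i F x) (at 0)"
      using der[of x 0] by (simp add: has_field_derivative_iff)
    moreover have "filterlim h (at 0) sequentially"
      unfolding filterlim_at h_def using LIMSEQ_inverse_real_of_nat by auto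
    ultimately show ?thesis unfolding D_def by (rule filterlim_compose)
  qed
  have "(\<lambda>m. integral\<^sup>L lborel (D m)) \<longlonglongrightarrow> integral\<^sup>L lborel (pd i F)"
  proof (rule integral_dominated_convergence[where w = "\<lambda>x. B * indicator (cball 0 (R + 1)) x"])
    show "pd i F \<in> borel_measurable lborel" using ip by (rule borel_measurable_integrable)
    show "D m \<in> borel_measurable lborel" for m
      unfolding D_def[abs_def] using tri iF
      by (intro borel_measurable_divide borel_measurable_diff) (auto intro: borel_measurable_integrable)
    show "integrable lborel (\<lambda>x::real^'k. B * indicator (cball 0 (R + 1)) x)"
      by (intro integrable_mult_right integrable_real_indicator) (use emeasure_bounded_finite[OF bounded_cball] in \<open>auto simp: top.not_eq_extremum\<close>)
  qed (use lim bd in auto)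
  then show ?thesis using D0 ip by (simp add: LIMSEQ_const_iff)
qed

lemma codiff_formal_adjoint:
  fixes G :: "real^'k::finite \<Rightarrow> real^'k^'k"
  assumes op: "open V" and G: "\<And>i j. smooth_on V (\<lambda>x. G x $ i $ j)"
    and det: "\<And>x. x \<in> V \<Longrightarrow> det (G x) \<noteq> 0"
    and \<omega>: "\<And>i. smooth_on V (\<lambda>x. \<omega> x $ i)" and u: "smooth_on UNIV u"
    and K: "compact K" "K \<subseteq> V" and Z: "\<And>x. x \<notin> K \<Longrightarrow> u x = 0"
  shows "(LINT x:V|lborel. (dform u x \<bullet> (metric_inv G x *v \<omega> x)) * vol_density G x) =
         (LINT x:V|lborel. u x * codiff G \<omega> x * vol_density G x)"
proof -
  define X where "X i y = vol_density G y * (metric_inv G y *v \<omega> y) $ i" for i y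
  have X: "c1_on V (X i)" for i
    unfolding X_def[abs_def] using c1_on_flux[OF op] smooth_on_imp_c1_on G \<omega> det by blast
  have cu: "c1_on UNIV u" by (rule smooth_on_imp_c1_on[OF u])
  have cuV: "c1_on V u" using cu by (auto simp: c1_on_def intro: continuous_on_subset)
  have opK: "open (- K)" using K by (simp add: compact_imp_closed open_Compl)
  have cov: "V \<union> - K = UNIV" using K by auto
  have pz: "pd i u x = 0" if "x \<notin> K" for i x
  proof -
    have "(u has_derivative (\<lambda>_. 0)) (at x)"
      by (rule has_derivative_transform_within_open[of "\<lambda>_. 0" _ _ _ "- K"]) (use that Z opK in auto)
    then show ?thesis by (rule pd_eqI)
  qed
  have c1_ext: "c1_on UNIV f" if "c1_on V f" "\<And>x. x \<notin> K \<Longrightarrow> f x = 0" for f :: "real^'k \<Rightarrow> real"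
  proof -
    have "c1_on (- K) f" by (rule c1_on_cong[OF opK c1_on_const[of _ 0]]) (use that in auto)
    then have "c1_on (V \<union> - K) f"
      using that(1) op opK by (auto simp: c1_on_def intro!: continuous_on_open_Un)
    then show ?thesis by (simp add: cov)
  qed
  have uX: "c1_on UNIV (\<lambda>x. u x * X i x)" for i
    by (rule c1_ext[OF c1_on_mult[OF cuV X]]) (simp add: Z)
  have pduX: "pd i (\<lambda>x. u x * X i x) x = pd i u x * X i x + u x * pd i (X i) x" if "x \<in> V" for i x
    using pd_eqI[OF has_derivative_mult[OF c1_on_hd[OF cuV that] c1_on_hd[OF X that]], of i]
    by (simp add: pd_def)
  have I: "integrable lborel f" if "continuous_on V f" "\<And>x. x \<notin> K \<Longrightarrow> f x = 0" for f :: "real^'k \<Rightarrow> real"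
  proof -
    have "integrable lborel (\<lambda>x. indicator K x *\<^sub>R f x)"
      using borel_integrable_compact[OF K(1) continuous_on_subset[OF that(1) K(2)]] by simp
    moreover have "(\<lambda>x. indicator K x *\<^sub>R f x) = f"
      using that(2) by (intro ext) (simp add: indicator_def, metis)
    ultimately show ?thesis by simp
  qed
  have i1: "integrable lborel (\<lambda>x. pd i u x * X i x)" for i
    using cuV c1_on_continuous[OF X] by (intro I continuous_on_mult) (auto simp: c1_on_def pz)
  have i2: "integrable lborel (\<lambda>x. u x * pd i (X i) x)" for i
    using X c1_on_continuous[OF cuV] by (intro I continuous_on_mult) (auto simp: c1_on_def Z)
  have "(\<integral>x. pd i u x * X i x \<partial>lborel) + (\<integral>x. u x * pd i (X i) x \<partial>lborel) = 0" for i
  proof -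
    have "pd i (\<lambda>x. u x * X i x) = (\<lambda>x. pd i u x * X i x + u x * pd i (X i) x)"
    proof
      fix x show "pd i (\<lambda>x. u x * X i x) x = pd i u x * X i x + u x * pd i (X i) x"
      proof (cases "x \<in> V")
        case False
        then have nK: "x \<notin> K" using K by auto
        have "((\<lambda>x. u x * X i x) has_derivative (\<lambda>_. 0)) (at x)"
          by (rule has_derivative_transform_within_open[of "\<lambda>_. 0" _ _ _ "- K"]) (use nK Z opK in auto)
        then have "pd i (\<lambda>x. u x * X i x) x = 0" by (rule pd_eqI)
        then show ?thesis using nK pz Z by simp
      qed (rule pduX)
    qed
    then show ?thesis
      using integral_pd_eq_0[OF uX K(1), of i i] i1 i2 Z by (simp add: Bochner_Integration.integral_add)
  qed
  then have S: "(\<Sum>i\<in>UNIV. \<integral>x. pd i u x * X i x \<partial>lborel) = - (\<Sum>i\<in>UNIV. \<integral>x. u x * pd i (X i) x \<partial>lborel)"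
    unfolding sum_negf[symmetric] by (intro sum.cong refl) (simp add: eq_neg_iff_add_eq_0)
  have "(LINT x:V|lborel. (dform u x \<bullet> (metric_inv G x *v \<omega> x)) * vol_density G x)
      = (\<integral>x. (\<Sum>i\<in>UNIV. pd i u x * X i x) \<partial>lborel)"
    unfolding set_lebesgue_integral_def
  proof (rule Bochner_Integration.integral_cong[OF refl])
    fix x
    have pz': "x \<notin> V \<Longrightarrow> pd i u x = 0" for i using pz K by blast
    show "indicator V x *\<^sub>R (dform u x \<bullet> (metric_inv G x *v \<omega> x) * vol_density G x)
        = (\<Sum>i\<in>UNIV. pd i u x * X i x)"
      using pz' by (cases "x \<in> V")
        (auto simp: dform_def inner_vec_def X_def sum_distrib_left sum_distrib_right mult_ac)
  qed
  also have "\<dots> = (\<Sum>i\<in>UNIV. \<integral>x. pd i u x * X i x \<partial>lborel)"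
    by (rule Bochner_Integration.integral_sum[OF i1])
  also have "\<dots> = - (\<Sum>i\<in>UNIV. \<integral>x. u x * pd i (X i) x \<partial>lborel)" by (rule S)
  also have "\<dots> = - (\<integral>x. (\<Sum>i\<in>UNIV. u x * pd i (X i) x) \<partial>lborel)"
    by (simp add: Bochner_Integration.integral_sum[OF i2])
  also have "\<dots> = (\<integral>x. - (\<Sum>i\<in>UNIV. u x * pd i (X i) x) \<partial>lborel)"
    by simp
  also have "\<dots> = (LINT x:V|lborel. u x * codiff G \<omega> x * vol_density G x)"
    unfolding set_lebesgue_integral_def
  proof (rule Bochner_Integration.integral_cong[OF refl])
    fix x
    show "- (\<Sum>i\<in>UNIV. u x * pd i (X i) x) = indicator V x *\<^sub>R (u x * codiff G \<omega> x * vol_density G x)"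
    proof (cases "x \<in> V")
      case True
      then have "vol_density G x \<noteq> 0" using det by (simp add: vol_density_def)
      then show ?thesis using True
        by (simp add: codiff_def X_def[abs_def] sum_distrib_left[symmetric])
    next
      case False
      then have "u x = 0" using K Z by blast
      then show ?thesis using False by simp
    qed
  qed
  finally show ?thesis .
qed

definition christoffel ::
    "(real^'k::finite \<Rightarrow> real^'k^'k) \<Rightarrow> 'k \<Rightarrow> 'k \<Rightarrow> 'k \<Rightarrow> real^'k \<Rightarrow> real" where
  "christoffel G m i j x = (1/2) * (\<Sum>l\<in>UNIV. metric_inv G x $ m $ l *
     (pd i (\<lambda>y. G y $ j $ l) x + pd j (\<lambda>y. G y $ i $ l) x - pd l (\<lambda>y. G y $ i $ j) x))"

text \<open>\<open>curv_up G i j k m\<close> is the component $R_{ijk}{}^m$ in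
  $R(\partial_i,\partial_j)\partial_k = R_{ijk}{}^m\partial_m$ with
  $R(X,Y) = \nabla_X\nabla_Y-\nabla_Y\nabla_X-\nabla_{[X,Y]}$, so that
  $\mathrm{Ric}_{jk} = R^i{}_{jki} = R_{ijk}{}^i$ is positive on round spheres.\<close>

definition curv_up ::
    "(real^'k::finite \<Rightarrow> real^'k^'k) \<Rightarrow> 'k \<Rightarrow> 'k \<Rightarrow> 'k \<Rightarrow> 'k \<Rightarrow> real^'k \<Rightarrow> real" where
  "curv_up G i j k m x =
     pd i (christoffel G m j k) x - pd j (christoffel G m i k) x
     + (\<Sum>p\<in>UNIV. christoffel G m i p x * christoffel G p j k x
                 - christoffel G m j p x * christoffel G p i k x)"

definition ricci :: "(real^'k::finite \<Rightarrow> real^'k^'k) \<Rightarrow> real^'k \<Rightarrow> real^'k^'k" where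
  "ricci G x = (\<chi> j k. \<Sum>i\<in>UNIV. curv_up G i j k i x)"

definition scal :: "(real^'k::finite \<Rightarrow> real^'k^'k) \<Rightarrow> real^'k \<Rightarrow> real" where
  "scal G x = (\<Sum>i\<in>UNIV. \<Sum>j\<in>UNIV. metric_inv G x $ i $ j * ricci G x $ i $ j)"

definition J_scal :: "(real^'k::finite \<Rightarrow> real^'k^'k) \<Rightarrow> real^'k \<Rightarrow> real" where
  "J_scal G x = scal G x / (2 * (real CARD('k) - 1))"

definition schouten :: "(real^'k::finite \<Rightarrow> real^'k^'k) \<Rightarrow> real^'k \<Rightarrow> real^'k^'k" where
  "schouten G x = (1 / (real CARD('k) - 2)) *\<^sub>R (ricci G x - J_scal G x *\<^sub>R G x)"

text \<open>A covariant tensor of rank \<open>s\<close> is given by its components, indexed by lists of length \<open>s\<close>.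
  The covariant derivative puts the new index in front:
  \<open>cov_deriv G T (a # is)\<close> is $\nabla_a(T)_{is}$.\<close>

definition cov_deriv ::
    "(real^'k::finite \<Rightarrow> real^'k^'k) \<Rightarrow> ('k list \<Rightarrow> real^'k \<Rightarrow> real) \<Rightarrow> 'k list \<Rightarrow> real^'k \<Rightarrow> real" where
  "cov_deriv G T as x = (case as of [] \<Rightarrow> 0 | a # is \<Rightarrow>
     pd a (T is) x -
     (\<Sum>m<length is. \<Sum>l\<in>UNIV. christoffel G l a (is ! m) x * T (is[m := l]) x))"

definition riemann ::
    "(real^'k::finite \<Rightarrow> real^'k^'k) \<Rightarrow> 'k list \<Rightarrow> real^'k \<Rightarrow> real" where
  "riemann G is x =
     (\<Sum>m\<in>UNIV. G x $ (is ! 3) $ m * curv_up G (is ! 0) (is ! 1) (is ! 2) m x)"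

text \<open>The endomorphism $\omega_i \mapsto T_{ij}g^{jk}\omega_k$ of one-forms defined by a symmetric
  2-tensor \<open>T\<close>.\<close>

definition endo ::
    "(real^'k::finite \<Rightarrow> real^'k^'k) \<Rightarrow> (real^'k \<Rightarrow> real^'k^'k) \<Rightarrow> real^'k \<Rightarrow> real^'k^'k" where
  "endo G T x = T x ** metric_inv G x"


section \<open>Smooth manifolds and Riemannian metrics\<close>

text \<open>A manifold is a (second countable Hausdorff) type \<open>'m\<close> with a smooth atlas modelled on
  \<open>real^'n\<close>.  Tensor fields and their one-parameter families are families of component functions,
  one for each chart of the atlas, which transform by the tensor law.\<close>

type_synonym ('m, 'n) chart = "'m set \<times> ('m \<Rightarrow> real^'n)"
type_synonym ('m, 'n) tensor2 = "('m, 'n) chart \<Rightarrow> real^'n \<Rightarrow> real^'n^'n"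
type_synonym ('m, 'n) tensor2_family = "('m, 'n) chart \<Rightarrow> real \<Rightarrow> real^'n \<Rightarrow> real^'n^'n"

abbreviation cdom :: "('m, 'n::finite) chart \<Rightarrow> 'm set" where "cdom c \<equiv> fst c"
abbreviation coord :: "('m, 'n::finite) chart \<Rightarrow> 'm \<Rightarrow> real^'n" where "coord c \<equiv> snd c"
abbreviation cimg :: "('m, 'n::finite) chart \<Rightarrow> (real^'n) set" where "cimg c \<equiv> coord c ` cdom c"

definition cinv :: "('m, 'n::finite) chart \<Rightarrow> real^'n \<Rightarrow> 'm" where
  "cinv c = inv_into (cdom c) (coord c)"

definition smooth_atlas :: "('m::{t2_space,second_countable_topology}, 'n::finite) chart set \<Rightarrow> bool" where
  "smooth_atlas A \<longleftrightarrow>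
     (\<Union>c\<in>A. cdom c) = UNIV \<and>
     (\<forall>c\<in>A. open (cdom c) \<and> open (cimg c) \<and> homeomorphism (cdom c) (cimg c) (coord c) (cinv c)) \<and>
     (\<forall>c\<in>A. \<forall>c'\<in>A. \<forall>i.
        smooth_on (coord c ` (cdom c \<inter> cdom c')) (\<lambda>x. coord c' (cinv c x) $ i))"

definition smooth_fun :: "('m, 'n::finite) chart set \<Rightarrow> ('m \<Rightarrow> real) \<Rightarrow> bool" where
  "smooth_fun A u \<longleftrightarrow> (\<forall>c\<in>A. smooth_on (cimg c) (\<lambda>x. u (cinv c x)))"

definition transition_jacobian ::
    "('m, 'n::finite) chart \<Rightarrow> ('m, 'n) chart \<Rightarrow> 'm \<Rightarrow> real^'n^'n" where
  "transition_jacobian c c' p = (\<chi> a i. pd i (\<lambda>x. coord c' (cinv c x) $ a) (coord c p))"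

definition riemannian_metric :: "('m, 'n::finite) chart set \<Rightarrow> ('m, 'n) tensor2 \<Rightarrow> bool" where
  "riemannian_metric A g \<longleftrightarrow>
     (\<forall>c\<in>A. (\<forall>i j. smooth_on (cimg c) (\<lambda>x. g c x $ i $ j)) \<and>
        (\<forall>x\<in>cimg c. transpose (g c x) = g c x \<and> (\<forall>v. v \<noteq> 0 \<longrightarrow> v \<bullet> (g c x *v v) > 0))) \<and>
     (\<forall>c\<in>A. \<forall>c'\<in>A. \<forall>p\<in>cdom c \<inter> cdom c'.
        g c (coord c p) =
          transpose (transition_jacobian c c' p) ** g c' (coord c' p) ** transition_jacobian c c' p)"

text \<open>Coordinates on the product of a real interval with a chart: \<open>None\<close> is the index of the
  interval coordinate (\<open>r\<close> or \<open>\<rho>\<close>), \<open>Some i\<close> the index of the \<open>i\<close>-th chart coordinate.\<close>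

definition xpart :: "real^('n::finite option) \<Rightarrow> real^'n" where
  "xpart y = (\<chi> i. y $ Some i)"

definition cyl_point :: "real \<Rightarrow> real^'n::finite \<Rightarrow> real^('n option)" where
  "cyl_point r x = (\<chi> a. case a of None \<Rightarrow> r | Some i \<Rightarrow> x $ i)"

definition cylinder :: "real set \<Rightarrow> (real^'n::finite) set \<Rightarrow> (real^('n option)) set" where
  "cylinder I V = {y. y $ None \<in> I \<and> xpart y \<in> V}"

definition smooth_metric_family ::
    "('m, 'n::finite) chart set \<Rightarrow> real set \<Rightarrow> ('m, 'n) tensor2_family \<Rightarrow> bool" where
  "smooth_metric_family A I h \<longleftrightarrow>
     (\<forall>s\<in>I. riemannian_metric A (\<lambda>c. h c s)) \<and>
     (\<forall>c\<in>A. \<forall>i j. smooth_on (cylinder I (cimg c)) (\<lambda>y. h c (y $ None) (xpart y) $ i $ j))"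


section \<open>Poincare-Einstein metrics\<close>

definition pe_metric ::
    "(real \<Rightarrow> real^'n::finite \<Rightarrow> real^'n^'n) \<Rightarrow> real^('n option) \<Rightarrow> real^('n option)^('n option)" where
  "pe_metric h y = (\<chi> a b. (case (a, b) of
       (None, None) \<Rightarrow> 1
     | (Some i, Some j) \<Rightarrow> h (y $ None) (xpart y) $ i $ j
     | _ \<Rightarrow> 0) / (y $ None)\<^sup>2)"

definition einstein_defect ::
    "(real \<Rightarrow> real^'n::finite \<Rightarrow> real^'n^'n) \<Rightarrow> real \<Rightarrow> real^'n \<Rightarrow> real^('n option)^('n option)" where
  "einstein_defect h r x =
     ricci (pe_metric h) (cyl_point r x) + real CARD('n) *\<^sub>R pe_metric h (cyl_point r x)"

text \<open>\<open>h c r\<close> are the components of $g_r$ in the chart \<open>c\<close>.  That $g_r$ is smooth up to \<open>r = 0\<close> and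
  even in \<open>r\<close> means that its even extension to \<open>r < 0\<close> is smooth; we let \<open>h\<close> be this extension.
  Since the components of the defect times $r^2$ are smooth up to \<open>r = 0\<close>, its order of vanishing
  can be tested on each line \<open>x = const\<close>.  For even \<open>n\<close>, the last condition says that the tangential
  components of the coefficient of $r^{n-2}$ have vanishing \<open>g\<close>-trace.\<close>

definition poincare_einstein ::
    "('m, 'n::finite) chart set \<Rightarrow> ('m, 'n) tensor2 \<Rightarrow> real \<Rightarrow> ('m, 'n) tensor2_family \<Rightarrow> bool" where
  "poincare_einstein A g \<epsilon> h \<longleftrightarrow>
     0 < \<epsilon> \<and> smooth_metric_family A {-\<epsilon><..<\<epsilon>} h \<and>
     (\<forall>c\<in>A. \<forall>x\<in>cimg c. h c 0 x = g c x \<and> (\<forall>r\<in>{-\<epsilon><..<\<epsilon>}. h c (- r) x = h c r x)) \<and>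
     (\<forall>c\<in>A. \<forall>x\<in>cimg c.
        (odd CARD('n) \<longrightarrow>
           (\<forall>m a b. (\<lambda>r. einstein_defect (h c) r x $ a $ b) \<in> O[at_right 0](\<lambda>r. r ^ m))) \<and>
        (even CARD('n) \<longrightarrow>
           (\<forall>a b. (\<lambda>r. einstein_defect (h c) r x $ a $ b) \<in> O[at_right 0](\<lambda>r. r ^ (CARD('n) - 2))) \<and>
           ((\<lambda>r. (\<Sum>i\<in>UNIV. \<Sum>j\<in>UNIV. metric_inv (g c) x $ i $ j *
                   einstein_defect (h c) r x $ Some i $ Some j) / r ^ (CARD('n) - 2))
              \<longlongrightarrow> 0) (at_right 0)))"


section \<open>The ambient metric\<close>

datatype 'n amb = AT | AX 'n | AInf  \<comment> \<open>the coordinates $t$, $x^i$, $\rho$\<close>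

instance amb :: (finite) finite
proof
  have "(UNIV :: 'a amb set) = insert AT (insert AInf (range AX))"
    by (metis (mono_tags) UNIV_eq_I amb.exhaust insertCI rangeI)
  then show "finite (UNIV :: 'a amb set)"
    by (metis finite finite_imageI finite_insert)
qed

definition amb_point :: "real \<Rightarrow> real^'n::finite \<Rightarrow> real \<Rightarrow> real^('n amb)" where
  "amb_point t x \<rho> = (\<chi> a. case a of AT \<Rightarrow> t | AX i \<Rightarrow> x $ i | AInf \<Rightarrow> \<rho>)"

definition amb_x :: "real^('n::finite amb) \<Rightarrow> real^'n" where
  "amb_x y = (\<chi> i. y $ AX i)"

text \<open>$\tilde g = 2t\,dt\,d\rho + 2\rho\,dt^2 + t^2 g(\rho)$, where \<open>k \<rho>\<close> are the components of
  $g(\rho)$.\<close>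

definition amb_metric ::
    "(real \<Rightarrow> real^'n::finite \<Rightarrow> real^'n^'n) \<Rightarrow> real^('n amb) \<Rightarrow> real^('n amb)^('n amb)" where
  "amb_metric k y = (\<chi> a b. case (a, b) of
       (AT, AT) \<Rightarrow> 2 * y $ AInf
     | (AT, AInf) \<Rightarrow> y $ AT
     | (AInf, AT) \<Rightarrow> y $ AT
     | (AX i, AX j) \<Rightarrow> (y $ AT)\<^sup>2 * k (y $ AInf) (amb_x y) $ i $ j
     | _ \<Rightarrow> 0)"

text \<open>The relation $g(\rho) = g_r$, $\rho = -r^2/2$, fixes $g(\rho)$ for $\rho\le 0$; to make
  \<open>\<rho>\<close>-derivatives at \<open>\<rho> = 0\<close> meaningful, $g(\rho)$ is a smooth family for $|\rho| < \eta$.\<close>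

definition ambient_family ::
    "('m, 'n::finite) chart set \<Rightarrow> real \<Rightarrow> ('m, 'n) tensor2_family \<Rightarrow> real \<Rightarrow> ('m, 'n) tensor2_family \<Rightarrow> bool" where
  "ambient_family A \<epsilon> h \<eta> k \<longleftrightarrow>
     0 < \<eta> \<and> smooth_metric_family A {-\<eta><..<\<eta>} k \<and>
     (\<forall>c\<in>A. \<forall>x\<in>cimg c. \<forall>r\<in>{-\<epsilon><..<\<epsilon>}. r\<^sup>2 / 2 < \<eta> \<longrightarrow> k c (- (r\<^sup>2 / 2)) x = h c r x)"

definition ext_obstruction ::
    "(real \<Rightarrow> real^'n::finite \<Rightarrow> real^'n^'n) \<Rightarrow> nat \<Rightarrow> real^'n \<Rightarrow> real^'n^'n" where
  "ext_obstruction k m x = (\<chi> i j.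
     - (cov_deriv (amb_metric k) ^^ (m - 1)) (riemann (amb_metric k))
         (replicate (m - 1) AInf @ [AInf, AX i, AX j, AInf]) (amb_point 1 x 0))"

definition smooth_extension ::
    "('m, 'n::finite) chart set \<Rightarrow> real \<Rightarrow> ('m \<Rightarrow> real) \<Rightarrow> ('m \<Rightarrow> real \<Rightarrow> real) \<Rightarrow> bool" where
  "smooth_extension A \<eta> u U \<longleftrightarrow>
     (\<forall>c\<in>A. smooth_on (cylinder {-\<eta><..<\<eta>} (cimg c)) (\<lambda>y. U (cinv c (xpart y)) (y $ None))) \<and>
     (\<forall>p. U p 0 = u p)"

text \<open>\<open>P\<close> is the GJMS-operator $P_{2N}$.  The right-hand side of the defining formula depends neither
  on the extension \<open>U\<close> nor on the chart used to compute it (for even \<open>n\<close>, this requires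
  $2N\le n$), so that this determines \<open>P\<close> on smooth functions.\<close>

definition gjms_operator ::
    "('m, 'n::finite) chart set \<Rightarrow> real \<Rightarrow> ('m, 'n) tensor2_family \<Rightarrow> nat \<Rightarrow>
     (('m \<Rightarrow> real) \<Rightarrow> 'm \<Rightarrow> real) \<Rightarrow> bool" where
  "gjms_operator A \<eta> k N P \<longleftrightarrow>
     (\<forall>u U. smooth_fun A u \<longrightarrow> smooth_extension A \<eta> u U \<longrightarrow>
       (\<forall>c\<in>A. \<forall>p\<in>cdom c. P u p =
          (laplacian (amb_metric (k c)) ^^ N)
            (\<lambda>y. (y $ AT) powr (real N - real CARD('n) / 2) * U (cinv c (amb_x y)) (y $ AInf))
            (amb_point 1 (coord c p) 0)))"


section \<open>Functions on the manifold given by coordinate expressions\<close>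

text \<open>The functions below are given by coordinate expressions which do not depend on the chart.\<close>

definition chart_at :: "('m, 'n::finite) chart set \<Rightarrow> 'm \<Rightarrow> ('m, 'n) chart" where
  "chart_at A p = (SOME c. c \<in> A \<and> p \<in> cdom c)"

text \<open>$w(r) = \sqrt{\mathrm{vol}(g_r)/\mathrm{vol}(g)}$ is the square root of a ratio of volume densities.\<close>

definition w_fun ::
    "('m, 'n::finite) chart set \<Rightarrow> ('m, 'n) tensor2 \<Rightarrow> ('m, 'n) tensor2_family \<Rightarrow> real \<Rightarrow> 'm \<Rightarrow> real" where
  "w_fun A g h r p = (let c = chart_at A p in
     sqrt (vol_density (h c r) (coord c p) / vol_density (g c) (coord c p)))"

definition w_coeff ::
    "('m, 'n::finite) chart set \<Rightarrow> ('m, 'n) tensor2 \<Rightarrow> ('m, 'n) tensor2_family \<Rightarrow> nat \<Rightarrow> 'm \<Rightarrow> real" where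
  "w_coeff A g h j p = (deriv ^^ j) (\<lambda>r. w_fun A g h r p) 0 / fact j"

text \<open>The operator \<open>u \<mapsto> \<delta>(T du)\<close> for an endomorphism field \<open>T\<close> of one-forms.\<close>

definition delta_endo_d ::
    "('m, 'n::finite) chart set \<Rightarrow> ('m, 'n) tensor2 \<Rightarrow> ('m, 'n) tensor2 \<Rightarrow> ('m \<Rightarrow> real) \<Rightarrow> 'm \<Rightarrow> real" where
  "delta_endo_d A g T u p = (let c = chart_at A p in
     codiff (g c) (\<lambda>x. T c x *v dform (\<lambda>z. u (cinv c z)) x) (coord c p))"

end

theory Submission
  imports Defs
begin

text \<open>
  The formula is a computation with the ambient metric, in one chart and on the cylinder of pairs
  $(x,\rho)$.  The Laplacian of the ambient metric maps $t^\gamma\varphi(x,\rho)$ to $t^{\gamma-2}$ times a second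
  order operator applied to $\varphi$ (\<open>laplacian_amb\<close>).  After conjugation by the square root
  $W=w$ of the volume ratio, this operator becomes
  \[ D_s = -2\rho\,\partial_\rho^2 + s\,\partial_\rho + M(\rho), \qquad s = 2\gamma+n-2, \qquad
     M(\rho) = -\delta(g(\rho)^{-1}d) + Q(\rho), \]
  with $\delta$ taken with respect to the fixed metric $g$ and with a potential $Q$ that does not depend on
  $\gamma$ (\<open>amb_op_conj\<close>).  Hence $P_{2N}$ is the composition of $N$ operators $D_s$ with
  $s = 2N-2, 2N-6, \ldots, 2-2N$, restricted to $\rho=0$.  As any extension of $u$ may be used, one takes
  $u/W$, which the conjugation turns into a function independent of $\rho$.

  Let $m_j$ be the $j$-th derivative of $M(\rho)$ at $\rho=0$.  From $\partial_\rho D_s = D_{s-2}\partial_\rho + M'(\rho)$ one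
  computes the normal derivatives of the factors one after the other (\<open>jet_Dop\<close>, \<open>gjms_slice\<close>) and finds
  $P_2=m_0$, $P_4=m_0^2-2m_1$, $P_6=m_0^3-4(m_1m_0+m_0m_1)+8m_2$ and an expression for $P_8$ in which
  $m_3$ occurs only as $-48\,m_3$.  Thus $\mathcal M_4=-2m_1$ and $\mathcal M_6=8m_2$, all products in the formula
  for $P_8$ are accounted for, and it remains to identify $-48\,m_3$ with the divergence term plus $\mu_8$.

  The divergence part of $m_3$ is given by the third derivative of $g(\rho)^{-1}$.  The curvature of the ambient
  metric expresses $\Omega^{(1)}$ and $\Omega^{(2)}$ by the first three derivatives of $g(\rho)$
  (\<open>ext_obstruction_eq\<close>), and the Einstein condition gives $g'(0)=2\mathsf P$ (\<open>Hd_1_schouten\<close>); solving for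
  the derivatives yields the tensor in the formula (\<open>Xd_3_eq\<close>).  The potential of $m_3$ need not be
  computed from $Q$: applied to $W$, the operator $D_s$ is the ambient Laplacian of a pure power of $t$, which
  gives $M(\rho)W = (2-n)W'+2\rho W''$ (\<open>div0_W\<close>).  Three derivatives of this relation at $\rho=0$ express
  $m_3(1)$ by $m_2(W^{(1)})$, $m_1(W^{(2)})$, $m_0(W^{(3)})$ and $W^{(4)}$ (\<open>mop_W\<close>), and $\rho=-r^2/2$ converts the derivatives of
  $W$ to the coefficients $w_{2j}$ (\<open>w_coeff_chart\<close>).
\<close>

section \<open>Calculus of smooth functions of several real variables\<close>

text \<open>Smoothness in a neighbourhood of a point.  Unlike smoothness on a set, it gives rules for partial
  derivatives whose side conditions mention only the function and the point that occur in the goal.\<close>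

definition smooth_at :: "(real^'k::finite \<Rightarrow> real) \<Rightarrow> real^'k \<Rightarrow> bool" where
  "smooth_at f x \<longleftrightarrow> (\<exists>S. x \<in> S \<and> smooth_on S f)"

lemma smooth_onD: "smooth_on S f \<Longrightarrow> x \<in> S \<Longrightarrow> smooth_at f x"
  by (auto simp: smooth_at_def)

lemma pd_cong_open:
  assumes "open S" "x \<in> S" "\<And>y. y \<in> S \<Longrightarrow> f y = g y"
  shows "pd i f x = pd i g x"
proof -
  have "(f has_derivative D) (at x) = (g has_derivative D) (at x)" for D
    using has_derivative_transform_within_open[of f D x UNIV S g]
      has_derivative_transform_within_open[of g D x UNIV S f] assms by auto
  then show ?thesis by (simp add: pd_def frechet_derivative_def)
qed

lemma smooth_on_open: "smooth_on S f \<Longrightarrow> open S"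
  by (simp add: smooth_on_def)

lemma smooth_on_pd: "smooth_on S f \<Longrightarrow> smooth_on S (pd i f)"
  unfolding smooth_on_def
proof (elim conjE, intro conjI allI)
  fix ks assume "\<forall>ks. foldr pd ks f differentiable_on S"
  then have "foldr pd (ks @ [i]) f differentiable_on S" by blast
  then show "foldr pd ks (pd i f) differentiable_on S" by simp
qed

text \<open>The set \<open>A\<close> need only contain the partial derivatives of its members up to equality on \<open>S\<close>:
  as \<open>S\<close> is open, functions that agree on \<open>S\<close> have partial derivatives that agree on \<open>S\<close>.\<close>

lemma smooth_on_coinduct:
  assumes S: "open S" and f: "f \<in> A"
    and diff: "\<And>f. f \<in> A \<Longrightarrow> f differentiable_on S"
    and pd: "\<And>f i. f \<in> A \<Longrightarrow> \<exists>g\<in>A. \<forall>x\<in>S. pd i f x = g x"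
  shows "smooth_on S f"
proof -
  have *: "\<exists>g\<in>A. \<forall>x\<in>S. foldr pd ks f x = g x" for ks
  proof (induction ks)
    case Nil
    then show ?case using f by auto
  next
    case (Cons k ks)
    then obtain g where g: "g \<in> A" "\<forall>x\<in>S. foldr pd ks f x = g x" by blast
    obtain g' where g': "g' \<in> A" "\<forall>x\<in>S. pd k g x = g' x" using pd[OF g(1)] by blast
    have "\<forall>x\<in>S. foldr pd (k # ks) f x = g' x"
      using pd_cong_open[OF S, of _ "foldr pd ks f" g k] g g' by auto
    then show ?case using g' by blast
  qed
  have "foldr pd ks f differentiable_on S" for ks
  proof -
    obtain g where g: "g \<in> A" "\<forall>x\<in>S. foldr pd ks f x = g x" using * by blast
    have "g differentiable_on S" using diff g by blast
    then show ?thesis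
      using g(2) differentiable_transform_within[of g _ S 1 "foldr pd ks f"] unfolding differentiable_on_def
      by (metis zero_less_one)
  qed
  then show ?thesis using S by (simp add: smooth_on_def)
qed

lemma smooth_on_differentiable: "smooth_on S f \<Longrightarrow> x \<in> S \<Longrightarrow> f differentiable (at x)"
  using smooth_on_imp_c1_on by (auto simp: c1_on_def)

lemma smooth_at_differentiable: "smooth_at f x \<Longrightarrow> f differentiable (at x)"
  by (auto simp: smooth_at_def smooth_on_differentiable)

lemma smooth_at_has_derivative:
  "smooth_at f x \<Longrightarrow> (f has_derivative frechet_derivative f (at x)) (at x)"
  using smooth_at_differentiable frechet_derivative_works by blast

lemma smooth_on_iff_smooth_at: "smooth_on S f \<longleftrightarrow> open S \<and> (\<forall>x\<in>S. smooth_at f x)"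
proof (intro iffI conjI ballI)
  assume R: "open S \<and> (\<forall>x\<in>S. smooth_at f x)"
  show "smooth_on S f"
  proof (rule smooth_on_coinduct[where A = "{f. \<forall>x\<in>S. smooth_at f x}"])
    show "f differentiable_on S" if "f \<in> {f. \<forall>x\<in>S. smooth_at f x}" for f
      using that R smooth_at_differentiable by (auto simp: differentiable_on_eq_differentiable_at)
    show "\<exists>g\<in>{f. \<forall>x\<in>S. smooth_at f x}. \<forall>x\<in>S. pd i f x = g x"
      if "f \<in> {f. \<forall>x\<in>S. smooth_at f x}" for f i
      using that smooth_on_pd by (intro bexI[of _ "pd i f"]) (auto simp: smooth_at_def, blast)
  qed (use R in auto)
qed (auto simp: smooth_on_open smooth_onD)

lemma smooth_on_subset: "smooth_on S f \<Longrightarrow> open T \<Longrightarrow> T \<subseteq> S \<Longrightarrow> smooth_on T f"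
  by (auto simp: smooth_on_iff_smooth_at)

lemma smooth_on_cong:
  assumes "smooth_on S f" "\<And>x. x \<in> S \<Longrightarrow> f x = g x" shows "smooth_on S g"
proof (rule smooth_on_coinduct[where A = "{g. \<exists>f. smooth_on S f \<and> (\<forall>x\<in>S. f x = g x)}"])
  show op: "open S" using assms smooth_on_open by blast
  show "g \<in> {g. \<exists>f. smooth_on S f \<and> (\<forall>x\<in>S. f x = g x)}" using assms by blast
  fix h assume "h \<in> {g. \<exists>f. smooth_on S f \<and> (\<forall>x\<in>S. f x = g x)}"
  then obtain f where f: "smooth_on S f" "\<forall>x\<in>S. f x = h x" by blast
  have "f differentiable_on S"
    using f smooth_on_differentiable op by (auto simp: differentiable_on_eq_differentiable_at)
  then show "h differentiable_on S"
    using f(2) differentiable_transform_within[of f _ S 1 h] unfolding differentiable_on_def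
    by (metis zero_less_one)
  show "\<exists>g\<in>{g. \<exists>f. smooth_on S f \<and> (\<forall>x\<in>S. f x = g x)}. \<forall>x\<in>S. pd i h x = g x" for i
    using f pd_cong_open[OF op, of _ f h i] smooth_on_pd[OF f(1)]
    by (intro bexI[of _ "pd i f"]) auto
qed

text \<open>The functions obtained from smooth ones by the operations under which smoothness should be
  stable; the product rule and its relatives keep the partial derivatives in this set, so that all
  stability statements follow at once by coinduction.\<close>

inductive_set smooth_closure ::
    "(real^'k::finite) set \<Rightarrow> (real^'l::finite) set \<Rightarrow> (real^'k \<Rightarrow> real^'l) \<Rightarrow> (real^'k \<Rightarrow> real) set"
  for S T L where
  base: "smooth_on S f \<Longrightarrow> f \<in> smooth_closure S T L"
| const: "(\<lambda>x. c) \<in> smooth_closure S T L"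
| pull: "smooth_on T h \<Longrightarrow> (\<lambda>x. h (L x)) \<in> smooth_closure S T L"
| add: "f \<in> smooth_closure S T L \<Longrightarrow> h \<in> smooth_closure S T L \<Longrightarrow> (\<lambda>x. f x + h x) \<in> smooth_closure S T L"
| mult: "f \<in> smooth_closure S T L \<Longrightarrow> h \<in> smooth_closure S T L \<Longrightarrow> (\<lambda>x. f x * h x) \<in> smooth_closure S T L"
| powr: "f \<in> smooth_closure S T L \<Longrightarrow> (\<And>x. x \<in> S \<Longrightarrow> f x > 0) \<Longrightarrow> (\<lambda>x. f x powr a) \<in> smooth_closure S T L"
| inv: "f \<in> smooth_closure S T L \<Longrightarrow> (\<And>x. x \<in> S \<Longrightarrow> f x \<noteq> 0) \<Longrightarrow> (\<lambda>x. inverse (f x)) \<in> smooth_closure S T L"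

lemma smooth_closure_sum:
  "(\<And>b. b \<in> I \<Longrightarrow> f b \<in> smooth_closure S T L) \<Longrightarrow> (\<lambda>x. \<Sum>b\<in>I. f b x) \<in> smooth_closure S T L"
  by (induction I rule: infinite_finite_induct)
     (auto intro: smooth_closure.const smooth_closure.add)

lemma linear_axis_expansion:
  fixes D :: "real^'k::finite \<Rightarrow> real"
  assumes "linear D"
  shows "D v = (\<Sum>b\<in>UNIV. v $ b * D (axis b 1))"
proof -
  have "D v = D (\<Sum>b\<in>UNIV. v $ b *\<^sub>R axis b 1)" by (simp add: basis_expansion flip: scalar_mult_eq_scaleR)
  also have "\<dots> = (\<Sum>b\<in>UNIV. v $ b * D (axis b 1))"
    using assms by (simp add: linear_sum linear_cmul)
  finally show ?thesis .
qed

lemma pd_compose: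
  fixes L :: "real^'k::finite \<Rightarrow> real^'l::finite"
  assumes "f differentiable (at (L x))" "(L has_derivative L') (at x)"
  shows "((\<lambda>y. f (L y)) has_derivative (\<lambda>v. \<Sum>b\<in>UNIV. L' v $ b * pd b f (L x))) (at x)"
    "pd i (\<lambda>y. f (L y)) x = (\<Sum>b\<in>UNIV. L' (axis i 1) $ b * pd b f (L x))"
proof -
  have f: "(f has_derivative frechet_derivative f (at (L x))) (at (L x))"
    using assms(1) frechet_derivative_works by blast
  have "((\<lambda>y. f (L y)) has_derivative (\<lambda>v. frechet_derivative f (at (L x)) (L' v))) (at x)"
    by (rule has_derivative_compose[OF assms(2) f])
  moreover have "frechet_derivative f (at (L x)) (L' v) = (\<Sum>b\<in>UNIV. L' v $ b * pd b f (L x))" for v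
    unfolding pd_def by (rule linear_axis_expansion[OF has_derivative_linear[OF f]])
  ultimately show 1: "((\<lambda>y. f (L y)) has_derivative (\<lambda>v. \<Sum>b\<in>UNIV. L' v $ b * pd b f (L x))) (at x)"
    by simp
  show "pd i (\<lambda>y. f (L y)) x = (\<Sum>b\<in>UNIV. L' (axis i 1) $ b * pd b f (L x))"
    using pd_eqI[OF 1] .
qed

lemma has_derivative_real_compose:
  assumes "(f has_derivative f') (at x)" "(\<phi> has_real_derivative d) (at (f x))"
  shows "((\<lambda>y. \<phi> (f y)) has_derivative (\<lambda>v. d * f' v)) (at x)"
  by (rule has_derivative_compose[OF assms(1) assms(2)[unfolded has_field_derivative_def]])

lemma smooth_closure_smooth:
  fixes L :: "real^'k::finite \<Rightarrow> real^'l::finite"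
  assumes S: "open S" and L: "\<And>x. x \<in> S \<Longrightarrow> (L has_derivative L') (at x)"
    and ST: "\<And>x. x \<in> S \<Longrightarrow> L x \<in> T" and f: "f \<in> smooth_closure S T L"
  shows "smooth_on S f"
proof -
  have *: "(\<forall>x\<in>S. f differentiable (at x)) \<and> (\<forall>i. \<exists>g\<in>smooth_closure S T L. \<forall>x\<in>S. pd i f x = g x)"
    if "f \<in> smooth_closure S T L" for f
    using that
  proof induction
    case (base f)
    then show ?case using smooth_on_differentiable smooth_on_pd smooth_closure.base by blast
  next
    case (const c)
    have "pd i (\<lambda>x. c) x = 0" for i x by (rule pd_eqI) simp
    then show ?case by (auto intro!: bexI[OF _ smooth_closure.const])
  next
    case (pull h)
    have d: "h differentiable (at (L x))" if "x \<in> S" for x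
      using pull ST[OF that] smooth_on_differentiable by blast
    have mem: "(\<lambda>x. \<Sum>b\<in>UNIV. L' (axis i 1) $ b * pd b h (L x)) \<in> smooth_closure S T L" for i
      by (intro smooth_closure_sum smooth_closure.mult smooth_closure.const
            smooth_closure.pull smooth_on_pd pull)
    show ?case
    proof (intro conjI ballI allI)
      show "(\<lambda>x. h (L x)) differentiable (at x)" if "x \<in> S" for x
        using pd_compose(1)[OF d[OF that] L[OF that]] unfolding differentiable_def by blast
      show "\<exists>g\<in>smooth_closure S T L. \<forall>x\<in>S. pd i (\<lambda>x. h (L x)) x = g x" for i
        by (rule bexI[OF _ mem[of i]]) (use pd_compose(2)[OF d L] in auto)
    qed
  next
    case (add f h)
    have "((\<lambda>x. f x + h x) has_derivative (\<lambda>v. frechet_derivative f (at x) v + frechet_derivative h (at x) v)) (at x)"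
      if "x \<in> S" for x
      using add that frechet_derivative_works by (intro has_derivative_add) auto
    then have "pd i (\<lambda>x. f x + h x) x = pd i f x + pd i h x" if "x \<in> S" for i x
      using pd_eqI that unfolding pd_def by blast
    moreover have "(\<exists>g\<in>smooth_closure S T L. \<forall>x\<in>S. pd i f x + pd i h x = g x)" for i
    proof -
      obtain g1 g2 where "g1 \<in> smooth_closure S T L" "g2 \<in> smooth_closure S T L"
        "\<forall>x\<in>S. pd i f x = g1 x" "\<forall>x\<in>S. pd i h x = g2 x" using add.IH by blast
      then show ?thesis
        by (intro bexI[of _ "\<lambda>x. g1 x + g2 x"] smooth_closure.add) auto
    qed
    ultimately show ?case using add by auto
  next
    case (mult f h)
    have "((\<lambda>x. f x * h x) has_derivative (\<lambda>v. f x * frechet_derivative h (at x) v + frechet_derivative f (at x) v * h x)) (at x)"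
      if "x \<in> S" for x
      using mult that frechet_derivative_works by (intro has_derivative_mult) auto
    then have "pd i (\<lambda>x. f x * h x) x = f x * pd i h x + pd i f x * h x" if "x \<in> S" for i x
      using pd_eqI that unfolding pd_def by blast
    moreover have "(\<exists>g\<in>smooth_closure S T L. \<forall>x\<in>S. f x * pd i h x + pd i f x * h x = g x)" for i
    proof -
      obtain g1 g2 where "g1 \<in> smooth_closure S T L" "g2 \<in> smooth_closure S T L"
        "\<forall>x\<in>S. pd i f x = g1 x" "\<forall>x\<in>S. pd i h x = g2 x" using mult.IH by blast
      then show ?thesis
        using mult.hyps by (intro bexI[of _ "\<lambda>x. f x * g2 x + g1 x * h x"]
          smooth_closure.add smooth_closure.mult) auto
    qed
    ultimately show ?case using mult by auto
  next
    case (powr f a)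
    have D: "((\<lambda>x. f x powr a) has_derivative (\<lambda>v. (a * f x powr (a - 1)) * frechet_derivative f (at x) v)) (at x)"
      if "x \<in> S" for x
      by (rule has_derivative_real_compose[where \<phi> = "\<lambda>z. z powr a"])
         (use powr that frechet_derivative_works in \<open>auto intro!: has_real_derivative_powr\<close>)
    then have "pd i (\<lambda>x. f x powr a) x = (a * f x powr (a - 1)) * pd i f x" if "x \<in> S" for i x
      using pd_eqI that unfolding pd_def by blast
    moreover have "(\<exists>g\<in>smooth_closure S T L. \<forall>x\<in>S. (a * f x powr (a - 1)) * pd i f x = g x)" for i
    proof -
      obtain g1 where "g1 \<in> smooth_closure S T L" "\<forall>x\<in>S. pd i f x = g1 x" using powr.IH by blast
      then show ?thesis
        using powr.hyps by (intro bexI[of _ "\<lambda>x. (a * f x powr (a - 1)) * g1 x"]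
          smooth_closure.mult smooth_closure.const smooth_closure.powr) auto
    qed
    moreover have "(\<lambda>x. f x powr a) differentiable (at x)" if "x \<in> S" for x
      using D[OF that] unfolding differentiable_def by blast
    ultimately show ?case by auto
  next
    case (inv f)
    have D: "((\<lambda>x. inverse (f x)) has_derivative (\<lambda>v. (- (inverse (f x) * inverse (f x))) * frechet_derivative f (at x) v)) (at x)"
      if "x \<in> S" for x
      by (rule has_derivative_real_compose[where \<phi> = inverse])
         (use inv that frechet_derivative_works DERIV_inverse[of "f x" UNIV] in \<open>auto simp: power2_eq_square\<close>)
    then have "pd i (\<lambda>x. inverse (f x)) x = (- (inverse (f x) * inverse (f x))) * pd i f x" if "x \<in> S" for i x
      using pd_eqI that unfolding pd_def by blast
    moreover have "(\<exists>g\<in>smooth_closure S T L. \<forall>x\<in>S. (- (inverse (f x) * inverse (f x))) * pd i f x = g x)" for i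
    proof -
      obtain g1 where "g1 \<in> smooth_closure S T L" "\<forall>x\<in>S. pd i f x = g1 x" using inv.IH by blast
      then show ?thesis
        using inv.hyps by (intro bexI[of _ "\<lambda>x. ((-1) * (inverse (f x) * inverse (f x))) * g1 x"]
          smooth_closure.mult smooth_closure.const smooth_closure.inv) auto
    qed
    moreover have "(\<lambda>x. inverse (f x)) differentiable (at x)" if "x \<in> S" for x
      using D[OF that] unfolding differentiable_def by blast
    ultimately show ?case by auto
  qed
  show ?thesis
    by (rule smooth_on_coinduct[OF S f]) (use * S in \<open>auto simp: differentiable_on_eq_differentiable_at\<close>)
qed

lemma smooth_closure_id:
  "open S \<Longrightarrow> f \<in> smooth_closure S S (\<lambda>x. x) \<Longrightarrow> smooth_on S f"
  by (rule smooth_closure_smooth[where L' = "\<lambda>v. v"]) auto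

lemma smooth_at_isCont: "smooth_at f x \<Longrightarrow> isCont f x"
  using smooth_at_differentiable differentiable_imp_continuous_within by blast

lemma smooth_at_nbhd:
  assumes "smooth_at f x" "open P" "f x \<in> P"
  shows "\<exists>S. x \<in> S \<and> smooth_on S f \<and> (\<forall>y\<in>S. f y \<in> P)"
proof -
  obtain S where S: "x \<in> S" "smooth_on S f" using assms by (auto simp: smooth_at_def)
  have "continuous_on S f" using smooth_on_imp_c1_on[OF S(2)] c1_on_continuous by blast
  then have "open (S \<inter> f -` P)"
    using S(2) smooth_on_open continuous_on_open_vimage assms(2) by (metis Int_commute)
  then have "smooth_on (S \<inter> f -` P) f" using S(2) smooth_on_subset by blast
  then show ?thesis using S(1) assms(3) by (intro exI[of _ "S \<inter> f -` P"]) simp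
qed

lemma smooth_at_const [simp]: "smooth_at (\<lambda>x. c) x"
  using smooth_onD[OF smooth_closure_id[OF open_UNIV smooth_closure.const]] by blast

lemma smooth_at_pd [simp]: "smooth_at f x \<Longrightarrow> smooth_at (pd i f) x"
  using smooth_on_pd by (auto simp: smooth_at_def)

lemma smooth_at_two:
  assumes "smooth_at f x" "smooth_at h x"
  obtains S where "x \<in> S" "smooth_on S f" "smooth_on S h"
proof -
  obtain S T where "x \<in> S" "smooth_on S f" "x \<in> T" "smooth_on T h"
    using assms by (auto simp: smooth_at_def)
  then show thesis
    by (intro that[of "S \<inter> T"]) (auto intro: smooth_on_subset simp: smooth_on_open open_Int)
qed

lemma smooth_at_add [simp]:
  assumes "smooth_at f x" "smooth_at h x" shows "smooth_at (\<lambda>y. f y + h y) x"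
proof -
  obtain S where S: "x \<in> S" "smooth_on S f" "smooth_on S h" using smooth_at_two[OF assms] .
  have "smooth_on S (\<lambda>y. f y + h y)"
    by (rule smooth_closure_id[OF smooth_on_open[OF S(2)] smooth_closure.add[OF smooth_closure.base[OF S(2)] smooth_closure.base[OF S(3)]]])
  then show ?thesis using S(1) smooth_onD by blast
qed

lemma smooth_at_mult [simp]:
  assumes "smooth_at f x" "smooth_at h x" shows "smooth_at (\<lambda>y. f y * h y) x"
proof -
  obtain S where S: "x \<in> S" "smooth_on S f" "smooth_on S h" using smooth_at_two[OF assms] .
  have "smooth_on S (\<lambda>y. f y * h y)"
    by (rule smooth_closure_id[OF smooth_on_open[OF S(2)] smooth_closure.mult[OF smooth_closure.base[OF S(2)] smooth_closure.base[OF S(3)]]])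
  then show ?thesis using S(1) smooth_onD by blast
qed

lemma smooth_at_minus [simp]: "smooth_at f x \<Longrightarrow> smooth_at (\<lambda>y. - f y) x"
  using smooth_at_mult[of "\<lambda>_. -1" x f] by simp

lemma smooth_at_diff [simp]: "smooth_at f x \<Longrightarrow> smooth_at h x \<Longrightarrow> smooth_at (\<lambda>y. f y - h y) x"
  using smooth_at_add[of f x "\<lambda>y. - h y"] by simp

lemma smooth_at_inverse [simp]:
  assumes "smooth_at f x" "f x \<noteq> 0" shows "smooth_at (\<lambda>y. inverse (f y)) x"
proof -
  have P: "open (- {0} :: real set)" "f x \<in> - {0}" using assms(2) by auto
  obtain S where S: "x \<in> S \<and> smooth_on S f \<and> (\<forall>y\<in>S. f y \<in> - {0})"
    using smooth_at_nbhd[OF assms(1) P] by (rule exE)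
  then have "smooth_on S (\<lambda>y. inverse (f y))"
    using smooth_on_open by (intro smooth_closure_id[OF _ smooth_closure.inv[OF smooth_closure.base]]) auto
  then show ?thesis using S smooth_onD by blast
qed

lemma smooth_at_powr [simp]:
  assumes "smooth_at f x" "f x > 0" shows "smooth_at (\<lambda>y. f y powr a) x"
proof -
  have P: "open ({0<..} :: real set)" "f x \<in> {0<..}" using assms(2) by auto
  obtain S where S: "x \<in> S \<and> smooth_on S f \<and> (\<forall>y\<in>S. f y \<in> {0<..})"
    using smooth_at_nbhd[OF assms(1) P] by (rule exE)
  then have "smooth_on S (\<lambda>y. f y powr a)"
    using smooth_on_open by (intro smooth_closure_id[OF _ smooth_closure.powr[OF smooth_closure.base]]) auto
  then show ?thesis using S smooth_onD by blast
qed

lemma smooth_at_divide [simp]: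
  "smooth_at f x \<Longrightarrow> smooth_at h x \<Longrightarrow> h x \<noteq> 0 \<Longrightarrow> smooth_at (\<lambda>y. f y / h y) x"
  by (simp add: divide_inverse)

lemma smooth_at_sum [simp]:
  "(\<And>b. b \<in> I \<Longrightarrow> smooth_at (f b) x) \<Longrightarrow> smooth_at (\<lambda>y. \<Sum>b\<in>I. f b y) x"
  by (induction I rule: infinite_finite_induct) auto

lemma smooth_at_prod [simp]:
  "(\<And>b. b \<in> I \<Longrightarrow> smooth_at (f b) x) \<Longrightarrow> smooth_at (\<lambda>y. \<Prod>b\<in>I. f b y) x"
  by (induction I rule: infinite_finite_induct) auto

lemma smooth_at_power [simp]: "smooth_at f x \<Longrightarrow> smooth_at (\<lambda>y. f y ^ m) x"
  by (induction m) auto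

lemma smooth_at_cong:
  assumes "smooth_at f x" "open S" "x \<in> S" "\<And>y. y \<in> S \<Longrightarrow> f y = g y"
  shows "smooth_at g x"
proof -
  obtain T where T: "x \<in> T" "smooth_on T f" using assms by (auto simp: smooth_at_def)
  have "smooth_on (S \<inter> T) g"
    using smooth_on_cong[OF smooth_on_subset[OF T(2), of "S \<inter> T"]] assms T smooth_on_open by blast
  then show ?thesis using T assms by (auto simp: smooth_at_def)
qed

lemma smooth_at_affine:
  fixes L :: "real^'k::finite \<Rightarrow> real^'l::finite"
  assumes "smooth_at f (L x)" and L: "\<And>x. (L has_derivative L') (at x)"
  shows "smooth_at (\<lambda>y. f (L y)) x"
proof -
  obtain T where T: "L x \<in> T" "smooth_on T f" using assms by (auto simp: smooth_at_def)
  have "continuous_on UNIV L"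
    by (intro continuous_at_imp_continuous_on ballI has_derivative_continuous[OF L])
  then have "open (L -` T)" using T(2) smooth_on_open open_vimage by blast
  then show ?thesis unfolding smooth_at_def using T
    by (intro exI[of _ "L -` T"])
       (auto intro!: smooth_closure_smooth[OF _ L, of "L -` T" T] smooth_closure.pull)
qed

lemma smooth_at_coord [simp]: "smooth_at (\<lambda>y. y $ a) x"
proof -
  have d: "(\<lambda>y::real^'a. y $ a) differentiable_on UNIV"
    by (simp add: differentiable_on_def bounded_linear_imp_differentiable bounded_linear_vec_nth)
  have p: "pd i (\<lambda>y::real^'a. y $ a) x = axis i 1 $ a" for i x
    by (rule pd_eqI) (rule bounded_linear_imp_has_derivative[OF bounded_linear_vec_nth])
  have "smooth_on UNIV (\<lambda>y::real^'a. y $ a)"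
    by (rule smooth_on_coinduct[where A = "insert (\<lambda>y. y $ a) (range (\<lambda>c x. c))"])
       (use d p in \<open>auto simp: pd_eqI[OF has_derivative_const]\<close>)
  then show ?thesis by (auto simp: smooth_at_def)
qed

lemma pd_const [simp]: "pd i (\<lambda>x. c) x = 0"
  by (rule pd_eqI) simp

lemma pd_coord [simp]: "pd i (\<lambda>y. y $ a) x = (if a = i then 1 else 0)"
proof -
  have "pd i (\<lambda>y. y $ a) x = axis i 1 $ a"
    by (rule pd_eqI) (rule bounded_linear_imp_has_derivative[OF bounded_linear_vec_nth])
  then show ?thesis by (simp add: axis_def)
qed

lemma pd_add:
  "smooth_at f x \<Longrightarrow> smooth_at h x \<Longrightarrow> pd i (\<lambda>y. f y + h y) x = pd i f x + pd i h x"
  using pd_eqI[OF has_derivative_add[OF smooth_at_has_derivative smooth_at_has_derivative]]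
  unfolding pd_def .

lemma pd_mult:
  "smooth_at f x \<Longrightarrow> smooth_at h x \<Longrightarrow> pd i (\<lambda>y. f y * h y) x = pd i f x * h x + f x * pd i h x"
  using pd_eqI[OF has_derivative_mult[OF smooth_at_has_derivative smooth_at_has_derivative]]
  unfolding pd_def by (simp add: add.commute)

lemma pd_cmult: "smooth_at f x \<Longrightarrow> pd i (\<lambda>y. c * f y) x = c * pd i f x"
  by (simp add: pd_mult)

lemma pd_divide_const: "smooth_at f x \<Longrightarrow> pd i (\<lambda>y. f y / c) x = pd i f x / c"
  using pd_cmult[of f x i "1 / c"] by simp

lemma pd_minus: "smooth_at f x \<Longrightarrow> pd i (\<lambda>y. - f y) x = - pd i f x"
  using pd_cmult[of f x i "-1"] by simp

lemma pd_diff: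
  "smooth_at f x \<Longrightarrow> smooth_at h x \<Longrightarrow> pd i (\<lambda>y. f y - h y) x = pd i f x - pd i h x"
  using pd_add[of f x "\<lambda>y. - h y" i] by (simp add: pd_minus)

lemma pd_sum:
  "(\<And>b. b \<in> I \<Longrightarrow> smooth_at (f b) x) \<Longrightarrow> pd i (\<lambda>y. \<Sum>b\<in>I. f b y) x = (\<Sum>b\<in>I. pd i (f b) x)"
  by (induction I rule: infinite_finite_induct) (auto simp: pd_add)

lemma pd_real_compose:
  assumes "smooth_at f x" "(\<phi> has_real_derivative d) (at (f x))"
  shows "pd i (\<lambda>y. \<phi> (f y)) x = d * pd i f x"
  using pd_eqI[OF has_derivative_real_compose[OF smooth_at_has_derivative[OF assms(1)] assms(2)]]
  unfolding pd_def .

lemma pd_inverse: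
  "smooth_at f x \<Longrightarrow> f x \<noteq> 0 \<Longrightarrow> pd i (\<lambda>y. inverse (f y)) x = - (inverse (f x))\<^sup>2 * pd i f x"
  using pd_real_compose[of f x inverse "- (inverse (f x))\<^sup>2" i] DERIV_inverse[of "f x" UNIV]
  by (simp add: power2_eq_square)

lemma pd_powr:
  "smooth_at f x \<Longrightarrow> f x > 0 \<Longrightarrow> pd i (\<lambda>y. f y powr a) x = a * f x powr (a - 1) * pd i f x"
  using pd_real_compose[of f x "\<lambda>z. z powr a" "a * f x powr (a - 1)" i] has_real_derivative_powr by blast

lemma pd_power:
  "smooth_at f x \<Longrightarrow> pd i (\<lambda>y. f y ^ m) x = real m * f x ^ (m - 1) * pd i f x"
  using pd_real_compose[of f x "\<lambda>z. z ^ m" "real m * f x ^ (m - 1)" i] DERIV_pow by simp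

text \<open>Equality of mixed second derivatives: by two applications of the mean value theorem, either
  mixed derivative is the limit of the quotient of the second difference by the square of the
  step width, and this quotient is symmetric in the two directions.\<close>

lemma has_real_derivative_line:
  assumes "smooth_at f (z + s *\<^sub>R axis i 1)"
  shows "((\<lambda>s. f (z + s *\<^sub>R axis i 1)) has_real_derivative pd i f (z + s *\<^sub>R axis i 1)) (at s)"
proof -
  let ?D = "frechet_derivative f (at (z + s *\<^sub>R axis i 1))"
  have "((\<lambda>s. f (z + s *\<^sub>R axis i 1)) has_derivative (\<lambda>v. ?D (v *\<^sub>R axis i 1))) (at s)"
    by (rule has_derivative_compose[of "\<lambda>s. z + s *\<^sub>R axis i 1" _ _ _ f])
       (auto intro!: derivative_eq_intros smooth_at_has_derivative assms)
  moreover have "?D (v *\<^sub>R axis i 1) = pd i f (z + s *\<^sub>R axis i 1) * v" for v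
    using linear_scale[OF has_derivative_linear[OF smooth_at_has_derivative[OF assms]]]
    by (simp add: pd_def mult.commute)
  ultimately show ?thesis by (simp add: has_field_derivative_def)
qed

lemma second_difference_limit:
  fixes f :: "real^'k::finite \<Rightarrow> real" and i j :: "'k"
  assumes "smooth_at f x"
  defines "\<Delta> \<equiv> \<lambda>h. f (x + h *\<^sub>R axis i 1 + h *\<^sub>R axis j 1) - f (x + h *\<^sub>R axis i 1)
    - f (x + h *\<^sub>R axis j 1) + f x"
  shows "((\<lambda>h. \<Delta> h / h\<^sup>2) \<longlongrightarrow> pd j (pd i f) x) (at_right 0)"
proof (rule tendstoI)
  fix e :: real assume e: "e > 0"
  let ?a = "axis i 1 :: real^'k" and ?b = "axis j 1 :: real^'k"
  obtain S where S: "x \<in> S" "smooth_on S f" using assms by (auto simp: smooth_at_def)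
  have sm: "smooth_at f y" "smooth_at (pd i f) y" if "y \<in> S" for y
    using that S smooth_onD[of S f y] by simp_all
  have "isCont (pd j (pd i f)) x" using S sm smooth_at_isCont smooth_at_pd by blast
  then have "\<forall>\<^sub>F y in nhds x. dist (pd j (pd i f) y) (pd j (pd i f) x) < e"
    using e isCont_def tendsto_iff tendsto_at_iff_tendsto_nhds by metis
  then obtain d1 where d1: "d1 > 0" "\<And>y. dist y x < d1 \<Longrightarrow> dist (pd j (pd i f) y) (pd j (pd i f) x) < e"
    unfolding eventually_nhds_metric by blast
  obtain d2 where d2: "d2 > 0" "ball x d2 \<subseteq> S"
    using S smooth_on_open open_contains_ball by blast
  define d where "d = min d1 d2 / 2"
  have d: "d > 0" using d1 d2 by (simp add: d_def)
  have near: "dist (x + s *\<^sub>R ?a + t *\<^sub>R ?b) x < min d1 d2" if "0 \<le> s" "s < d" "0 \<le> t" "t < d" for s t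
  proof -
    have "dist (x + s *\<^sub>R ?a + t *\<^sub>R ?b) x = norm (s *\<^sub>R ?a + t *\<^sub>R ?b)" by (simp add: dist_norm)
    also have "\<dots> \<le> s + t" using that norm_triangle_ineq[of "s *\<^sub>R ?a" "t *\<^sub>R ?b"] by (simp add: norm_axis_1)
    finally show ?thesis using that unfolding d_def by linarith
  qed
  have inS: "x + s *\<^sub>R ?a + t *\<^sub>R ?b \<in> S" if "0 \<le> s" "s < d" "0 \<le> t" "t < d" for s t
    using near[OF that] d2 by (auto simp: dist_commute subset_iff)
  have "dist (\<Delta> h / h\<^sup>2) (pd j (pd i f) x) < e" if h: "0 < h" "h < d" for h
  proof -
    define p where "p s = f ((x + h *\<^sub>R ?b) + s *\<^sub>R ?a) - f (x + s *\<^sub>R ?a)" for s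
    have "\<exists>s. 0 < s \<and> s < h \<and> p h - p 0 = (h - 0) * (pd i f ((x + h *\<^sub>R ?b) + s *\<^sub>R ?a) - pd i f (x + s *\<^sub>R ?a))"
    proof (rule MVT2[OF h(1)])
      fix s assume s: "0 \<le> s" "s \<le> h"
      have 1: "(x + h *\<^sub>R ?b) + s *\<^sub>R ?a \<in> S" using inS[of s h] s h by (simp add: algebra_simps)
      have 2: "x + s *\<^sub>R ?a \<in> S" using inS[of s 0] s h d by simp
      show "(p has_real_derivative pd i f ((x + h *\<^sub>R ?b) + s *\<^sub>R ?a) - pd i f (x + s *\<^sub>R ?a)) (at s)"
        unfolding p_def by (intro DERIV_diff has_real_derivative_line sm 1 2)
    qed
    then obtain s where s: "0 < s" "s < h"
      "p h - p 0 = h * (pd i f ((x + s *\<^sub>R ?a) + h *\<^sub>R ?b) - pd i f ((x + s *\<^sub>R ?a) + 0 *\<^sub>R ?b))"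
      by (auto simp: algebra_simps)
    have "\<exists>t. 0 < t \<and> t < h \<and> pd i f ((x + s *\<^sub>R ?a) + h *\<^sub>R ?b) - pd i f ((x + s *\<^sub>R ?a) + 0 *\<^sub>R ?b)
        = (h - 0) * pd j (pd i f) ((x + s *\<^sub>R ?a) + t *\<^sub>R ?b)"
      by (rule MVT2[OF h(1)]) (use s h in \<open>auto intro!: has_real_derivative_line sm inS\<close>)
    then obtain t where t: "0 < t" "t < h" "p h - p 0 = h * (h * pd j (pd i f) (x + s *\<^sub>R ?a + t *\<^sub>R ?b))"
      using s(3) by auto
    have "p h - p 0 = \<Delta> h" by (simp add: p_def \<Delta>_def algebra_simps)
    then have "\<Delta> h / h\<^sup>2 = pd j (pd i f) (x + s *\<^sub>R ?a + t *\<^sub>R ?b)"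
      using t(3) h by (auto simp: power2_eq_square field_simps)
    moreover have "dist (x + s *\<^sub>R ?a + t *\<^sub>R ?b) x < d1" using near[of s t] s t h by simp
    ultimately show ?thesis using d1(2) by simp
  qed
  then show "\<forall>\<^sub>F h in at_right 0. dist (\<Delta> h / h\<^sup>2) (pd j (pd i f) x) < e"
    using d by (auto simp: eventually_at_right_field)
qed

lemma pd_commute:
  assumes "smooth_at f x" shows "pd i (pd j f) x = pd j (pd i f) x"
  using second_difference_limit[OF assms, of i j] second_difference_limit[OF assms, of j i]
    tendsto_unique[OF trivial_limit_at_right_real]
  by (simp add: add.commute add.left_commute algebra_simps) 


text \<open>Projections that select some of the coordinates: from the ambient space and from the cylinder of
  pairs $(x,\rho)$ to its factors.  Partial derivatives of pullbacks along them are again pullbacks,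
  or vanish.\<close>

definition coords :: "('l::finite \<Rightarrow> 'k::finite) \<Rightarrow> real^'k \<Rightarrow> real^'l" where
  "coords \<sigma> y = (\<chi> b. y $ \<sigma> b)"

lemma coords_nth [simp]: "coords \<sigma> y $ b = y $ \<sigma> b"
  by (simp add: coords_def)

lemma has_derivative_coords: "(coords \<sigma> has_derivative coords \<sigma>) (at y)"
proof (rule bounded_linear_imp_has_derivative)
  show "bounded_linear (coords \<sigma>)"
    by (rule linear_conv_bounded_linear[THEN iffD1], rule linearI) (simp_all add: vec_eq_iff)
qed

lemma smooth_at_coords: "smooth_at f (coords \<sigma> y) \<Longrightarrow> smooth_at (\<lambda>z. f (coords \<sigma> z)) y"
  by (rule smooth_at_affine[OF _ has_derivative_coords])

lemma pd_coords:
  assumes "inj \<sigma>" "smooth_at f (coords \<sigma> y)"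
  shows "pd (\<sigma> b) (\<lambda>z. f (coords \<sigma> z)) y = pd b f (coords \<sigma> y)"
    and "a \<notin> range \<sigma> \<Longrightarrow> pd a (\<lambda>z. f (coords \<sigma> z)) y = 0"
proof -
  have *: "pd a (\<lambda>z. f (coords \<sigma> z)) y = (\<Sum>b\<in>UNIV. (if \<sigma> b = a then 1 else 0) * pd b f (coords \<sigma> y))" for a
    using pd_compose(2)[OF smooth_at_differentiable[OF assms(2)] has_derivative_coords, of a]
    by (simp add: axis_def)
  show "pd (\<sigma> b) (\<lambda>z. f (coords \<sigma> z)) y = pd b f (coords \<sigma> y)"
    unfolding * using assms(1) by (simp add: inj_eq if_distrib[of "\<lambda>u. u * _"] cong: if_cong)
  show "a \<notin> range \<sigma> \<Longrightarrow> pd a (\<lambda>z. f (coords \<sigma> z)) y = 0"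
    unfolding * by (intro sum.neutral) auto
qed

section \<open>Volume densities and divergences\<close>

lemma pd_prod:
  assumes "finite I" "\<And>b. b \<in> I \<Longrightarrow> smooth_at (f b) x"
  shows "pd i (\<lambda>y. \<Prod>b\<in>I. f b y) x = (\<Sum>k\<in>I. \<Prod>b\<in>I. if b = k then pd i (f b) x else f b x)"
  using assms
proof (induction I)
  case (insert c I)
  have "(\<Prod>b\<in>I. if b = c then pd i (f b) x else f b x) = (\<Prod>b\<in>I. f b x)"
    using insert.hyps by (intro prod.cong) auto
  moreover have "(\<Sum>k\<in>I. (if c = k then pd i (f c) x else f c x) * (\<Prod>b\<in>I. if b = k then pd i (f b) x else f b x))
      = f c x * (\<Sum>k\<in>I. \<Prod>b\<in>I. if b = k then pd i (f b) x else f b x)"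
    unfolding sum_distrib_left using insert.hyps by (intro sum.cong) auto
  ultimately show ?case using insert by (simp add: pd_mult)
qed simp

lemma smooth_at_det:
  fixes G :: "real^'k::finite \<Rightarrow> real^'m^'m::finite"
  assumes "\<And>a b. smooth_at (\<lambda>y. G y $ a $ b) x"
  shows "smooth_at (\<lambda>y. det (G y)) x"
  unfolding det_def by (intro smooth_at_sum smooth_at_mult smooth_at_const smooth_at_prod assms)

lemma matrix_inv_mult:
  fixes A :: "real^'m^'m::finite"
  assumes "det A \<noteq> 0"
  shows "A ** matrix_inv A = mat 1" "matrix_inv A ** A = mat 1"
proof -
  have "invertible A" using assms by (simp add: invertible_det_nz)
  then have "A ** matrix_inv A = mat 1 \<and> matrix_inv A ** A = mat 1"
    unfolding invertible_def matrix_inv_def by (rule someI_ex)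
  then show "A ** matrix_inv A = mat 1" "matrix_inv A ** A = mat 1" by auto
qed

lemma matrix_inv_eqI:
  fixes A B :: "real^'m^'m::finite"
  assumes "A ** B = mat 1"
  shows "matrix_inv A = B" "det A \<noteq> 0"
proof -
  have "det A * det B = 1" using assms by (metis det_I det_mul)
  then show d: "det A \<noteq> 0" by auto
  have "matrix_inv A = matrix_inv A ** (A ** B)" using assms by simp
  also have "\<dots> = B" using matrix_inv_mult[OF d] by (simp add: matrix_mul_assoc)
  finally show "matrix_inv A = B" .
qed

lemma transpose_matrix_inv:
  fixes A :: "real^'m^'m::finite"
  assumes "det A \<noteq> 0" "transpose A = A"
  shows "transpose (matrix_inv A) = matrix_inv A"
proof -
  have "A ** transpose (matrix_inv A) = transpose (matrix_inv A ** A)"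
    using assms by (simp add: matrix_transpose_mul)
  then show ?thesis
    using matrix_inv_mult[OF assms(1)] matrix_inv_eqI(1)[of A "transpose (matrix_inv A)"] by simp
qed

text \<open>Cramer's rule exhibits the entries of the inverse as rational functions of the entries.\<close>

lemma matrix_inv_nth:
  fixes A :: "real^'m^'m::finite"
  assumes "det A \<noteq> 0"
  shows "matrix_inv A $ i $ j = det (\<chi> a b. if b = i then axis j 1 $ a else A $ a $ b) / det A"
proof -
  have "A *v (matrix_inv A *v axis j 1) = axis j 1"
    by (simp add: matrix_vector_mul_assoc matrix_inv_mult[OF assms])
  then have "matrix_inv A *v axis j 1 = (\<chi> i. det (\<chi> a b. if b = i then axis j 1 $ a else A $ a $ b) / det A)"
    using cramer[OF assms] by blast
  moreover have "(matrix_inv A *v axis j 1) $ i = matrix_inv A $ i $ j"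
    by (simp add: matrix_vector_mul_component inner_axis' matrix_vector_mult_basis column_def)
  ultimately show ?thesis by simp
qed

lemma smooth_at_matrix_inv:
  fixes G :: "real^'k::finite \<Rightarrow> real^'m^'m::finite"
  assumes "\<And>a b. smooth_at (\<lambda>y. G y $ a $ b) x" "det (G x) \<noteq> 0"
  shows "smooth_at (\<lambda>y. matrix_inv (G y) $ i $ j) x"
proof -
  have D: "smooth_at (\<lambda>y. det (G y)) x" by (rule smooth_at_det[OF assms(1)])
  have P: "open (- {0::real})" "det (G x) \<in> - {0}" using assms(2) by auto
  obtain S where S: "x \<in> S \<and> smooth_on S (\<lambda>y. det (G y)) \<and> (\<forall>y\<in>S. det (G y) \<in> - {0})"
    using smooth_at_nbhd[OF D P] by (rule exE)
  have "smooth_at (\<lambda>y. if b = i then axis j 1 $ a else G y $ a $ b) x" for a b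
    using assms(1) by (cases "b = i") auto
  then have "smooth_at (\<lambda>y. det (\<chi> a b. if b = i then axis j 1 $ a else G y $ a $ b) / det (G y)) x"
    using assms(2) by (intro smooth_at_divide D smooth_at_det) auto
  then show ?thesis
  proof (rule smooth_at_cong)
    show "open S" "x \<in> S" using S smooth_on_open by auto
    show "det (\<chi> a b. if b = i then axis j 1 $ a else G y $ a $ b) / det (G y) = matrix_inv (G y) $ i $ j"
      if "y \<in> S" for y using matrix_inv_nth[of "G y" i j] S that by auto
  qed
qed

text \<open>Half the trace of $G^{-1}\partial_a G$, the logarithmic derivative of the volume density.\<close>

definition dlogvol :: "(real^'k::finite \<Rightarrow> real^'m^'m::finite) \<Rightarrow> 'k \<Rightarrow> real^'k \<Rightarrow> real" where
  "dlogvol G a x = (\<Sum>i\<in>UNIV. \<Sum>j\<in>UNIV. matrix_inv (G x) $ j $ i * pd a (\<lambda>y. G y $ i $ j) x) / 2"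

lemma smooth_at_dlogvol:
  assumes "\<And>a b. smooth_at (\<lambda>y. G y $ a $ b) x" "det (G x) \<noteq> 0"
  shows "smooth_at (dlogvol G a) x"
proof -
  have "smooth_at (\<lambda>x. (\<Sum>i\<in>UNIV. \<Sum>j\<in>UNIV. matrix_inv (G x) $ j $ i * pd a (\<lambda>y. G y $ i $ j) x) / 2) x"
    using assms by (intro smooth_at_divide smooth_at_sum smooth_at_mult smooth_at_matrix_inv) auto
  then show ?thesis unfolding dlogvol_def[abs_def] .
qed

text \<open>Jacobi's formula.  Differentiating the rows of the determinant one at a time produces
  determinants in which one row is replaced by a combination of all rows, to which the lemma behind
  Cramer's rule applies.\<close>

lemma pd_det:
  fixes G :: "real^'k::finite \<Rightarrow> real^'m^'m::finite"
  assumes G: "\<And>a b. smooth_at (\<lambda>y. G y $ a $ b) x" and det: "det (G x) \<noteq> 0"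
  shows "pd c (\<lambda>y. det (G y)) x = 2 * dlogvol G c x * det (G x)"
proof -
  define dG where "dG a b = pd c (\<lambda>y. G y $ a $ b) x" for a b
  define R where "R k = (\<chi> a b. if a = k then dG a b else G x $ a $ b)" for k
  define q where "q k = (\<chi> j. \<Sum>b\<in>UNIV. dG k b * matrix_inv (G x) $ b $ j)" for k
  have row: "(\<Sum>j\<in>UNIV. q k $ j *s row j (G x)) = (\<chi> b. dG k b)" for k
  proof (subst vec_eq_iff, intro allI)
    fix b
    have "(\<Sum>j\<in>UNIV. q k $ j *s row j (G x)) $ b
        = (\<Sum>j\<in>UNIV. \<Sum>e\<in>UNIV. dG k e * (matrix_inv (G x) $ e $ j * G x $ j $ b))"
      by (simp add: q_def row_def sum_distrib_right mult.assoc)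
    also have "\<dots> = (\<Sum>e\<in>UNIV. dG k e * (matrix_inv (G x) ** G x) $ e $ b)"
      by (subst sum.swap) (simp add: matrix_matrix_mult_def sum_distrib_left)
    also have "\<dots> = dG k b"
      by (simp add: matrix_inv_mult[OF det] mat_def if_distrib[of "\<lambda>u. _ * u"] cong: if_cong)
    finally show "(\<Sum>j\<in>UNIV. q k $ j *s row j (G x)) $ b = (\<chi> b. dG k b) $ b" by simp
  qed
  have detR: "det (R k) = q k $ k * det (G x)" for k
  proof -
    have "R k = (\<chi> i. if i = k then (\<Sum>j\<in>UNIV. q k $ j *s row j (G x)) else row i (G x))"
      unfolding row by (simp add: R_def row_def vec_eq_iff)
    then show ?thesis using cramer_lemma_transpose[of k "q k" "G x"] by simp
  qed
  have "pd c (\<lambda>y. det (G y)) x = (\<Sum>p | p permutes UNIV. of_int (sign p) *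
      (\<Sum>k\<in>UNIV. \<Prod>a\<in>UNIV. if a = k then pd c (\<lambda>y. G y $ a $ p a) x else G x $ a $ p a))"
    unfolding det_def using G by (simp add: pd_sum pd_cmult pd_prod)
  also have "\<dots> = (\<Sum>p | p permutes UNIV. \<Sum>k\<in>UNIV. of_int (sign p) * (\<Prod>a\<in>UNIV. R k $ a $ p a))"
    unfolding R_def dG_def by (simp add: sum_distrib_left cong: if_cong)
  also have "\<dots> = (\<Sum>k\<in>UNIV. det (R k))"
    unfolding det_def by (rule sum.swap)
  also have "\<dots> = (\<Sum>k\<in>UNIV. q k $ k) * det (G x)"
    by (simp add: detR sum_distrib_right)
  also have "(\<Sum>k\<in>UNIV. q k $ k) = 2 * dlogvol G c x"
    by (simp add: q_def dlogvol_def dG_def mult.commute)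
  finally show ?thesis .
qed

text \<open>This form of the volume density is built from operations that preserve smoothness.\<close>

lemma sqrt_abs_eq_powr: "sqrt \<bar>z\<bar> = (z ^ 2) powr (1/4)"
proof (cases "z = 0")
  case False
  define s where "s = sqrt \<bar>z\<bar>"
  have s: "s > 0" "s ^ 2 = \<bar>z\<bar>" using False by (auto simp: s_def)
  have "z ^ 2 = (s ^ 2) ^ 2" using s by simp
  also have "\<dots> = s ^ 4" by (simp flip: power_mult)
  also have "\<dots> = s powr 4" using s by simp
  finally have "(z ^ 2) powr (1/4) = s" using s by (simp add: powr_powr del: powr_numeral)
  then show ?thesis by (simp add: s_def)
qed simp

lemma smooth_at_sqrt_det:
  fixes G :: "real^'k::finite \<Rightarrow> real^'m^'m::finite"
  assumes "\<And>a b. smooth_at (\<lambda>y. G y $ a $ b) x" "det (G x) \<noteq> 0"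
  shows "smooth_at (\<lambda>y. sqrt \<bar>det (G y)\<bar>) x"
  unfolding sqrt_abs_eq_powr
  using assms by (intro smooth_at_powr smooth_at_power smooth_at_det) auto

lemma pd_sqrt_det:
  fixes G :: "real^'k::finite \<Rightarrow> real^'m^'m::finite"
  assumes G: "\<And>a b. smooth_at (\<lambda>y. G y $ a $ b) x" and det: "det (G x) \<noteq> 0"
  shows "pd c (\<lambda>y. sqrt \<bar>det (G y)\<bar>) x = dlogvol G c x * sqrt \<bar>det (G x)\<bar>"
proof -
  let ?z = "det (G x)"
  have "pd c (\<lambda>y. sqrt \<bar>det (G y)\<bar>) x = 1/4 * (?z ^ 2) powr (1/4 - 1) * (2 * ?z * (2 * dlogvol G c x * ?z))"
    unfolding sqrt_abs_eq_powr
    using assms smooth_at_det[OF G] by (subst pd_powr) (auto simp: pd_power pd_det)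
  also have "(?z ^ 2) powr (1/4 - 1) = (?z ^ 2) powr (1/4) / ?z ^ 2"
    using det by (subst powr_diff) auto
  finally show ?thesis using det by (simp add: sqrt_abs_eq_powr power2_eq_square)
qed

lemma vol_density_pos: "det (G x) \<noteq> 0 \<Longrightarrow> vol_density G x > 0"
  by (simp add: vol_density_def)

text \<open>Jacobi's formula allows one to compute divergences without knowing the determinant.\<close>

lemma codiff_eq:
  fixes G :: "real^'k::finite \<Rightarrow> real^'k^'k"
  assumes G: "\<And>a b. smooth_at (\<lambda>y. G y $ a $ b) x" and det: "det (G x) \<noteq> 0"
    and X: "\<And>i. smooth_at (\<lambda>y. (metric_inv G y *v \<omega> y) $ i) x"
  shows "codiff G \<omega> x = - (\<Sum>i\<in>UNIV. pd i (\<lambda>y. (metric_inv G y *v \<omega> y) $ i) x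
      + dlogvol G i x * (metric_inv G x *v \<omega> x) $ i)"
proof -
  have v: "smooth_at (vol_density G) x"
    using smooth_at_sqrt_det[OF G det] by (simp add: vol_density_def[abs_def])
  have "pd i (\<lambda>y. vol_density G y * (metric_inv G y *v \<omega> y) $ i) x = vol_density G x *
      (pd i (\<lambda>y. (metric_inv G y *v \<omega> y) $ i) x + dlogvol G i x * (metric_inv G x *v \<omega> x) $ i)" for i
    using pd_mult[OF v X] pd_sqrt_det[OF G det]
    by (simp add: vol_density_def[abs_def] algebra_simps)
  then show ?thesis
    using vol_density_pos[of G x] det by (simp add: codiff_def flip: sum_distrib_left)
qed

lemma codiff_cong_open:
  assumes S: "open S" "x \<in> S" and eq: "\<And>y. y \<in> S \<Longrightarrow> G y = G' y" "\<And>y. y \<in> S \<Longrightarrow> \<omega> y = \<omega>' y"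
  shows "codiff G \<omega> x = codiff G' \<omega>' x"
proof -
  have "pd i (\<lambda>y. vol_density G y * (metric_inv G y *v \<omega> y) $ i) x
      = pd i (\<lambda>y. vol_density G' y * (metric_inv G' y *v \<omega>' y) $ i) x" for i
    by (rule pd_cong_open[OF S]) (simp add: eq vol_density_def metric_inv_def)
  then show ?thesis by (simp add: codiff_def vol_density_def eq S)
qed

lemma laplacian_cong_open:
  assumes S: "open S" "x \<in> S" and eq: "\<And>y. y \<in> S \<Longrightarrow> f y = f' y"
  shows "laplacian G f x = laplacian G f' x"
  unfolding laplacian_def
  using codiff_cong_open[OF S refl, of "dform f" "dform f'"] pd_cong_open[OF S(1) _ eq]
  by (simp add: dform_def)

section \<open>The Laplacian of the ambient metric\<close>

text \<open>The coordinates \<open>None\<close> and \<open>Some i\<close> of the cylinder correspond to $\rho$ and $x^i$.\<close>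

fun amb_index :: "'n option \<Rightarrow> 'n amb" where
  "amb_index None = AInf"
| "amb_index (Some i) = AX i"

lemma inj_amb_index: "inj amb_index"
proof (rule injI)
  show "a = b" if "amb_index a = amb_index b" for a b :: "'n option"
    using that by (cases a; cases b) auto
qed

lemma AT_notin_amb_index: "AT \<notin> range amb_index"
  by (auto elim: amb_index.elims[OF sym])

lemma xpart_eq_coords: "xpart = coords Some"
  by (auto simp: xpart_def coords_def)

lemma xpart_coords_amb_index: "xpart (coords amb_index y) = amb_x y"
  by (simp add: xpart_def amb_x_def vec_eq_iff)

lemma pd_amb_index:
  fixes y :: "real^('n::finite amb)"
  assumes "smooth_at f (coords amb_index y)"
  shows "pd AInf (\<lambda>z. f (coords amb_index z)) y = pd None f (coords amb_index y)"
    "pd (AX i) (\<lambda>z. f (coords amb_index z)) y = pd (Some i) f (coords amb_index y)"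
    "pd AT (\<lambda>z. f (coords amb_index z)) y = 0"
  using pd_coords(1)[OF inj_amb_index assms, of None] pd_coords(1)[OF inj_amb_index assms, of "Some i"]
    pd_coords(2)[OF inj_amb_index assms AT_notin_amb_index] by simp_all

lemma sum_amb: "(\<Sum>a\<in>UNIV. f a) = f AT + f AInf + (\<Sum>i\<in>UNIV. f (AX i :: 'n::finite amb))"
proof -
  have U: "UNIV = insert AT (insert AInf (range (AX :: 'n \<Rightarrow> _)))"
    by (metis (mono_tags) UNIV_eq_I amb.exhaust insertCI rangeI)
  have "inj (AX :: 'n \<Rightarrow> _)" by (simp add: inj_def)
  then show ?thesis unfolding U
    by (subst sum.insert, simp, force)+ (simp add: sum.reindex add.assoc)
qed

lemma sum_option: "(\<Sum>a\<in>UNIV. f a) = f None + (\<Sum>i\<in>UNIV. f (Some i :: 'n::finite option))"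
  by (simp add: UNIV_option_conv sum.reindex)

lemma amb_metric_nth [simp]:
  "amb_metric k y $ AT $ AT = 2 * y $ AInf" "amb_metric k y $ AT $ AInf = y $ AT"
  "amb_metric k y $ AInf $ AT = y $ AT" "amb_metric k y $ AInf $ AInf = 0"
  "amb_metric k y $ AX i $ AT = 0" "amb_metric k y $ AX i $ AInf = 0"
  "amb_metric k y $ AT $ AX j = 0" "amb_metric k y $ AInf $ AX j = 0"
  "amb_metric k y $ AX i $ AX j = (y $ AT)\<^sup>2 * k (y $ AInf) (amb_x y) $ i $ j"
  by (simp_all add: amb_metric_def)

text \<open>A smooth family of nondegenerate metrics on an open subset \<open>V\<close> of \<open>real^'n\<close>, to be used both
  for $g(\rho)$ and for $g_r$ in a chart.  Functions of \<open>x\<close> and the parameter are functions on the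
  cylinder \<open>C\<close> over \<open>V\<close>.\<close>

locale metric_family =
  fixes \<eta> :: real and V :: "(real^'n::finite) set" and k :: "real \<Rightarrow> real^'n \<Rightarrow> real^'n^'n"
  assumes eta: "\<eta> > 0" and open_V: "open V"
    and smooth_family: "\<And>i j. smooth_on (cylinder {-\<eta><..<\<eta>} V) (\<lambda>y. k (y $ None) (xpart y) $ i $ j)"
    and sym_family: "\<And>\<rho> x. \<bar>\<rho>\<bar> < \<eta> \<Longrightarrow> x \<in> V \<Longrightarrow> transpose (k \<rho> x) = k \<rho> x"
    and det_family: "\<And>\<rho> x. \<bar>\<rho>\<bar> < \<eta> \<Longrightarrow> x \<in> V \<Longrightarrow> det (k \<rho> x) \<noteq> 0"
begin

definition C :: "(real^('n option)) set" where "C = cylinder {-\<eta><..<\<eta>} V"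

definition H :: "real^('n option) \<Rightarrow> real^'n^'n" where "H y = k (y $ None) (xpart y)"

definition Hi :: "'n \<Rightarrow> 'n \<Rightarrow> real^('n option) \<Rightarrow> real" where "Hi i j y = matrix_inv (H y) $ i $ j"

definition grad :: "(real^('n option) \<Rightarrow> real) \<Rightarrow> 'n \<Rightarrow> real^('n option) \<Rightarrow> real" where
  "grad \<phi> i y = (\<Sum>j\<in>UNIV. Hi i j y * pd (Some j) \<phi> y)"

abbreviation smooth :: "(real^('n option) \<Rightarrow> real) \<Rightarrow> bool" where
  "smooth \<phi> \<equiv> smooth_on C \<phi>"

lemma mem_C: "y \<in> C \<longleftrightarrow> \<bar>y $ None\<bar> < \<eta> \<and> xpart y \<in> V"
  by (auto simp: C_def cylinder_def)

lemma open_C: "open C"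
  using smooth_family smooth_on_open unfolding C_def by blast

lemma smooth_iff: "smooth \<phi> \<longleftrightarrow> (\<forall>y\<in>C. smooth_at \<phi> y)"
  by (simp add: smooth_on_iff_smooth_at open_C)

lemma smooth_at_H: "y \<in> C \<Longrightarrow> smooth_at (\<lambda>z. H z $ i $ j) y"
  using smooth_family smooth_onD unfolding H_def C_def by blast

lemma det_H: "y \<in> C \<Longrightarrow> det (H y) \<noteq> 0"
  using det_family by (simp add: H_def mem_C)

lemma transpose_H: "y \<in> C \<Longrightarrow> transpose (H y) = H y"
  using sym_family by (simp add: H_def mem_C)

lemma sym_H:
  assumes "y \<in> C" shows "H y $ i $ j = H y $ j $ i"
proof -
  have "H y $ i $ j = transpose (H y) $ j $ i" by (simp add: transpose_def)
  then show ?thesis by (simp add: transpose_H[OF assms])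
qed

lemma smooth_at_Hi [simp]: "y \<in> C \<Longrightarrow> smooth_at (Hi i j) y"
  using smooth_at_matrix_inv[OF smooth_at_H det_H] by (simp add: Hi_def[abs_def])

lemma Hi_H: "y \<in> C \<Longrightarrow> (\<Sum>l\<in>UNIV. Hi i l y * H y $ l $ j) = (if i = j then 1 else 0)"
  using matrix_inv_mult(2)[OF det_H, of y] by (simp add: Hi_def matrix_matrix_mult_def mat_def vec_eq_iff)

lemma H_Hi: "y \<in> C \<Longrightarrow> (\<Sum>l\<in>UNIV. H y $ i $ l * Hi l j y) = (if i = j then 1 else 0)"
  using matrix_inv_mult(1)[OF det_H, of y] by (simp add: Hi_def matrix_matrix_mult_def mat_def vec_eq_iff)

lemma sym_Hi:
  assumes "y \<in> C" shows "Hi i j y = Hi j i y"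
proof -
  have "matrix_inv (H y) $ i $ j = transpose (matrix_inv (H y)) $ j $ i" by (simp add: transpose_def)
  then show ?thesis
    by (simp add: transpose_matrix_inv[OF det_H[OF assms] transpose_H[OF assms]] Hi_def)
qed

lemma smooth_at_grad [simp]: "y \<in> C \<Longrightarrow> smooth_at \<phi> y \<Longrightarrow> smooth_at (grad \<phi> i) y"
  unfolding grad_def[abs_def] by simp

lemma smooth_at_dlogvol_H [simp]: "y \<in> C \<Longrightarrow> smooth_at (dlogvol H a) y"
  by (intro smooth_at_dlogvol smooth_at_H det_H)

subsection \<open>Inverse and volume density of the ambient metric\<close>

text \<open>On this set the ambient metric is smooth and nondegenerate; its points with $t = 1$, $\rho = 0$
  form a copy of \<open>V\<close>.\<close>

definition amb_dom :: "(real^('n amb)) set" where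
  "amb_dom = {y. y $ AT > 0 \<and> coords amb_index y \<in> C}"

definition amb_inv :: "real^('n amb) \<Rightarrow> real^('n amb)^('n amb)" where
  "amb_inv y = (\<chi> a b. case (a, b) of
       (AT, AInf) \<Rightarrow> 1 / y $ AT
     | (AInf, AT) \<Rightarrow> 1 / y $ AT
     | (AInf, AInf) \<Rightarrow> - 2 * y $ AInf / (y $ AT)\<^sup>2
     | (AX i, AX j) \<Rightarrow> Hi i j (coords amb_index y) / (y $ AT)\<^sup>2
     | _ \<Rightarrow> 0)"

lemma amb_inv_nth [simp]:
  "amb_inv y $ AT $ AT = 0" "amb_inv y $ AT $ AInf = 1 / y $ AT"
  "amb_inv y $ AInf $ AT = 1 / y $ AT" "amb_inv y $ AInf $ AInf = - 2 * y $ AInf / (y $ AT)\<^sup>2"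
  "amb_inv y $ AX i $ AT = 0" "amb_inv y $ AX i $ AInf = 0"
  "amb_inv y $ AT $ AX j = 0" "amb_inv y $ AInf $ AX j = 0"
  "amb_inv y $ AX i $ AX j = Hi i j (coords amb_index y) / (y $ AT)\<^sup>2"
  by (simp_all add: amb_inv_def)

lemma amb_metric_AX: "amb_metric k y $ AX i $ AX j = (y $ AT)\<^sup>2 * H (coords amb_index y) $ i $ j"
  by (simp add: H_def xpart_coords_amb_index)

lemma amb_domD:
  "y \<in> amb_dom \<Longrightarrow> y $ AT > 0" "y \<in> amb_dom \<Longrightarrow> coords amb_index y \<in> C"
  by (auto simp: amb_dom_def)

lemma open_amb_dom: "open amb_dom"
proof -
  have "continuous_on UNIV (\<lambda>y::real^('n amb). y $ AT)" by (intro continuous_intros)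
  then have 1: "open {y::real^('n amb). 0 < y $ AT}"
    by (intro open_Collect_less) (auto intro: continuous_intros)
  have "continuous_on UNIV (coords amb_index :: real^('n amb) \<Rightarrow> real^('n option))"
    by (intro continuous_at_imp_continuous_on ballI has_derivative_continuous[OF has_derivative_coords])
  then have "open (coords amb_index -` C :: (real^('n amb)) set)"
    using open_C open_vimage by blast
  then have "open ({y::real^('n amb). 0 < y $ AT} \<inter> coords amb_index -` C)" using 1 by blast
  moreover have "amb_dom = {y. 0 < y $ AT} \<inter> coords amb_index -` C" by (auto simp: amb_dom_def)
  ultimately show ?thesis by simp
qed

lemma amb_metric_inv:
  assumes y: "y \<in> amb_dom"
  shows "metric_inv (amb_metric k) y = amb_inv y" "det (amb_metric k y) \<noteq> 0"
proof -
  have t: "y $ AT \<noteq> 0" using amb_domD[OF y] by simp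
  have HH: "(\<Sum>l\<in>UNIV. (y $ AT)\<^sup>2 * H (coords amb_index y) $ i $ l * (Hi l j (coords amb_index y) / (y $ AT)\<^sup>2))
      = (if i = j then 1 else 0)" for i j
    using H_Hi[OF amb_domD(2)[OF y], of i j] t by simp
  have "(amb_metric k y ** amb_inv y) $ a $ b = mat 1 $ a $ b" for a b
    using t HH unfolding amb_metric_AX[symmetric]
    by (cases a; cases b) (auto simp: matrix_matrix_mult_def sum_amb mat_def power2_eq_square field_simps simp del: amb_metric_nth(9))
  then have "amb_metric k y ** amb_inv y = mat 1" by (simp add: vec_eq_iff)
  from matrix_inv_eqI[OF this] show "metric_inv (amb_metric k) y = amb_inv y" "det (amb_metric k y) \<noteq> 0"
    by (simp_all add: metric_inv_def)
qed

lemma smooth_at_amb_metric: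
  assumes y: "y \<in> amb_dom"
  shows "smooth_at (\<lambda>y. amb_metric k y $ a $ b) y"
proof -
  have "smooth_at (\<lambda>z. (z $ AT)\<^sup>2 * H (coords amb_index z) $ i $ j) y" for i j
    using smooth_at_coords[OF smooth_at_H[OF amb_domD(2)[OF y]], of i j] by simp
  then show ?thesis
    by (cases a; cases b) (simp_all add: amb_metric_AX del: amb_metric_nth(9))
qed

lemma pd_amb_metric_AX:
  assumes y: "y \<in> amb_dom"
  shows "pd AT (\<lambda>y. amb_metric k y $ AX i $ AX j) y = 2 * y $ AT * H (coords amb_index y) $ i $ j"
    "pd AInf (\<lambda>y. amb_metric k y $ AX i $ AX j) y
      = (y $ AT)\<^sup>2 * pd None (\<lambda>z. H z $ i $ j) (coords amb_index y)"
    "pd (AX l) (\<lambda>y. amb_metric k y $ AX i $ AX j) y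
      = (y $ AT)\<^sup>2 * pd (Some l) (\<lambda>z. H z $ i $ j) (coords amb_index y)"
proof -
  have s: "smooth_at (\<lambda>z. H z $ i $ j) (coords amb_index y)"
    by (rule smooth_at_H[OF amb_domD(2)[OF y]])
  show "pd AT (\<lambda>y. amb_metric k y $ AX i $ AX j) y = 2 * y $ AT * H (coords amb_index y) $ i $ j"
    "pd AInf (\<lambda>y. amb_metric k y $ AX i $ AX j) y
      = (y $ AT)\<^sup>2 * pd None (\<lambda>z. H z $ i $ j) (coords amb_index y)"
    "pd (AX l) (\<lambda>y. amb_metric k y $ AX i $ AX j) y
      = (y $ AT)\<^sup>2 * pd (Some l) (\<lambda>z. H z $ i $ j) (coords amb_index y)"
    unfolding amb_metric_AX using smooth_at_coords[OF s] pd_amb_index[OF s]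
    by (simp_all add: pd_mult pd_power)
qed

lemma sum_Hi_H: "y \<in> C \<Longrightarrow> (\<Sum>i\<in>UNIV. \<Sum>j\<in>UNIV. Hi j i y * H y $ i $ j) = real CARD('n)"
proof -
  assume y: "y \<in> C"
  have "(\<Sum>i\<in>UNIV. \<Sum>j\<in>UNIV. Hi j i y * H y $ i $ j) = (\<Sum>j\<in>UNIV. \<Sum>i\<in>UNIV. Hi j i y * H y $ i $ j)"
    by (rule sum.swap)
  then show ?thesis using Hi_H[OF y] by simp
qed

lemma dlogvol_amb:
  assumes y: "y \<in> amb_dom"
  shows "dlogvol (amb_metric k) AT y = (real CARD('n) + 1) / y $ AT"
    "dlogvol (amb_metric k) AInf y = dlogvol H None (coords amb_index y)"
    "dlogvol (amb_metric k) (AX l) y = dlogvol H (Some l) (coords amb_index y)"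
proof -
  have t: "y $ AT \<noteq> 0" using amb_domD[OF y] by simp
  have inv: "matrix_inv (amb_metric k y) = amb_inv y"
    using amb_metric_inv[OF y] by (simp add: metric_inv_def)
  have e: "dlogvol (amb_metric k) a y = (2 * (1 / y $ AT) * pd a (\<lambda>y. y $ AT) y +
     (\<Sum>i\<in>UNIV. \<Sum>j\<in>UNIV. Hi j i (coords amb_index y) / (y $ AT)\<^sup>2 * pd a (\<lambda>y. amb_metric k y $ AX i $ AX j) y)) / 2" for a
    unfolding dlogvol_def inv by (simp add: sum_amb del: amb_metric_nth(9) pd_coord)
  show "dlogvol (amb_metric k) AT y = (real CARD('n) + 1) / y $ AT"
    unfolding e pd_amb_metric_AX[OF y] using t sum_Hi_H[OF amb_domD(2)[OF y]]
    by (simp add: power2_eq_square field_simps flip: sum_distrib_left sum_divide_distrib)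
  show "dlogvol (amb_metric k) AInf y = dlogvol H None (coords amb_index y)"
    "dlogvol (amb_metric k) (AX l) y = dlogvol H (Some l) (coords amb_index y)"
    unfolding e pd_amb_metric_AX[OF y] using t by (simp_all add: dlogvol_def Hi_def)
qed

subsection \<open>Action on homogeneous functions\<close>

text \<open>The operator induced by the ambient Laplacian on the coefficients \<open>\<phi>\<close> of the functions
  $t^\gamma\varphi(x,\rho)$ of homogeneity \<open>\<gamma>\<close>.\<close>

definition amb_op :: "real \<Rightarrow> (real^('n option) \<Rightarrow> real) \<Rightarrow> real^('n option) \<Rightarrow> real" where
  "amb_op \<gamma> \<phi> y = (2 * \<gamma> + real CARD('n) - 2) * pd None \<phi> y - 2 * y $ None * pd None (pd None \<phi>) y
     + dlogvol H None y * (\<gamma> * \<phi> y - 2 * y $ None * pd None \<phi> y)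
     + (\<Sum>i\<in>UNIV. pd (Some i) (grad \<phi> i) y + dlogvol H (Some i) y * grad \<phi> i y)"

text \<open>With Jacobi's formula for the volume density $t^{n+1}\mathrm{vol}(g(\rho))$ this is the divergence of
  the gradient \<open>X\<close> of $t^\gamma\varphi$, each of whose components is again a power of \<open>t\<close> times a function
  on the cylinder.\<close>

lemma laplacian_amb:
  assumes \<phi>: "smooth \<phi>" and y: "y \<in> amb_dom"
  shows "laplacian (amb_metric k) (\<lambda>y. (y $ AT) powr \<gamma> * \<phi> (coords amb_index y)) y
    = (y $ AT) powr (\<gamma> - 2) * amb_op \<gamma> \<phi> (coords amb_index y)"
proof -
  define \<Phi> where "\<Phi> = (\<lambda>y::real^('n amb). (y $ AT) powr \<gamma> * \<phi> (coords amb_index y))"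
  define Q where "Q = (\<lambda>z. \<gamma> * \<phi> z - 2 * z $ None * pd None \<phi> z)"
  define X where "X = (\<lambda>y a. (metric_inv (amb_metric k) y *v dform \<Phi> y) $ a)"
  have s\<phi>: "smooth_at \<phi> (coords amb_index y)" if "y \<in> amb_dom" for y
    using \<phi> amb_domD(2)[OF that] by (simp add: smooth_iff)
  have sQ: "smooth_at Q (coords amb_index y)" if "y \<in> amb_dom" for y
    unfolding Q_def using s\<phi>[OF that] by simp
  have sg: "smooth_at (grad \<phi> i) (coords amb_index y)" if "y \<in> amb_dom" for y i
    using s\<phi>[OF that] amb_domD(2)[OF that] by simp
  have st: "smooth_at (\<lambda>y. (y $ AT) powr b) y" and pt: "pd a (\<lambda>y. (y $ AT) powr b) y = (if a = AT then b * (y $ AT) powr (b - 1) else 0)"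
    if "y \<in> amb_dom" for y b a
    using amb_domD(1)[OF that] by (auto simp: pd_powr)
  have pw: "(y $ AT) powr (b - 1) = (y $ AT) powr b / y $ AT"
    "(y $ AT) powr (b - 2) = (y $ AT) powr b / (y $ AT)\<^sup>2" if "y \<in> amb_dom" for y b
    using amb_domD(1)[OF that] by (simp_all add: powr_diff)
  have d\<Phi>: "pd AT \<Phi> y = \<gamma> * (y $ AT) powr (\<gamma> - 1) * \<phi> (coords amb_index y)"
      "pd AInf \<Phi> y = (y $ AT) powr \<gamma> * pd None \<phi> (coords amb_index y)"
      "pd (AX i) \<Phi> y = (y $ AT) powr \<gamma> * pd (Some i) \<phi> (coords amb_index y)"
    if "y \<in> amb_dom" for y i
    unfolding \<Phi>_def using st[OF that] pt[OF that] smooth_at_coords[OF s\<phi>[OF that]] pd_amb_index[OF s\<phi>[OF that]]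
    by (simp_all add: pd_mult)
  have X: "X y AT = (y $ AT) powr (\<gamma> - 1) * pd None \<phi> (coords amb_index y)"
      "X y AInf = (y $ AT) powr (\<gamma> - 2) * Q (coords amb_index y)"
      "X y (AX i) = (y $ AT) powr (\<gamma> - 2) * grad \<phi> i (coords amb_index y)"
    if "y \<in> amb_dom" for y i
    unfolding X_def amb_metric_inv[OF that] pw[OF that, of \<gamma>] using amb_domD(1)[OF that]
    by (simp_all add: matrix_vector_mult_def sum_amb dform_def d\<Phi>[OF that] Q_def grad_def
        pw(1)[OF that, of \<gamma>] power2_eq_square sum_distrib_left field_simps)
  have sp: "smooth_at (pd None \<phi>) (coords amb_index y)" if "y \<in> amb_dom" for y
    using s\<phi>[OF that] by simp
  have sX: "smooth_at (\<lambda>z. X z a) y" if "y \<in> amb_dom" for a y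
  proof -
    note c = smooth_at_cong[OF _ open_amb_dom that]
    show ?thesis
    proof (cases a)
      case AT
      show ?thesis unfolding AT
        by (rule c[OF smooth_at_mult[OF st[OF that] smooth_at_coords[OF sp[OF that]]] X(1)[symmetric]])
    next
      case AInf
      show ?thesis unfolding AInf
        by (rule c[OF smooth_at_mult[OF st[OF that] smooth_at_coords[OF sQ[OF that]]] X(2)[symmetric]])
    next
      case (AX i)
      show ?thesis unfolding AX
        by (rule c[OF smooth_at_mult[OF st[OF that] smooth_at_coords[OF sg[OF that]]] X(3)[symmetric]])
    qed
  qed
  note smooths = st[OF y] smooth_at_coords[OF sp[OF y]] smooth_at_coords[OF sQ[OF y]] smooth_at_coords[OF sg[OF y]]
  have cX: "pd AT (\<lambda>z. X z AT) y = pd AT (\<lambda>z. (z $ AT) powr (\<gamma> - 1) * pd None \<phi> (coords amb_index z)) y"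
    "pd AInf (\<lambda>z. X z AInf) y = pd AInf (\<lambda>z. (z $ AT) powr (\<gamma> - 2) * Q (coords amb_index z)) y"
    "pd (AX i) (\<lambda>z. X z (AX i)) y = pd (AX i) (\<lambda>z. (z $ AT) powr (\<gamma> - 2) * grad \<phi> i (coords amb_index z)) y" for i
    by (rule pd_cong_open[OF open_amb_dom y], rule X, assumption)+
  have pX: "pd AT (\<lambda>z. X z AT) y = (\<gamma> - 1) * (y $ AT) powr (\<gamma> - 1 - 1) * pd None \<phi> (coords amb_index y)"
      "pd AInf (\<lambda>z. X z AInf) y = (y $ AT) powr (\<gamma> - 2) * pd None Q (coords amb_index y)"
      "pd (AX i) (\<lambda>z. X z (AX i)) y = (y $ AT) powr (\<gamma> - 2) * pd (Some i) (grad \<phi> i) (coords amb_index y)" for i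
    unfolding cX
    using smooths pt[OF y] pd_amb_index[OF sp[OF y]] pd_amb_index[OF sQ[OF y]] pd_amb_index[OF sg[OF y]]
    by (simp_all add: pd_mult)
  have pw3: "(y $ AT) powr (\<gamma> - 1) = (y $ AT) powr (\<gamma> - 2) * y $ AT"
    using pw[OF y, of \<gamma>] amb_domD(1)[OF y] by (simp add: power2_eq_square)
  have pQ: "pd None Q z = (\<gamma> - 2) * pd None \<phi> z - 2 * z $ None * pd None (pd None \<phi>) z"
    if "smooth_at \<phi> z" for z
    unfolding Q_def using that by (simp add: pd_diff pd_mult algebra_simps)
  have "laplacian (amb_metric k) \<Phi> y = (\<Sum>a\<in>UNIV. pd a (\<lambda>z. X z a) y + dlogvol (amb_metric k) a y * X y a)"
    unfolding laplacian_def using sX[OF y] unfolding X_def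
    by (subst codiff_eq[OF smooth_at_amb_metric[OF y] amb_metric_inv(2)[OF y]]) simp_all
  also have "\<dots> = (y $ AT) powr (\<gamma> - 2) * amb_op \<gamma> \<phi> (coords amb_index y)"
    unfolding pw3 sum_amb pX X[OF y] dlogvol_amb[OF y] amb_op_def pQ[OF s\<phi>[OF y]]
    using amb_domD(1)[OF y]
    by (simp add: pw3 Q_def power2_eq_square field_simps sum.distrib sum_distrib_left)
  finally show ?thesis unfolding \<Phi>_def .
qed

end

section \<open>Slices of the cylinder and lifts to it\<close>

lemma cyl_point_nth [simp]: "cyl_point r x $ None = r" "cyl_point r x $ Some i = x $ i"
  by (simp_all add: cyl_point_def)

lemma xpart_cyl_point [simp]: "xpart (cyl_point r x) = x"
  by (simp add: xpart_def vec_eq_iff)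

lemma cyl_point_xpart: "cyl_point (y $ None) (xpart y) = y"
  by (simp add: vec_eq_iff xpart_def split: option.split) (metis cyl_point_nth not_None_eq xpart_def vec_lambda_beta)

lemma has_derivative_cyl_point:
  fixes x :: "real^'n::finite"
  shows "(cyl_point r has_derivative cyl_point 0) (at x)"
proof -
  have "bounded_linear (cyl_point 0 :: real^'n \<Rightarrow> _)"
    by (rule linear_conv_bounded_linear[THEN iffD1], rule linearI)
       (simp_all add: vec_eq_iff cyl_point_def split: option.split)
  then have "(cyl_point 0 has_derivative cyl_point 0) (at x)"
    by (rule bounded_linear_imp_has_derivative)
  then have "((\<lambda>x. axis None r + cyl_point 0 x) has_derivative (\<lambda>v. 0 + cyl_point 0 v)) (at x)"
    by (intro has_derivative_add has_derivative_const)
  moreover have "(\<lambda>x::real^'n. axis None r + cyl_point 0 x) = cyl_point r"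
    by (auto simp: fun_eq_iff vec_eq_iff cyl_point_def axis_def split: option.split)
  ultimately have "(cyl_point r has_derivative (\<lambda>v. 0 + cyl_point 0 v)) (at x)" by (simp only:)
  then show ?thesis by simp
qed

lemma smooth_at_slice: "smooth_at f (cyl_point r x) \<Longrightarrow> smooth_at (\<lambda>x. f (cyl_point r x)) x"
  by (rule smooth_at_affine[OF _ has_derivative_cyl_point])

lemma pd_slice:
  assumes "smooth_at f (cyl_point r x)"
  shows "pd i (\<lambda>x. f (cyl_point r x)) x = pd (Some i) f (cyl_point r x)"
  unfolding pd_compose(2)[OF smooth_at_differentiable[OF assms] has_derivative_cyl_point] sum_option
  by (simp add: axis_def if_distrib[of "\<lambda>u. u * _"] cong: if_cong)

lemma smooth_at_lift: "smooth_at u (xpart y) \<Longrightarrow> smooth_at (\<lambda>z. u (xpart z)) y"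
  unfolding xpart_eq_coords by (rule smooth_at_coords)

lemma pd_lift:
  assumes "smooth_at u (xpart y)"
  shows "pd None (\<lambda>z. u (xpart z)) y = 0" "pd (Some i) (\<lambda>z. u (xpart z)) y = pd i u (xpart y)"
  using assms pd_coords[of Some u y] unfolding xpart_eq_coords by auto

section \<open>Conjugation by the volume density\<close>

context metric_family
begin

lemma open_interval_C: "x \<in> V \<Longrightarrow> \<bar>r\<bar> < \<eta> \<Longrightarrow> cyl_point r x \<in> C"
  by (simp add: mem_C)

lemma cyl0_C [simp]: "x \<in> V \<Longrightarrow> cyl_point 0 x \<in> C"
  using eta by (simp add: mem_C)

definition v0 :: "real^'n \<Rightarrow> real" where "v0 x = sqrt \<bar>det (k 0 x)\<bar>"

definition dlogv0 :: "'n \<Rightarrow> real^('n option) \<Rightarrow> real" where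
  "dlogv0 i y = pd i v0 (xpart y) / v0 (xpart y)"

text \<open>The function \<open>W\<close> below is $w(r)$ at $\rho = -r^2/2$, and \<open>\<beta>\<close> is its reciprocal.\<close>

definition volratio :: "real^('n option) \<Rightarrow> real" where
  "volratio y = sqrt \<bar>det (H y)\<bar> / v0 (xpart y)"

definition W :: "real^('n option) \<Rightarrow> real" where "W y = volratio y powr (1/2)"

definition \<beta> :: "real^('n option) \<Rightarrow> real" where "\<beta> y = volratio y powr (- (1/2))"

lemma v0_pos: "x \<in> V \<Longrightarrow> v0 x > 0"
  using det_family[of 0 x] eta by (simp add: v0_def)

lemma smooth_at_v0: "x \<in> V \<Longrightarrow> smooth_at v0 x"
proof -
  assume x: "x \<in> V"
  have "smooth_at (\<lambda>y. sqrt \<bar>det (H y)\<bar>) (cyl_point 0 x)"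
    using x by (intro smooth_at_sqrt_det smooth_at_H det_H) auto
  from smooth_at_slice[OF this] show ?thesis by (simp add: v0_def[abs_def] H_def)
qed

lemma smooth_on_v0: "smooth_on V v0"
  by (simp add: smooth_on_iff_smooth_at open_V smooth_at_v0)

lemma xpart_C: "y \<in> C \<Longrightarrow> xpart y \<in> V"
  by (simp add: mem_C)

lemma smooth_at_lift_C: "smooth_on V u \<Longrightarrow> y \<in> C \<Longrightarrow> smooth_at (\<lambda>z. u (xpart z)) y"
  using smooth_at_lift smooth_onD xpart_C by blast

lemma smooth_at_v0_lift [simp]: "y \<in> C \<Longrightarrow> smooth_at (\<lambda>z. v0 (xpart z)) y"
  by (rule smooth_at_lift_C[OF smooth_on_v0])

lemma smooth_at_dlogv0_V: "x \<in> V \<Longrightarrow> smooth_at (\<lambda>x. pd i v0 x / v0 x) x"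
  using v0_pos[of x] smooth_at_v0[of x] by simp

lemma smooth_at_dlogv0 [simp]: "y \<in> C \<Longrightarrow> smooth_at (dlogv0 i) y"
  using smooth_at_lift[OF smooth_at_dlogv0_V[OF xpart_C]] by (simp add: dlogv0_def[abs_def])

lemma pd_dlogv0 [simp]: "y \<in> C \<Longrightarrow> pd None (dlogv0 i) y = 0"
  using pd_lift(1)[OF smooth_at_dlogv0_V[OF xpart_C]] by (simp add: dlogv0_def[abs_def])

lemma volratio_pos: "y \<in> C \<Longrightarrow> volratio y > 0"
  using v0_pos[OF xpart_C] det_H by (simp add: volratio_def)

lemma smooth_at_sqrt_det_H: "y \<in> C \<Longrightarrow> smooth_at (\<lambda>y. sqrt \<bar>det (H y)\<bar>) y"
  by (intro smooth_at_sqrt_det smooth_at_H det_H)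

lemma smooth_at_volratio [simp]: "y \<in> C \<Longrightarrow> smooth_at volratio y"
  using v0_pos[OF xpart_C, of y] smooth_at_sqrt_det_H by (simp add: volratio_def[abs_def])

lemma smooth_at_W [simp]: "y \<in> C \<Longrightarrow> smooth_at W y"
  unfolding W_def[abs_def] by (intro smooth_at_powr volratio_pos) auto

lemma smooth_at_\<beta> [simp]: "y \<in> C \<Longrightarrow> smooth_at \<beta> y"
  unfolding \<beta>_def[abs_def] by (intro smooth_at_powr volratio_pos) auto

lemma \<beta>_W: "y \<in> C \<Longrightarrow> \<beta> y * W y = 1"
  unfolding \<beta>_def W_def using volratio_pos[of y] by (simp add: powr_minus)

lemma W_cyl0: "x \<in> V \<Longrightarrow> W (cyl_point 0 x) = 1"
  using v0_pos[of x] by (simp add: W_def volratio_def v0_def H_def)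

lemma pd_volratio:
  assumes y: "y \<in> C"
  shows "pd None volratio y = dlogvol H None y * volratio y"
    "pd (Some i) volratio y = (dlogvol H (Some i) y - dlogv0 i y) * volratio y"
proof -
  have p: "v0 (xpart y) > 0" by (rule v0_pos[OF xpart_C[OF y]])
  note d = pd_sqrt_det[OF smooth_at_H[OF y] det_H[OF y]]
  note l = pd_lift[OF smooth_at_v0[OF xpart_C[OF y]]]
  have e: "pd a volratio y = pd a (\<lambda>z. sqrt \<bar>det (H z)\<bar>) y / v0 (xpart y)
      - sqrt \<bar>det (H y)\<bar> * pd a (\<lambda>z. v0 (xpart z)) y / (v0 (xpart y))\<^sup>2" for a
  proof -
    have "pd a volratio y = pd a (\<lambda>z. sqrt \<bar>det (H z)\<bar> * inverse (v0 (xpart z))) y"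
      unfolding volratio_def[abs_def] divide_inverse ..
    also have "\<dots> = pd a (\<lambda>z. sqrt \<bar>det (H z)\<bar>) y * inverse (v0 (xpart y))
        + sqrt \<bar>det (H y)\<bar> * (- (inverse (v0 (xpart y)))\<^sup>2 * pd a (\<lambda>z. v0 (xpart z)) y)"
      using p y smooth_at_sqrt_det_H[OF y] by (subst pd_mult) (auto simp: pd_inverse)
    finally show ?thesis by (simp add: field_simps)
  qed
  show "pd None volratio y = dlogvol H None y * volratio y"
    "pd (Some i) volratio y = (dlogvol H (Some i) y - dlogv0 i y) * volratio y"
    unfolding e d l using p by (simp_all add: volratio_def dlogv0_def power2_eq_square field_simps)
qed

lemma pd_volratio_powr:
  assumes y: "y \<in> C"
  shows "pd a (\<lambda>y. volratio y powr b) y = b * pd a volratio y / volratio y * volratio y powr b"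
  using volratio_pos[OF y] y by (simp add: pd_powr powr_diff)

text \<open>The logarithmic derivatives of the density, expressed by the conjugating factor.\<close>

lemma dlogvol_eq:
  assumes y: "y \<in> C"
  shows "dlogvol H None y = - (2 * W y * pd None \<beta> y)"
    "dlogvol H (Some i) y = dlogv0 i y - 2 * W y * pd (Some i) \<beta> y"
proof -
  have *: "pd None \<beta> y = - (1/2) * dlogvol H None y * \<beta> y"
    "pd (Some i) \<beta> y = - (1/2) * (dlogvol H (Some i) y - dlogv0 i y) * \<beta> y"
    unfolding \<beta>_def[abs_def] pd_volratio_powr[OF y] pd_volratio[OF y]
    using volratio_pos[OF y] by auto
  have cancel: "2 * W y * (- (1/2) * d * \<beta> y) = - d" for d
  proof -
    have "2 * W y * (- (1/2) * d * \<beta> y) = - (d * (\<beta> y * W y))" by simp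
    then show ?thesis by (simp only: \<beta>_W[OF y] mult_1_right)
  qed
  show "dlogvol H None y = - (2 * W y * pd None \<beta> y)"
    "dlogvol H (Some i) y = dlogv0 i y - 2 * W y * pd (Some i) \<beta> y"
    unfolding * cancel by simp_all
qed

lemma pd_W: "y \<in> C \<Longrightarrow> 2 * pd None W y = dlogvol H None y * W y"
  unfolding W_def[abs_def] pd_volratio_powr pd_volratio using volratio_pos[of y] by simp

text \<open>The operator $F \mapsto \mathrm{div}_g(b\,dF)$, where the divergence is that of the initial metric $g(0)$
  at every value of the parameter.\<close>

definition div0 :: "('n \<Rightarrow> 'n \<Rightarrow> real^('n option) \<Rightarrow> real) \<Rightarrow> (real^('n option) \<Rightarrow> real) \<Rightarrow> real^('n option) \<Rightarrow> real" where
  "div0 b F y = (\<Sum>i\<in>UNIV. pd (Some i) (\<lambda>z. \<Sum>j\<in>UNIV. b i j z * pd (Some j) F z) y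
     + dlogv0 i y * (\<Sum>j\<in>UNIV. b i j y * pd (Some j) F y))"

text \<open>The potential that conjugation by \<open>W\<close> produces.  Its explicit form only serves to show that it is
  smooth and does not depend on the homogeneity \<open>\<gamma>\<close>.\<close>

definition Q :: "real^('n option) \<Rightarrow> real" where
  "Q y = W y * ((real CARD('n) - 2) * pd None \<beta> y - 2 * y $ None * pd None (pd None \<beta>) y
     + 4 * y $ None * W y * (pd None \<beta> y)\<^sup>2 + div0 Hi \<beta> y
     - 2 * W y * (\<Sum>i\<in>UNIV. pd (Some i) \<beta> y * grad \<beta> i y))"

text \<open>The conjugated ambient Laplacian; \<open>s\<close> stands for $2\gamma+n-2$.\<close>

definition Dop :: "real \<Rightarrow> (real^('n option) \<Rightarrow> real) \<Rightarrow> real^('n option) \<Rightarrow> real" where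
  "Dop s F y = s * pd None F y - 2 * y $ None * pd None (pd None F) y + div0 Hi F y + Q y * F y"

lemma smooth_at_div0 [simp]:
  "y \<in> C \<Longrightarrow> (\<And>i j. smooth_at (b i j) y) \<Longrightarrow> smooth_at F y \<Longrightarrow> smooth_at (div0 b F) y"
  unfolding div0_def[abs_def] by simp

lemma smooth_at_Q [simp]: "y \<in> C \<Longrightarrow> smooth_at Q y"
  unfolding Q_def[abs_def] by simp

lemma smooth_at_Dop [simp]: "y \<in> C \<Longrightarrow> smooth_at F y \<Longrightarrow> smooth_at (Dop s F) y"
  unfolding Dop_def[abs_def] by simp

lemma smooth_Dop: "smooth F \<Longrightarrow> smooth (Dop s F)"
  unfolding smooth_iff by simp

lemma div0_grad: "div0 Hi F y = (\<Sum>i\<in>UNIV. pd (Some i) (grad F i) y + dlogv0 i y * grad F i y)"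
  by (simp add: div0_def grad_def[abs_def])

lemma grad_sym: "y \<in> C \<Longrightarrow> (\<Sum>i\<in>UNIV. pd (Some i) F y * grad E i y) = (\<Sum>i\<in>UNIV. pd (Some i) E y * grad F i y)"
  unfolding grad_def sum_distrib_left
  by (subst sum.swap) (auto intro!: sum.cong simp: sym_Hi mult_ac)

text \<open>Conjugation by the square root of the volume ratio removes the term $-2\rho\,(\log\mathrm{vol})'\partial_\rho$
  and makes the tangential part symmetric for the fixed density of $g(0)$.  The cross terms in the derivatives
  of \<open>F\<close> and \<open>\<beta>\<close> cancel because the inverse metric is symmetric.\<close>

lemma amb_op_conj:
  assumes F: "smooth F" and y: "y \<in> C"
  shows "amb_op \<gamma> (\<lambda>z. F z * \<beta> z) y = Dop (2 * \<gamma> + real CARD('n) - 2) F y * \<beta> y"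
proof -
  have sF: "smooth_at F z" if "z \<in> C" for z using F that by (simp add: smooth_iff)
  let ?\<phi> = "\<lambda>z. F z * \<beta> z"
  have p1: "pd a ?\<phi> z = pd a F z * \<beta> z + F z * pd a \<beta> z" if "z \<in> C" for a z
    using sF that by (simp add: pd_mult)
  have p2: "pd None (pd None ?\<phi>) y = pd None (pd None F) y * \<beta> y + 2 * pd None F y * pd None \<beta> y + F y * pd None (pd None \<beta>) y"
  proof -
    have "pd None (pd None ?\<phi>) y = pd None (\<lambda>z. pd None F z * \<beta> z + F z * pd None \<beta> z) y"
      by (rule pd_cong_open[OF open_C y p1])
    then show ?thesis using sF[OF y] y by (simp add: pd_add pd_mult)
  qed
  have g: "grad ?\<phi> i z = \<beta> z * grad F i z + F z * grad \<beta> i z" if "z \<in> C" for i z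
    unfolding grad_def p1[OF that] by (simp add: sum_distrib_left sum.distrib algebra_simps)
  have pg: "pd (Some i) (grad ?\<phi> i) y = pd (Some i) \<beta> y * grad F i y + \<beta> y * pd (Some i) (grad F i) y
      + pd (Some i) F y * grad \<beta> i y + F y * pd (Some i) (grad \<beta> i) y" for i
  proof -
    have "pd (Some i) (grad ?\<phi> i) y = pd (Some i) (\<lambda>z. \<beta> z * grad F i z + F z * grad \<beta> i z) y"
      by (rule pd_cong_open[OF open_C y g])
    then show ?thesis using sF[OF y] y by (simp add: pd_add pd_mult)
  qed
  let ?T = "\<lambda>E. \<Sum>i\<in>UNIV. pd (Some i) E y * grad \<beta> i y"
  let ?S = "\<Sum>i\<in>UNIV. pd (Some i) \<beta> y * grad F i y"
  have "(\<Sum>i\<in>UNIV. pd (Some i) (grad ?\<phi> i) y + dlogvol H (Some i) y * grad ?\<phi> i y)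
      = \<beta> y * div0 Hi F y + F y * div0 Hi \<beta> y + ?S + ?T F - 2 * (\<beta> y * W y) * ?S - 2 * W y * F y * ?T \<beta>"
    unfolding pg g[OF y] dlogvol_eq[OF y] div0_grad
    by (simp add: sum.distrib sum_subtractf sum_distrib_left algebra_simps)
  from this[unfolded \<beta>_W[OF y]] have x: "(\<Sum>i\<in>UNIV. pd (Some i) (grad ?\<phi> i) y + dlogvol H (Some i) y * grad ?\<phi> i y)
      = \<beta> y * div0 Hi F y + F y * (div0 Hi \<beta> y - 2 * W y * ?T \<beta>)"
    using grad_sym[OF y, of F \<beta>] by (simp add: algebra_simps)
  have "\<beta> y \<noteq> 0" using \<beta>_W[OF y] by auto
  then have W: "W y = 1 / \<beta> y" "\<beta> y \<noteq> 0"
    using \<beta>_W[OF y] by (simp_all add: eq_divide_eq mult.commute)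
  show ?thesis
    unfolding amb_op_def x p1[OF y] p2 Dop_def Q_def dlogvol_eq(1)[OF y] W(1)
    using W(2) by (simp add: field_simps power2_eq_square)
qed

text \<open>A relation that determines the potential: on \<open>W\<close>, the conjugated operator is the ambient Laplacian of a
  pure power $t^\gamma$, which involves only the logarithmic derivative of the volume.  Any power would do;
  the proof uses $\gamma = 1$.\<close>

lemma div0_W:
  assumes y: "y \<in> C"
  shows "div0 Hi W y + Q y * W y = (2 - real CARD('n)) * pd None W y + 2 * y $ None * pd None (pd None W) y"
proof -
  have eq: "W z * \<beta> z = 1" if "z \<in> C" for z using \<beta>_W[OF that] by (simp add: mult.commute)
  have 1: "pd a (\<lambda>z. W z * \<beta> z) z = 0" if "z \<in> C" for a z
  proof -
    have "pd a (\<lambda>z. W z * \<beta> z) z = pd a (\<lambda>z. 1) z" by (rule pd_cong_open[OF open_C that eq])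
    then show ?thesis by simp
  qed
  have 2: "pd None (pd None (\<lambda>z. W z * \<beta> z)) y = 0"
  proof -
    have "pd None (pd None (\<lambda>z. W z * \<beta> z)) y = pd None (\<lambda>z. 0) y" by (rule pd_cong_open[OF open_C y 1])
    then show ?thesis by simp
  qed
  have 3: "grad (\<lambda>z. W z * \<beta> z) i z = 0" if "z \<in> C" for i z
    by (simp add: grad_def 1[OF that])
  have 4: "pd (Some i) (grad (\<lambda>z. W z * \<beta> z) i) y = 0" for i
  proof -
    have "pd (Some i) (grad (\<lambda>z. W z * \<beta> z) i) y = pd (Some i) (\<lambda>z. 0) y" by (rule pd_cong_open[OF open_C y 3])
    then show ?thesis by simp
  qed
  have "Dop (2 * 1 + real CARD('n) - 2) W y * \<beta> y = dlogvol H None y"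
    using amb_op_conj[of W y 1] y unfolding amb_op_def 1[OF y] 2 3[OF y] 4 eq[OF y] by (simp add: smooth_iff)
  then have "Dop (real CARD('n)) W y * (\<beta> y * W y) = dlogvol H None y * W y"
    by (simp add: mult.assoc[symmetric])
  then have "Dop (real CARD('n)) W y = 2 * pd None W y"
    by (simp add: \<beta>_W[OF y] pd_W[OF y])
  then show ?thesis by (simp add: Dop_def algebra_simps)
qed

text \<open>Each application of the Laplacian lowers the homogeneity by 2, hence the parameter \<open>s\<close> by 4.\<close>

primrec iterD :: "nat \<Rightarrow> real \<Rightarrow> (real^('n option) \<Rightarrow> real) \<Rightarrow> real^('n option) \<Rightarrow> real" where
  "iterD 0 s F = F"
| "iterD (Suc m) s F = Dop (s - 4 * real m) (iterD m s F)"

lemma smooth_iterD: "smooth F \<Longrightarrow> smooth (iterD m s F)"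
  by (induction m) (auto intro: smooth_Dop)

lemma laplacian_amb_iterate:
  assumes F: "smooth F" and y: "y \<in> amb_dom"
  shows "(laplacian (amb_metric k) ^^ m) (\<lambda>y. (y $ AT) powr \<gamma> * (F (coords amb_index y) * \<beta> (coords amb_index y))) y
    = (y $ AT) powr (\<gamma> - 2 * real m) * (iterD m (2 * \<gamma> + real CARD('n) - 2) F (coords amb_index y) * \<beta> (coords amb_index y))"
  using y
proof (induction m arbitrary: y)
  case (Suc m)
  let ?F = "iterD m (2 * \<gamma> + real CARD('n) - 2) F"
  have sF: "smooth ?F" by (rule smooth_iterD[OF F])
  then have s: "smooth (\<lambda>z. ?F z * \<beta> z)" by (simp add: smooth_iff)
  note C = amb_domD(2)[OF Suc.prems]
  have "(laplacian (amb_metric k) ^^ Suc m) (\<lambda>y. (y $ AT) powr \<gamma> * (F (coords amb_index y) * \<beta> (coords amb_index y))) y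
      = laplacian (amb_metric k) (\<lambda>y. (y $ AT) powr (\<gamma> - 2 * real m) * (?F (coords amb_index y) * \<beta> (coords amb_index y))) y"
    unfolding funpow.simps comp_apply
    by (rule laplacian_cong_open[OF open_amb_dom Suc.prems Suc.IH])
  also have "\<dots> = (y $ AT) powr (\<gamma> - 2 * real m - 2) * (Dop (2 * (\<gamma> - 2 * real m) + real CARD('n) - 2) ?F (coords amb_index y) * \<beta> (coords amb_index y))"
    unfolding laplacian_amb[OF s Suc.prems] amb_op_conj[OF sF C] ..
  also have "\<gamma> - 2 * real m - 2 = \<gamma> - 2 * real (Suc m)" by simp
  also have "2 * (\<gamma> - 2 * real m) + real CARD('n) - 2 = 2 * \<gamma> + real CARD('n) - 2 - 4 * real m" by simp
  finally show ?case by simp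
qed simp

end

section \<open>Normal derivatives along the hypersurface\<close>

lemma smooth_at_pd_funpow [simp]: "smooth_at f y \<Longrightarrow> smooth_at ((pd a ^^ m) f) y"
  by (induction m) auto

context metric_family
begin

text \<open>The operator whose coefficients are the \<open>m\<close>-th $\rho$-derivatives of those of the tangential part of
  the conjugated Laplacian.\<close>

definition Mop :: "nat \<Rightarrow> (real^('n option) \<Rightarrow> real) \<Rightarrow> real^('n option) \<Rightarrow> real" where
  "Mop m F y = div0 (\<lambda>i j. (pd None ^^ m) (Hi i j)) F y + (pd None ^^ m) Q y * F y"

lemma smooth_at_Mop [simp]: "y \<in> C \<Longrightarrow> smooth_at F y \<Longrightarrow> smooth_at (Mop m F) y"
  unfolding Mop_def[abs_def] by simp

text \<open>The divergence uses a density that does not depend on $\rho$, so that only the coefficients and the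
  argument are differentiated.\<close>

lemma pd_div0:
  assumes b: "\<And>i j. smooth (b i j)" and F: "smooth F" and y: "y \<in> C"
  shows "pd None (div0 b F) y = div0 (\<lambda>i j. pd None (b i j)) F y + div0 b (pd None F) y"
proof -
  define E where "E b F i z = (\<Sum>j\<in>UNIV. b i j z * pd (Some j) F z)"
    for b :: "'n \<Rightarrow> 'n \<Rightarrow> real^('n option) \<Rightarrow> real" and F i z
  have s: "smooth_at (b i j) z" "smooth_at F z" if "z \<in> C" for i j z
    using b F that by (auto simp: smooth_iff)
  have sE: "smooth_at (E b F i) z" "smooth_at (E (\<lambda>i j. pd None (b i j)) F i) z" "smooth_at (E b (pd None F) i) z"
    if "z \<in> C" for i z using s[OF that] by (simp_all add: E_def[abs_def])
  have E1: "pd None (E b F i) z = E (\<lambda>i j. pd None (b i j)) F i z + E b (pd None F) i z" if "z \<in> C" for i z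
    unfolding E_def using s[OF that] pd_commute[OF s(2)[OF that], of None]
    by (simp add: pd_sum pd_mult sum.distrib)
  have E2: "pd None (pd (Some i) (E b F i)) y
      = pd (Some i) (E (\<lambda>i j. pd None (b i j)) F i) y + pd (Some i) (E b (pd None F) i) y" for i
  proof -
    have "pd None (pd (Some i) (E b F i)) y = pd (Some i) (pd None (E b F i)) y"
      by (rule pd_commute[OF sE(1)[OF y]])
    also have "\<dots> = pd (Some i) (\<lambda>z. E (\<lambda>i j. pd None (b i j)) F i z + E b (pd None F) i z) y"
      by (rule pd_cong_open[OF open_C y E1])
    finally show ?thesis using sE[OF y] by (simp add: pd_add)
  qed
  have D: "div0 b F = (\<lambda>y. \<Sum>i\<in>UNIV. pd (Some i) (E b F i) y + dlogv0 i y * E b F i y)" for b F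
    by (simp add: div0_def[abs_def] E_def[abs_def])
  show ?thesis unfolding D using y sE[OF y] E1[OF y] E2
    by (simp add: pd_sum pd_add pd_mult sum.distrib algebra_simps)
qed

lemma pd_Mop:
  assumes F: "smooth F" and y: "y \<in> C"
  shows "pd None (Mop m F) y = Mop (Suc m) F y + Mop m (pd None F) y"
proof -
  have s: "smooth ((pd None ^^ m) (Hi i j))" for i j by (simp add: smooth_iff)
  have sF: "smooth_at F y" using F y by (simp add: smooth_iff)
  have "pd None (Mop m F) y = pd None (div0 (\<lambda>i j. (pd None ^^ m) (Hi i j)) F) y
      + (pd None ((pd None ^^ m) Q) y * F y + (pd None ^^ m) Q y * pd None F y)"
    unfolding Mop_def[abs_def] using y sF by (simp add: pd_add pd_mult)
  then show ?thesis unfolding pd_div0[OF s F y] Mop_def by simp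
qed

lemma smooth_pd: "smooth F \<Longrightarrow> smooth (pd a F)"
  by (rule smooth_on_pd)

lemma Dop_eq: "Dop s F y = s * pd None F y - 2 * y $ None * pd None (pd None F) y + Mop 0 F y"
  by (simp add: Dop_def Mop_def)

text \<open>Differentiating the coefficient $-2\rho$ of the second derivative lowers the coefficient of the first
  derivative by 2; the coefficient $-2\rho$ itself vanishes on the slice.\<close>

lemma pd_Dop:
  assumes F: "smooth F" and y: "y \<in> C"
  shows "pd None (Dop s F) y = Dop (s - 2) (pd None F) y + Mop 1 F y"
proof -
  have s: "smooth_at F y" using F y by (simp add: smooth_iff)
  show ?thesis unfolding Dop_eq[abs_def]
    using s y pd_Mop[OF F y, of 0] by (simp add: pd_add pd_diff pd_mult algebra_simps)
qed

lemma pd_cong_C: "y \<in> C \<Longrightarrow> (\<And>z. z \<in> C \<Longrightarrow> f z = g z) \<Longrightarrow> pd a f y = pd a g y"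
  using pd_cong_open[OF open_C] by blast

lemma pd2_Mop:
  assumes F: "smooth F" and y: "y \<in> C"
  shows "pd None (pd None (Mop m F)) y = Mop (m + 2) F y + 2 * Mop (m + 1) (pd None F) y + Mop m (pd None (pd None F)) y"
proof -
  have s: "smooth_at F y" "smooth (pd None F)" using F y smooth_pd by (auto simp: smooth_iff)
  have "pd None (pd None (Mop m F)) y = pd None (\<lambda>z. Mop (Suc m) F z + Mop m (pd None F) z) y"
    by (rule pd_cong_C[OF y pd_Mop[OF F]])
  then show ?thesis using s y pd_Mop[OF F y] pd_Mop[OF s(2) y] by (simp add: pd_add)
qed

lemma pd3_Mop:
  assumes F: "smooth F" and y: "y \<in> C"
  shows "pd None (pd None (pd None (Mop m F))) y = Mop (m + 3) F y + 3 * Mop (m + 2) (pd None F) y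
    + 3 * Mop (m + 1) (pd None (pd None F)) y + Mop m (pd None (pd None (pd None F))) y"
proof -
  have s: "smooth_at F y" "smooth (pd None F)" "smooth (pd None (pd None F))"
    using F y smooth_pd by (auto simp: smooth_iff)
  have "pd None (pd None (pd None (Mop m F))) y
      = pd None (\<lambda>z. Mop (m + 2) F z + 2 * Mop (m + 1) (pd None F) z + Mop m (pd None (pd None F)) z) y"
    by (rule pd_cong_C[OF y pd2_Mop[OF F]])
  then show ?thesis using s y pd_Mop[OF F y] pd_Mop[OF s(2) y] pd_Mop[OF s(3) y]
    by (simp add: pd_add pd_cmult numeral_3_eq_3)
qed

lemma pd2_Dop:
  assumes F: "smooth F" and y: "y \<in> C"
  shows "pd None (pd None (Dop s F)) y = Dop (s - 4) (pd None (pd None F)) y + 2 * Mop 1 (pd None F) y + Mop 2 F y"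
proof -
  have s: "smooth_at F y" "smooth (pd None F)" using F y smooth_pd by (auto simp: smooth_iff)
  have "pd None (pd None (Dop s F)) y = pd None (\<lambda>z. Dop (s - 2) (pd None F) z + Mop 1 F z) y"
    by (rule pd_cong_C[OF y pd_Dop[OF F]])
  then show ?thesis using s y pd_Mop[OF F y, of 1] pd_Dop[OF s(2) y] by (simp add: pd_add numeral_2_eq_2)
qed

lemma pd3_Dop:
  assumes F: "smooth F" and y: "y \<in> C"
  shows "pd None (pd None (pd None (Dop s F))) y = Dop (s - 6) (pd None (pd None (pd None F))) y
    + 3 * Mop 1 (pd None (pd None F)) y + 3 * Mop 2 (pd None F) y + Mop 3 F y"
proof -
  have s: "smooth_at F y" "smooth (pd None F)" "smooth (pd None (pd None F))"
    using F y smooth_pd by (auto simp: smooth_iff)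
  have "pd None (pd None (pd None (Dop s F))) y
      = pd None (\<lambda>z. Dop (s - 4) (pd None (pd None F)) z + 2 * Mop 1 (pd None F) z + Mop 2 F z) y"
    by (rule pd_cong_C[OF y pd2_Dop[OF F]])
  then show ?thesis
    using s y pd_Mop[OF F y, of 2] pd_Mop[OF s(2) y, of 1] pd_Dop[OF s(3) y]
    by (simp add: pd_add pd_cmult numeral_2_eq_2 numeral_3_eq_3)
qed

subsection \<open>The operators on the slice\<close>

text \<open>The restrictions of these operators and of normal derivatives to $\rho = 0$.  They take the value 0
  outside \<open>V\<close>, so that identities valid on \<open>V\<close> are equations between functions.\<close>

definition mop :: "nat \<Rightarrow> (real^'n \<Rightarrow> real) \<Rightarrow> real^'n \<Rightarrow> real" where
  "mop m u x = (if x \<in> V then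
     (\<Sum>i\<in>UNIV. pd i (\<lambda>x. \<Sum>j\<in>UNIV. (pd None ^^ m) (Hi i j) (cyl_point 0 x) * pd j u x) x
        + pd i v0 x / v0 x * (\<Sum>j\<in>UNIV. (pd None ^^ m) (Hi i j) (cyl_point 0 x) * pd j u x))
     + (pd None ^^ m) Q (cyl_point 0 x) * u x else 0)"

definition jet :: "nat \<Rightarrow> (real^('n option) \<Rightarrow> real) \<Rightarrow> real^'n \<Rightarrow> real" where
  "jet j F x = (if x \<in> V then (pd None ^^ j) F (cyl_point 0 x) else 0)"

lemma mop_cong:
  assumes "\<And>x. x \<in> V \<Longrightarrow> u x = w x" shows "mop m u = mop m w"
proof
  fix x
  have 1: "pd j u x = pd j w x" if "x \<in> V" for x j by (rule pd_cong_open[OF open_V that assms])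
  have 2: "pd i (\<lambda>x. \<Sum>j\<in>UNIV. (pd None ^^ m) (Hi i j) (cyl_point 0 x) * pd j u x) x
     = pd i (\<lambda>x. \<Sum>j\<in>UNIV. (pd None ^^ m) (Hi i j) (cyl_point 0 x) * pd j w x) x" if "x \<in> V" for x i
    by (rule pd_cong_open[OF open_V that]) (simp add: 1)
  show "mop m u x = mop m w x" using 1 2 assms by (simp add: mop_def)
qed

lemma smooth_at_coeff [simp]: "x \<in> V \<Longrightarrow> smooth_at (\<lambda>x. (pd None ^^ m) (Hi i j) (cyl_point 0 x)) x"
  by (rule smooth_at_slice) simp

lemma smooth_V_iff: "smooth_on V u \<longleftrightarrow> (\<forall>x\<in>V. smooth_at u x)"
  by (simp add: smooth_on_iff_smooth_at open_V)

lemma mop_add: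
  assumes "smooth_on V u" "smooth_on V w"
  shows "mop m (\<lambda>x. u x + w x) = (\<lambda>x. mop m u x + mop m w x)"
proof
  fix x
  have s: "smooth_at u x" "smooth_at w x" if "x \<in> V" for x using assms that by (auto simp: smooth_V_iff)
  have e: "(\<Sum>j\<in>UNIV. (pd None ^^ m) (Hi i j) (cyl_point 0 x) * pd j (\<lambda>x. u x + w x) x)
    = (\<Sum>j\<in>UNIV. (pd None ^^ m) (Hi i j) (cyl_point 0 x) * pd j u x)
      + (\<Sum>j\<in>UNIV. (pd None ^^ m) (Hi i j) (cyl_point 0 x) * pd j w x)" if "x \<in> V" for x i
    using s[OF that] by (simp add: pd_add sum.distrib algebra_simps)
  have p: "pd i (\<lambda>x. \<Sum>j\<in>UNIV. (pd None ^^ m) (Hi i j) (cyl_point 0 x) * pd j (\<lambda>x. u x + w x) x) x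
     = pd i (\<lambda>x. \<Sum>j\<in>UNIV. (pd None ^^ m) (Hi i j) (cyl_point 0 x) * pd j u x) x
       + pd i (\<lambda>x. \<Sum>j\<in>UNIV. (pd None ^^ m) (Hi i j) (cyl_point 0 x) * pd j w x) x" if "x \<in> V" for x i
  proof -
    have "pd i (\<lambda>x. \<Sum>j\<in>UNIV. (pd None ^^ m) (Hi i j) (cyl_point 0 x) * pd j (\<lambda>x. u x + w x) x) x
      = pd i (\<lambda>x. (\<Sum>j\<in>UNIV. (pd None ^^ m) (Hi i j) (cyl_point 0 x) * pd j u x)
      + (\<Sum>j\<in>UNIV. (pd None ^^ m) (Hi i j) (cyl_point 0 x) * pd j w x)) x"
      by (rule pd_cong_open[OF open_V that e])
    then show ?thesis using s[OF that] that by (simp add: pd_add)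
  qed
  show "mop m (\<lambda>x. u x + w x) x = mop m u x + mop m w x"
    unfolding mop_def using e p by (simp add: sum.distrib algebra_simps)
qed

lemma mop_cmult:
  assumes "smooth_on V u"
  shows "mop m (\<lambda>x. c * u x) = (\<lambda>x. c * mop m u x)"
proof
  fix x
  have s: "smooth_at u x" if "x \<in> V" for x using assms that by (auto simp: smooth_V_iff)
  have e: "(\<Sum>j\<in>UNIV. (pd None ^^ m) (Hi i j) (cyl_point 0 x) * pd j (\<lambda>x. c * u x) x)
    = c * (\<Sum>j\<in>UNIV. (pd None ^^ m) (Hi i j) (cyl_point 0 x) * pd j u x)" if "x \<in> V" for x i
    using s[OF that] by (simp add: pd_cmult sum_distrib_left algebra_simps)
  have p: "pd i (\<lambda>x. \<Sum>j\<in>UNIV. (pd None ^^ m) (Hi i j) (cyl_point 0 x) * pd j (\<lambda>x. c * u x) x) x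
     = c * pd i (\<lambda>x. \<Sum>j\<in>UNIV. (pd None ^^ m) (Hi i j) (cyl_point 0 x) * pd j u x) x" if "x \<in> V" for x i
  proof -
    have "pd i (\<lambda>x. \<Sum>j\<in>UNIV. (pd None ^^ m) (Hi i j) (cyl_point 0 x) * pd j (\<lambda>x. c * u x) x) x
      = pd i (\<lambda>x. c * (\<Sum>j\<in>UNIV. (pd None ^^ m) (Hi i j) (cyl_point 0 x) * pd j u x)) x"
      by (rule pd_cong_open[OF open_V that e])
    then show ?thesis using s[OF that] that by (simp add: pd_cmult)
  qed
  show "mop m (\<lambda>x. c * u x) x = c * mop m u x"
    unfolding mop_def using e p by (simp add: sum.distrib sum_distrib_left algebra_simps)
qed

lemma smooth_on_mop:
  assumes "smooth_on V u" shows "smooth_on V (mop m u)"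
proof -
  have q: "smooth_at (\<lambda>x. (pd None ^^ m) Q (cyl_point 0 x)) x" if "x \<in> V" for x
    using that by (intro smooth_at_slice) simp
  have s: "smooth_at u x" if "x \<in> V" for x using assms that by (auto simp: smooth_V_iff)
  have nz: "v0 x \<noteq> 0" if "x \<in> V" for x using v0_pos[OF that] by simp
  have "smooth_on V (\<lambda>x. (\<Sum>i\<in>UNIV. pd i (\<lambda>x. \<Sum>j\<in>UNIV. (pd None ^^ m) (Hi i j) (cyl_point 0 x) * pd j u x) x
        + pd i v0 x / v0 x * (\<Sum>j\<in>UNIV. (pd None ^^ m) (Hi i j) (cyl_point 0 x) * pd j u x))
     + (pd None ^^ m) Q (cyl_point 0 x) * u x)"
    using q s smooth_at_v0 nz by (simp add: smooth_V_iff)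
  then show ?thesis by (rule smooth_on_cong) (simp add: mop_def)
qed

lemma Mop_slice:
  assumes F: "smooth F" and x: "x \<in> V"
  shows "Mop m F (cyl_point 0 x) = mop m (jet 0 F) x"
proof -
  have s: "smooth_at F (cyl_point 0 x)" if "x \<in> V" for x using F that by (simp add: smooth_iff)
  have d: "pd (Some j) F (cyl_point 0 x) = pd j (\<lambda>x. F (cyl_point 0 x)) x" if "x \<in> V" for j x
    using pd_slice[OF s[OF that]] by simp
  have "pd (Some i) (\<lambda>z. \<Sum>j\<in>UNIV. (pd None ^^ m) (Hi i j) z * pd (Some j) F z) (cyl_point 0 x)
     = pd i (\<lambda>x. \<Sum>j\<in>UNIV. (pd None ^^ m) (Hi i j) (cyl_point 0 x) * pd (Some j) F (cyl_point 0 x)) x" for i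
    using s[OF x] x by (subst pd_slice) simp_all
  also have "\<dots> i = pd i (\<lambda>x. \<Sum>j\<in>UNIV. (pd None ^^ m) (Hi i j) (cyl_point 0 x) * pd j (\<lambda>x. F (cyl_point 0 x)) x) x" for i
    by (rule pd_cong_open[OF open_V x]) (simp add: d)
  finally have e: "pd (Some i) (\<lambda>z. \<Sum>j\<in>UNIV. (pd None ^^ m) (Hi i j) z * pd (Some j) F z) (cyl_point 0 x)
     = pd i (\<lambda>x. \<Sum>j\<in>UNIV. (pd None ^^ m) (Hi i j) (cyl_point 0 x) * pd j (\<lambda>x. F (cyl_point 0 x)) x) x" for i .
  have "Mop m F (cyl_point 0 x) = mop m (\<lambda>x. F (cyl_point 0 x)) x"
    unfolding Mop_def div0_def e mop_def by (simp add: x d[OF x] dlogv0_def)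
  also have "mop m (\<lambda>x. F (cyl_point 0 x)) = mop m (jet 0 F)"
    by (rule mop_cong) (simp add: jet_def)
  finally show ?thesis .
qed

lemma jet_pd: "jet j (pd None F) = jet (Suc j) F"
  by (simp add: jet_def fun_eq_iff funpow_swap1)

lemma jet_Dop:
  assumes F: "smooth F"
  shows "jet 0 (Dop s F) = (\<lambda>x. s * jet 1 F x + mop 0 (jet 0 F) x)"
    "jet 1 (Dop s F) = (\<lambda>x. (s - 2) * jet 2 F x + mop 0 (jet 1 F) x + mop 1 (jet 0 F) x)"
    "jet 2 (Dop s F) = (\<lambda>x. (s - 4) * jet 3 F x + mop 0 (jet 2 F) x + 2 * mop 1 (jet 1 F) x + mop 2 (jet 0 F) x)"
    "jet 3 (Dop s F) = (\<lambda>x. (s - 6) * jet 4 F x + mop 0 (jet 3 F) x + 3 * mop 1 (jet 2 F) x + 3 * mop 2 (jet 1 F) x + mop 3 (jet 0 F) x)"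
proof -
  have s: "smooth (pd None F)" "smooth (pd None (pd None F))" "smooth (pd None (pd None (pd None F)))"
    using F smooth_pd by blast+
  have D: "Dop s F (cyl_point 0 x) = s * jet 1 F x + mop 0 (jet 0 F) x" if "smooth F" "x \<in> V" for s F x
    using that Mop_slice[OF that, of 0] by (simp add: Dop_eq jet_def[of "Suc 0"])
  have z: "mop m u x = 0" "jet m F x = 0" if "x \<notin> V" for m u x F using that by (simp_all add: mop_def jet_def)
  show "jet 0 (Dop s F) = (\<lambda>x. s * jet 1 F x + mop 0 (jet 0 F) x)"
    using D[OF F] z by (auto simp: jet_def[of 0 "Dop s F"] fun_eq_iff)
  show "jet 1 (Dop s F) = (\<lambda>x. (s - 2) * jet 2 F x + mop 0 (jet 1 F) x + mop 1 (jet 0 F) x)"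
    using D[OF s(1)] z pd_Dop[OF F] Mop_slice[OF F]
    by (auto simp: jet_def[of "Suc 0" "Dop s F"] fun_eq_iff jet_pd numeral_2_eq_2)
  show "jet 2 (Dop s F) = (\<lambda>x. (s - 4) * jet 3 F x + mop 0 (jet 2 F) x + 2 * mop 1 (jet 1 F) x + mop 2 (jet 0 F) x)"
    using D[OF s(2)] z pd2_Dop[OF F] Mop_slice[OF F] Mop_slice[OF s(1)]
    by (auto simp: jet_def[of "Suc (Suc 0)" "Dop s F"] fun_eq_iff jet_pd numeral_2_eq_2 numeral_3_eq_3)
  show "jet 3 (Dop s F) = (\<lambda>x. (s - 6) * jet 4 F x + mop 0 (jet 3 F) x + 3 * mop 1 (jet 2 F) x + 3 * mop 2 (jet 1 F) x + mop 3 (jet 0 F) x)"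
    using D[OF s(3)] z pd3_Dop[OF F] Mop_slice[OF F] Mop_slice[OF s(1)] Mop_slice[OF s(2)]
    by (auto simp: jet_def[of "Suc (Suc (Suc 0))" "Dop s F"] fun_eq_iff jet_pd numeral_eq_Suc)
qed


lemma smooth_lift: "smooth_on V u \<Longrightarrow> smooth (\<lambda>y. u (xpart y))"
  by (simp add: smooth_iff smooth_at_lift_C)

lemma jet_lift:
  assumes u: "smooth_on V u"
  shows "jet 0 (\<lambda>y. u (xpart y)) = (\<lambda>x. if x \<in> V then u x else 0)"
    "jet (Suc j) (\<lambda>y. u (xpart y)) = (\<lambda>x. 0)"
proof -
  have 0: "pd None (\<lambda>y. u (xpart y)) y = 0" if "y \<in> C" for y
    using pd_lift(1) smooth_onD[OF u xpart_C[OF that]] by blast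
  have "(pd None ^^ j) (pd None (\<lambda>y. u (xpart y))) y = 0" if "y \<in> C" for y
    using that
  proof (induction j arbitrary: y)
    case (Suc j)
    then have "pd None ((pd None ^^ j) (pd None (\<lambda>y. u (xpart y)))) y = pd None (\<lambda>y. 0) y"
      by (intro pd_cong_C) auto
    then show ?case by simp
  qed (simp add: 0)
  then show "jet (Suc j) (\<lambda>y. u (xpart y)) = (\<lambda>x. 0)"
    by (simp add: jet_def fun_eq_iff flip: funpow_swap1)
qed (simp add: jet_def fun_eq_iff)

lemma mop_zero: "mop m (\<lambda>x. 0) = (\<lambda>x. 0)"
  by (simp add: mop_def fun_eq_iff)

lemma mop_restrict: "mop m (\<lambda>x. if x \<in> V then u x else 0) = mop m u"
  by (rule mop_cong) simp

lemma smooth_V_add: "smooth_on V u \<Longrightarrow> smooth_on V w \<Longrightarrow> smooth_on V (\<lambda>x. u x + w x)"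
  and smooth_V_cmult: "smooth_on V u \<Longrightarrow> smooth_on V (\<lambda>x. c * u x)"
  by (simp_all add: smooth_V_iff)

text \<open>The GJMS-operators of order up to 8 in terms of the operators \<open>mop\<close>.  Starting from a function that
  does not depend on $\rho$, the formulas for the normal derivatives are applied to one factor of the
  composition after the other; a composition of \<open>N\<close> factors needs the derivatives of order less than
  \<open>N\<close> of the first factor.\<close>

lemma gjms_slice:
  assumes u: "smooth_on V u" and x: "x \<in> V"
  defines "F \<equiv> \<lambda>y. u (xpart y)"
  shows "iterD 1 0 F (cyl_point 0 x) = mop 0 u x"
    "iterD 2 2 F (cyl_point 0 x) = mop 0 (mop 0 u) x - 2 * mop 1 u x"
    "iterD 3 4 F (cyl_point 0 x) = mop 0 (mop 0 (mop 0 u)) x - 4 * mop 1 (mop 0 u) x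
       - 4 * mop 0 (mop 1 u) x + 8 * mop 2 u x"
    "iterD 4 6 F (cyl_point 0 x) = mop 0 (mop 0 (mop 0 (mop 0 u))) x
       - 6 * (mop 1 (mop 0 (mop 0 u)) x + mop 0 (mop 0 (mop 1 u)) x) - 8 * mop 0 (mop 1 (mop 0 u)) x
       + 36 * mop 1 (mop 1 u) x + 24 * (mop 2 (mop 0 u) x + mop 0 (mop 2 u) x) - 48 * mop 3 u x"
proof -
  have F: "smooth F" unfolding F_def by (rule smooth_lift[OF u])
  note sD = smooth_Dop[OF F] smooth_Dop[OF smooth_Dop[OF F]] smooth_Dop[OF smooth_Dop[OF smooth_Dop[OF F]]]
  have jF: "jet 0 F = (\<lambda>x. if x \<in> V then u x else 0)" "jet 1 F = (\<lambda>x. 0)" "jet 2 F = (\<lambda>x. 0)"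
    "jet 3 F = (\<lambda>x. 0)" "jet 4 F = (\<lambda>x. 0)"
    unfolding F_def using jet_lift[OF u] by (simp_all add: numeral_eq_Suc)
  note j1 = jet_Dop[OF F, unfolded jF mop_restrict mop_zero]
  note sm = smooth_on_mop smooth_V_add smooth_V_cmult u
  have j: "iterD m s F (cyl_point 0 x) = jet 0 (iterD m s F) x" for m s using x by (simp add: jet_def)
  show "iterD 1 0 F (cyl_point 0 x) = mop 0 u x"
    unfolding j by (simp add: j1)
  note lin = mop_add mop_cmult
  show "iterD 2 2 F (cyl_point 0 x) = mop 0 (mop 0 u) x - 2 * mop 1 u x"
    unfolding j by (simp add: numeral_2_eq_2 jet_Dop[OF sD(1)] j1 del: One_nat_def)
  show "iterD 3 4 F (cyl_point 0 x) = mop 0 (mop 0 (mop 0 u)) x - 4 * mop 1 (mop 0 u) x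
       - 4 * mop 0 (mop 1 u) x + 8 * mop 2 u x"
    unfolding j by (simp add: numeral_3_eq_3 jet_Dop[OF sD(2)] jet_Dop[OF sD(1)] j1 lin sm del: One_nat_def)
  show "iterD 4 6 F (cyl_point 0 x) = mop 0 (mop 0 (mop 0 (mop 0 u))) x
       - 6 * (mop 1 (mop 0 (mop 0 u)) x + mop 0 (mop 0 (mop 1 u)) x) - 8 * mop 0 (mop 1 (mop 0 u)) x
       + 36 * mop 1 (mop 1 u) x + 24 * (mop 2 (mop 0 u) x + mop 0 (mop 2 u) x) - 48 * mop 3 u x"
  proof -
    define A where "A = Dop 6 F"
    define B where "B = Dop 2 A"
    define E where "E = Dop (- 2) B"
    have s: "smooth A" "smooth B" "smooth E"
      unfolding A_def B_def E_def by (intro smooth_Dop F)+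
    have iD: "iterD 4 6 F = Dop (- 6) E"
      unfolding A_def B_def E_def by (simp add: numeral_eq_Suc)
    have A: "jet 0 A = mop 0 u" "jet 1 A = mop 1 u" "jet 2 A = mop 2 u" "jet 3 A = mop 3 u"
      unfolding A_def j1 by simp_all
    have B: "jet 0 B = (\<lambda>x. 2 * mop 1 u x + mop 0 (mop 0 u) x)"
      "jet 1 B = (\<lambda>x. mop 0 (mop 1 u) x + mop 1 (mop 0 u) x)"
      "jet 2 B = (\<lambda>x. (- 2) * mop 3 u x + (mop 0 (mop 2 u) x + (2 * mop 1 (mop 1 u) x + mop 2 (mop 0 u) x)))"
      unfolding B_def jet_Dop[OF s(1)] A by (simp_all add: fun_eq_iff)
    have m: "mop m (jet 0 B) = (\<lambda>x. 2 * mop m (mop 1 u) x + mop m (mop 0 (mop 0 u)) x)"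
      "mop m (jet 1 B) = (\<lambda>x. mop m (mop 0 (mop 1 u)) x + mop m (mop 1 (mop 0 u)) x)" for m
      unfolding B by (simp_all only: lin sm)
    have E: "jet 0 E = (\<lambda>x. (- 2) * jet 1 B x + mop 0 (jet 0 B) x)"
      "jet 1 E = (\<lambda>x. (- 4) * jet 2 B x + mop 0 (jet 1 B) x + mop 1 (jet 0 B) x)"
      unfolding E_def jet_Dop[OF s(2)] by simp_all
    have "smooth_on V (jet 0 B)" "smooth_on V (jet 1 B)" unfolding B by (simp_all only: sm)
    then have m2: "mop 0 (jet 0 E) = (\<lambda>x. (- 2) * mop 0 (jet 1 B) x + mop 0 (mop 0 (jet 0 B)) x)"
      unfolding E by (simp only: lin sm)
    have m3: "mop 0 (\<lambda>x. 2 * mop 0 (mop 1 u) x + mop 0 (mop 0 (mop 0 u)) x) = (\<lambda>x. 2 * mop 0 (mop 0 (mop 1 u)) x + mop 0 (mop 0 (mop 0 (mop 0 u))) x)"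
      by (simp only: lin sm)
    have "iterD 4 6 F (cyl_point 0 x) = jet 0 (Dop (- 6) E) x"
      using j[of 4 6] unfolding iD .
    then show ?thesis
      unfolding jet_Dop[OF s(3)] m2 E(2) m m3 B(3) by simp
  qed
qed

text \<open>The third derivative at $\rho = 0$ of the relation for \<open>W\<close>.  Since $W = 1$ there, it expresses the
  potential $m_3(1)$ by $m_2$, $m_1$ and $m_0$ applied to the coefficients of \<open>W\<close>.\<close>

lemma mop_W:
  assumes x: "x \<in> V"
  shows "mop 3 (\<lambda>x. 1) x + 3 * mop 2 (jet 1 W) x + 3 * mop 1 (jet 2 W) x + mop 0 (jet 3 W) x
    = (8 - real CARD('n)) * jet 4 W x"
proof -
  have sW: "smooth W" "smooth (pd None W)" "smooth (pd None (pd None W))" "smooth (pd None (pd None (pd None W)))"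
     "smooth (pd None (pd None (pd None (pd None W))))"
    using smooth_pd by (simp_all add: smooth_iff)
  \<comment> \<open>The right-hand side of the relation for \<open>W\<close> is \<open>T\<close> applied to its derivative; differentiation raises \<open>a\<close> by 2.\<close>
  define T where "T a E = (\<lambda>y. a * E y + 2 * y $ None * pd None E y)"
    for a and E :: "real^('n option) \<Rightarrow> real"
  have T: "pd None (T a E) y = T (a + 2) (pd None E) y" if "smooth E" "y \<in> C" for a E y
    unfolding T_def using that by (simp add: smooth_iff pd_add pd_mult algebra_simps)
  have 0: "Mop 0 W y = T (2 - real CARD('n)) (pd None W) y" if "y \<in> C" for y
    using div0_W[OF that] by (simp add: Mop_def T_def)
  have 1: "pd None (Mop 0 W) y = T (4 - real CARD('n)) (pd None (pd None W)) y" if "y \<in> C" for y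
    using pd_cong_C[OF that 0] T[OF sW(2) that] by (simp add: algebra_simps)
  have 2: "pd None (pd None (Mop 0 W)) y = T (6 - real CARD('n)) (pd None (pd None (pd None W))) y" if "y \<in> C" for y
    using pd_cong_C[OF that 1] T[OF sW(3) that] by (simp add: algebra_simps)
  have 3: "pd None (pd None (pd None (Mop 0 W))) y = T (8 - real CARD('n)) (pd None (pd None (pd None (pd None W)))) y" if "y \<in> C" for y
    using pd_cong_C[OF that 2] T[OF sW(4) that] by (simp add: algebra_simps)
  have j0: "mop m (jet 0 W) = mop m (\<lambda>x. 1)" for m
    by (rule mop_cong) (simp add: jet_def W_cyl0)
  have "(8 - real CARD('n)) * jet 4 W x = pd None (pd None (pd None (Mop 0 W))) (cyl_point 0 x)"
    using x by (simp add: 3 T_def jet_def numeral_eq_Suc)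
  also have "\<dots> = mop 3 (\<lambda>x. 1) x + 3 * mop 2 (jet 1 W) x + 3 * mop 1 (jet 2 W) x + mop 0 (jet 3 W) x"
    using x by (simp add: pd3_Mop[OF sW(1)] Mop_slice[OF sW(1)] Mop_slice[OF sW(2)] Mop_slice[OF sW(3)]
       Mop_slice[OF sW(4)] jet_pd j0 numeral_2_eq_2 numeral_3_eq_3)
  finally show ?thesis by simp
qed

end

section \<open>Derivatives of the inverse metric\<close>

lemma matrix_scaleR_left: "(c *\<^sub>R A) ** B = c *\<^sub>R (A ** (B :: real^'k^'k::finite))"
  and matrix_scaleR_right: "A ** (c *\<^sub>R B) = c *\<^sub>R (A ** (B :: real^'k^'k::finite))"
  and matrix_add_left: "(A + D) ** B = A ** B + D ** (B :: real^'k^'k::finite)"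
  and matrix_add_right: "A ** (B + D) = A ** B + A ** (D :: real^'k^'k::finite)"
  and matrix_minus_left: "(- A) ** B = - (A ** (B :: real^'k^'k::finite))"
  and matrix_diff_left: "(A - D) ** B = A ** B - D ** (B :: real^'k^'k::finite)"
  and matrix_diff_right: "A ** (B - D) = A ** B - A ** (D :: real^'k^'k::finite)"
  and matrix_minus_right: "A ** (- B) = - (A ** (B :: real^'k^'k::finite))"
  by (simp_all add: matrix_matrix_mult_def vec_eq_iff sum.distrib sum_subtractf sum_distrib_left sum_negf algebra_simps)

lemma matrix_mult_nth: "(A ** B) $ i $ j = (\<Sum>l\<in>UNIV. A $ i $ l * B $ l $ j)"
  by (simp add: matrix_matrix_mult_def)

lemmas matrix_ring_simps = matrix_scaleR_left matrix_scaleR_right matrix_add_left matrix_add_right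
  matrix_minus_left matrix_minus_right matrix_diff_left matrix_diff_right matrix_mul_assoc

context metric_family
begin

definition msmooth :: "(real^('n option) \<Rightarrow> real^'n^'n) \<Rightarrow> bool" where
  "msmooth A \<longleftrightarrow> (\<forall>i j. smooth (\<lambda>z. A z $ i $ j))"

definition dm :: "(real^('n option) \<Rightarrow> real^'n^'n) \<Rightarrow> real^('n option) \<Rightarrow> real^'n^'n" where
  "dm A y = (\<chi> i j. pd None (\<lambda>z. A z $ i $ j) y)"

text \<open>The $\rho$-derivatives of the metric and of its inverse, kept as matrices in order to compute with matrix
  products.\<close>

definition Hd :: "nat \<Rightarrow> real^('n option) \<Rightarrow> real^'n^'n" where
  "Hd m y = (\<chi> i j. (pd None ^^ m) (\<lambda>z. H z $ i $ j) y)"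

definition Xd :: "nat \<Rightarrow> real^('n option) \<Rightarrow> real^'n^'n" where
  "Xd m y = (\<chi> i j. (pd None ^^ m) (Hi i j) y)"

lemma dm_nth [simp]: "dm A y $ i $ j = pd None (\<lambda>z. A z $ i $ j) y"
  by (simp add: dm_def)

lemma Hd_nth: "Hd m y $ i $ j = (pd None ^^ m) (\<lambda>z. H z $ i $ j) y"
  by (simp add: Hd_def)

lemma Xd_nth: "Xd m y $ i $ j = (pd None ^^ m) (Hi i j) y"
  by (simp add: Xd_def)

lemma Hd_0 [simp]: "Hd 0 = H" and Xd_0: "Xd 0 y = matrix_inv (H y)"
  by (simp_all add: Hd_def Xd_def Hi_def fun_eq_iff vec_eq_iff)

lemma dm_Hd: "dm (Hd m) = Hd (Suc m)" and dm_Xd: "dm (Xd m) = Xd (Suc m)"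
  by (simp_all add: fun_eq_iff vec_eq_iff Hd_def Xd_def)

lemma msmooth_Hd [simp]: "msmooth (Hd m)"
  unfolding msmooth_def Hd_nth by (simp add: smooth_iff smooth_at_H)

lemma msmooth_Xd [simp]: "msmooth (Xd m)"
  unfolding msmooth_def Xd_nth by (simp add: smooth_iff)

lemma msmoothD: "msmooth A \<Longrightarrow> y \<in> C \<Longrightarrow> smooth_at (\<lambda>z. A z $ i $ j) y"
  by (simp add: msmooth_def smooth_iff)

lemma msmooth_mult [simp]: "msmooth A \<Longrightarrow> msmooth B \<Longrightarrow> msmooth (\<lambda>z. A z ** B z)"
  and msmooth_add [simp]: "msmooth A \<Longrightarrow> msmooth B \<Longrightarrow> msmooth (\<lambda>z. A z + B z)"
  and msmooth_diff [simp]: "msmooth A \<Longrightarrow> msmooth B \<Longrightarrow> msmooth (\<lambda>z. A z - B z)"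
  and msmooth_scaleR [simp]: "msmooth A \<Longrightarrow> msmooth (\<lambda>z. c *\<^sub>R A z)"
  by (simp_all add: msmooth_def smooth_iff matrix_matrix_mult_def)

lemma dm_mult:
  "msmooth A \<Longrightarrow> msmooth B \<Longrightarrow> y \<in> C \<Longrightarrow> dm (\<lambda>z. A z ** B z) y = dm A y ** B y + A y ** dm B y"
  by (simp add: vec_eq_iff matrix_matrix_mult_def msmoothD pd_sum pd_mult sum.distrib)

lemma dm_add: "msmooth A \<Longrightarrow> msmooth B \<Longrightarrow> y \<in> C \<Longrightarrow> dm (\<lambda>z. A z + B z) y = dm A y + dm B y"
  and dm_diff: "msmooth A \<Longrightarrow> msmooth B \<Longrightarrow> y \<in> C \<Longrightarrow> dm (\<lambda>z. A z - B z) y = dm A y - dm B y"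
  and dm_scaleR: "msmooth A \<Longrightarrow> y \<in> C \<Longrightarrow> dm (\<lambda>z. c *\<^sub>R A z) y = c *\<^sub>R dm A y"
  by (simp_all add: vec_eq_iff msmoothD pd_add pd_diff pd_cmult)

lemma dm_cong:
  assumes "y \<in> C" "\<And>z. z \<in> C \<Longrightarrow> A z = B z" shows "dm A y = dm B y"
  using assms by (auto simp: vec_eq_iff intro!: pd_cong_C)

lemma X_H: "y \<in> C \<Longrightarrow> Xd 0 y ** H y = mat 1" and H_X: "y \<in> C \<Longrightarrow> H y ** Xd 0 y = mat 1"
  by (simp_all add: Xd_0 matrix_inv_mult det_H)

text \<open>The derivatives of the inverse metric are determined recursively by those of $g^{-1}g = 1$.\<close>

lemma Leibniz_inverse:
  assumes y: "y \<in> C"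
  shows "Xd 1 y ** H y + Xd 0 y ** Hd 1 y = 0"
    "Xd 2 y ** H y + 2 *\<^sub>R (Xd 1 y ** Hd 1 y) + Xd 0 y ** Hd 2 y = 0"
    "Xd 3 y ** H y + 3 *\<^sub>R (Xd 2 y ** Hd 1 y) + 3 *\<^sub>R (Xd 1 y ** Hd 2 y) + Xd 0 y ** Hd 3 y = 0"
proof -
  have c: "dm (\<lambda>z. M) y = 0" for M and y :: "real^('n option)" by (simp add: vec_eq_iff)
  have 1: "Xd (Suc 0) z ** Hd 0 z + Xd 0 z ** Hd (Suc 0) z = 0" if "z \<in> C" for z
  proof -
    have "dm (\<lambda>z. Xd 0 z ** Hd 0 z) z = dm (\<lambda>z. mat 1) z" by (rule dm_cong[OF that]) (simp add: X_H)
    then show ?thesis unfolding c using that by (simp add: dm_mult dm_Hd dm_Xd del: Hd_0)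
  qed
  have 2: "Xd (Suc (Suc 0)) z ** Hd 0 z + 2 *\<^sub>R (Xd (Suc 0) z ** Hd (Suc 0) z) + Xd 0 z ** Hd (Suc (Suc 0)) z = 0" if "z \<in> C" for z
  proof -
    have "dm (\<lambda>z. Xd (Suc 0) z ** Hd 0 z + Xd 0 z ** Hd (Suc 0) z) z = dm (\<lambda>z. 0) z" by (rule dm_cong[OF that 1])
    then show ?thesis unfolding c using that
      by (simp only: dm_add dm_mult dm_Hd dm_Xd msmooth_mult msmooth_Xd msmooth_Hd)
         (simp add: vec_eq_iff algebra_simps del: Hd_0)
  qed
  have 3: "Xd (Suc (Suc (Suc 0))) z ** Hd 0 z + 3 *\<^sub>R (Xd (Suc (Suc 0)) z ** Hd (Suc 0) z)
      + 3 *\<^sub>R (Xd (Suc 0) z ** Hd (Suc (Suc 0)) z) + Xd 0 z ** Hd (Suc (Suc (Suc 0))) z = 0" if "z \<in> C" for z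
  proof -
    have "dm (\<lambda>z. Xd (Suc (Suc 0)) z ** Hd 0 z + 2 *\<^sub>R (Xd (Suc 0) z ** Hd (Suc 0) z) + Xd 0 z ** Hd (Suc (Suc 0)) z) z = dm (\<lambda>z. 0) z"
      by (rule dm_cong[OF that 2])
    then show ?thesis unfolding c using that
      by (simp only: dm_add dm_mult dm_scaleR dm_Hd dm_Xd msmooth_add msmooth_mult msmooth_scaleR msmooth_Xd msmooth_Hd)
         (simp add: vec_eq_iff algebra_simps del: Hd_0)
  qed
  show "Xd 1 y ** H y + Xd 0 y ** Hd 1 y = 0"
    "Xd 2 y ** H y + 2 *\<^sub>R (Xd 1 y ** Hd 1 y) + Xd 0 y ** Hd 2 y = 0"
    "Xd 3 y ** H y + 3 *\<^sub>R (Xd 2 y ** Hd 1 y) + 3 *\<^sub>R (Xd 1 y ** Hd 2 y) + Xd 0 y ** Hd 3 y = 0"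
    using 1[OF y] 2[OF y] 3[OF y] by (simp_all add: numeral_2_eq_2 numeral_3_eq_3)
qed

lemma Xd_eq:
  assumes y: "y \<in> C"
  shows "Xd 1 y = - (Xd 0 y ** Hd 1 y ** Xd 0 y)"
    "Xd 2 y = - ((2 *\<^sub>R (Xd 1 y ** Hd 1 y) + Xd 0 y ** Hd 2 y) ** Xd 0 y)"
    "Xd 3 y = - ((3 *\<^sub>R (Xd 2 y ** Hd 1 y) + 3 *\<^sub>R (Xd 1 y ** Hd 2 y) + Xd 0 y ** Hd 3 y) ** Xd 0 y)"
proof -
  have *: "A = - (B ** Xd 0 y)" if "A ** H y + B = 0" for A B :: "real^'n^'n"
  proof -
    have "A = (A ** H y) ** Xd 0 y" by (simp add: H_X[OF y] flip: matrix_mul_assoc)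
    also have "A ** H y = - B" using that by (simp add: eq_neg_iff_add_eq_0)
    finally show ?thesis by (simp add: matrix_minus_left)
  qed
  show "Xd 1 y = - (Xd 0 y ** Hd 1 y ** Xd 0 y)"
    "Xd 2 y = - ((2 *\<^sub>R (Xd 1 y ** Hd 1 y) + Xd 0 y ** Hd 2 y) ** Xd 0 y)"
    "Xd 3 y = - ((3 *\<^sub>R (Xd 2 y ** Hd 1 y) + 3 *\<^sub>R (Xd 1 y ** Hd 2 y) + Xd 0 y ** Hd 3 y) ** Xd 0 y)"
    using Leibniz_inverse[OF y] by (auto intro!: * simp: add.assoc)
qed

text \<open>These two expressions in the derivatives of the family are the extended obstruction tensors
  $\Omega^{(1)}$ and $\Omega^{(2)}$ at $\rho = 0$ (shown in \<open>ext_obstruction_eq\<close>).\<close>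

definition Om1 :: "real^('n option) \<Rightarrow> real^'n^'n" where
  "Om1 y = (1/2) *\<^sub>R Hd 2 y - (1/4) *\<^sub>R (Hd 1 y ** Xd 0 y ** Hd 1 y)"

definition Om2 :: "real^('n option) \<Rightarrow> real^'n^'n" where
  "Om2 y = dm Om1 y - (1/2) *\<^sub>R (Hd 1 y ** Xd 0 y ** Om1 y + Om1 y ** Xd 0 y ** Hd 1 y)"

lemma msmooth_Om1: "msmooth Om1"
  unfolding Om1_def[abs_def] by simp

text \<open>The tensor in the divergence term.  Solving the definitions of \<open>Om1\<close> and \<open>Om2\<close> for the derivatives of
  the metric gives $g''=2\Omega^{(1)}+2P^2$ and $g^{(3)}=2\Omega^{(2)}+4(P\Omega^{(1)}+\Omega^{(1)}P)$ with $P = g'/2$,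
  which are inserted into the formula for the third derivative of the inverse.\<close>

lemma Xd_3_eq:
  assumes y: "y \<in> C" and P: "Hd 1 y = 2 *\<^sub>R P"
  shows "Xd 3 y = (- 2) *\<^sub>R (Xd 0 y ** (Om2 y ** Xd 0 y
     - 4 *\<^sub>R (P ** Xd 0 y ** (Om1 y ** Xd 0 y) + Om1 y ** Xd 0 y ** (P ** Xd 0 y))
     + 12 *\<^sub>R (P ** Xd 0 y ** (P ** Xd 0 y) ** (P ** Xd 0 y))))"
proof -
  have d: "dm Om1 y = (1/2) *\<^sub>R Hd 3 y - (1/4) *\<^sub>R
      (Hd 2 y ** Xd 0 y ** Hd 1 y + Hd 1 y ** Xd 1 y ** Hd 1 y + Hd 1 y ** Xd 0 y ** Hd 2 y)"
    unfolding Om1_def[abs_def] using y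
    by (simp add: dm_diff dm_scaleR dm_mult dm_Hd dm_Xd numeral_2_eq_2 numeral_3_eq_3 matrix_ring_simps)
  have K2: "Hd 2 y = 2 *\<^sub>R Om1 y + 2 *\<^sub>R (P ** Xd 0 y ** P)"
    unfolding Om1_def P by (simp add: matrix_ring_simps) (simp add: vec_eq_iff)
  have K3: "Hd 3 y = 2 *\<^sub>R Om2 y + 4 *\<^sub>R (P ** Xd 0 y ** Om1 y + Om1 y ** Xd 0 y ** P)"
    using d unfolding Om2_def K2 P Xd_eq(1)[OF y]
    by (simp add: matrix_ring_simps) (simp add: vec_eq_iff algebra_simps)
  show ?thesis
    unfolding Xd_eq(3)[OF y] Xd_eq(2)[OF y] Xd_eq(1)[OF y] K2 K3 P
    by (simp add: matrix_ring_simps) (simp add: vec_eq_iff algebra_simps)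
qed

section \<open>Curvature of the ambient metric\<close>

lemma sym_Hd: "y \<in> C \<Longrightarrow> Hd m y $ i $ j = Hd m y $ j $ i"
proof (induction m arbitrary: y)
  case 0
  then show ?case by (simp add: sym_H)
next
  case (Suc m)
  have "pd None (\<lambda>z. Hd m z $ i $ j) y = pd None (\<lambda>z. Hd m z $ j $ i) y"
    by (rule pd_cong_C[OF Suc.prems Suc.IH])
  then show ?case by (simp flip: dm_Hd)
qed

lemma Xd_0_nth: "Xd 0 y $ i $ j = Hi i j y"
  by (simp add: Xd_def)

lemma Hd_1_nth: "pd None (\<lambda>z. H z $ i $ j) y = Hd 1 y $ i $ j"
  by (simp add: Hd_def)

lemma pd_amb_metric_rest:
  "pd a (\<lambda>y. amb_metric k y $ AT $ AT) y = (if a = AInf then 2 else 0)"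
  "pd a (\<lambda>y. amb_metric k y $ AT $ AInf) y = (if a = AT then 1 else 0)"
  "pd a (\<lambda>y. amb_metric k y $ AInf $ AT) y = (if a = AT then 1 else 0)"
  "pd a (\<lambda>y. amb_metric k y $ AInf $ AInf) y = 0"
  "pd a (\<lambda>y. amb_metric k y $ AX i $ AT) y = 0" "pd a (\<lambda>y. amb_metric k y $ AX i $ AInf) y = 0"
  "pd a (\<lambda>y. amb_metric k y $ AT $ AX i) y = 0" "pd a (\<lambda>y. amb_metric k y $ AInf $ AX i) y = 0"
  by (simp_all add: pd_cmult)

text \<open>The Christoffel symbols that enter the curvature component with indices $\infty, i, j, \infty$ and its covariant
  derivative.  As $\tilde g_{\infty a}$ vanishes except for $a=t$, lowering the last index turns this component into
  \<open>t\<close> times the one with upper index \<open>t\<close>.\<close>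

lemma amb_christoffel:
  assumes y: "y \<in> amb_dom"
  shows "christoffel (amb_metric k) AT (AX i) (AX j) y = - (1/2) * y $ AT * Hd 1 (coords amb_index y) $ i $ j"
    "christoffel (amb_metric k) AT AInf a y = 0" "christoffel (amb_metric k) AT a AInf y = 0"
    "christoffel (amb_metric k) a AInf AInf y = 0"
    "christoffel (amb_metric k) AInf AInf (AX j) y = 0"
    "christoffel (amb_metric k) (AX p) AInf (AX j) y = (1/2) * (Xd 0 (coords amb_index y) ** Hd 1 (coords amb_index y)) $ p $ j"
proof -
  note c = christoffel_def amb_metric_inv[OF y] sum_amb pd_amb_metric_rest pd_amb_metric_AX[OF y] Hd_1_nth
  have t: "y $ AT > 0" by (rule amb_domD[OF y])
  note simps = Xd_0_nth sum_distrib_left matrix_matrix_mult_def sym_Hd[OF amb_domD(2)[OF y]] power2_eq_square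
  show "christoffel (amb_metric k) AT (AX i) (AX j) y = - (1/2) * y $ AT * Hd 1 (coords amb_index y) $ i $ j"
    unfolding c using t by (simp add: power2_eq_square)
  show "christoffel (amb_metric k) AT AInf a y = 0" "christoffel (amb_metric k) AT a AInf y = 0"
    unfolding c by (cases a; simp add: pd_amb_metric_rest del: amb_metric_nth)+
  show "christoffel (amb_metric k) a AInf AInf y = 0"
    unfolding c by (cases a; simp add: pd_amb_metric_rest del: amb_metric_nth)
  show "christoffel (amb_metric k) AInf AInf (AX j) y = 0"
    unfolding c by simp
  show "christoffel (amb_metric k) (AX p) AInf (AX j) y = (1/2) * (Xd 0 (coords amb_index y) ** Hd 1 (coords amb_index y)) $ p $ j"
    unfolding c using t by (simp add: Xd_0_nth matrix_matrix_mult_def sym_Hd[OF amb_domD(2)[OF y], of _ j])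
qed

lemma amb_riemann:
  assumes y: "y \<in> amb_dom"
  shows "riemann (amb_metric k) [AInf, AX i, AX j, AInf] y = - (y $ AT)\<^sup>2 * Om1 (coords amb_index y) $ i $ j"
proof -
  let ?c = "coords amb_index y"
  have C: "?c \<in> C" by (rule amb_domD(2)[OF y])
  have s: "smooth_at (\<lambda>z. Hd 1 z $ i $ j) ?c" by (rule msmoothD[OF msmooth_Hd C])
  have 1: "pd AInf (christoffel (amb_metric k) AT (AX i) (AX j)) y = - (1/2) * y $ AT * Hd 2 ?c $ i $ j"
  proof -
    have "pd AInf (christoffel (amb_metric k) AT (AX i) (AX j)) y
      = pd AInf (\<lambda>y. (- (1/2) * y $ AT) * Hd 1 (coords amb_index y) $ i $ j) y"
      by (rule pd_cong_open[OF open_amb_dom y amb_christoffel(1)])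
    also have "\<dots> = (- (1/2) * y $ AT) * pd None (\<lambda>z. Hd 1 z $ i $ j) ?c"
      using smooth_at_coords[OF s] pd_amb_index(1)[OF s] by (simp add: pd_mult pd_minus pd_divide_const)
    also have "pd None (\<lambda>z. Hd 1 z $ i $ j) ?c = Hd 2 ?c $ i $ j" by (simp add: Hd_def numeral_2_eq_2)
    finally show ?thesis .
  qed
  have 2: "pd (AX i) (christoffel (amb_metric k) AT AInf (AX j)) y = 0"
  proof -
    have "pd (AX i) (christoffel (amb_metric k) AT AInf (AX j)) y = pd (AX i) (\<lambda>y. 0) y"
      by (rule pd_cong_open[OF open_amb_dom y amb_christoffel(2)])
    then show ?thesis by simp
  qed
  have cu: "curv_up (amb_metric k) AInf (AX i) (AX j) AT y
      = - (1/2) * y $ AT * Hd 2 ?c $ i $ j + (1/4) * y $ AT * (Hd 1 ?c ** (Xd 0 ?c ** Hd 1 ?c)) $ i $ j"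
    unfolding curv_up_def 1 2 sum_amb amb_christoffel[OF y]
    by (simp add: matrix_mult_nth[of "Hd 1 ?c" "Xd 0 ?c ** Hd 1 ?c"] sum_distrib_left sum_negf algebra_simps del: One_nat_def)
  show ?thesis
    by (simp add: riemann_def sum_amb Om1_def cu power2_eq_square matrix_mul_assoc algebra_simps numeral_3_eq_3)
qed

text \<open>As $\tilde\nabla_\infty\partial_\infty=0$, only the two tangential slots contribute correction terms, and these involve
  $g^{-1}g'/2$.\<close>

lemma amb_cov_riemann:
  assumes y: "y \<in> amb_dom"
  shows "cov_deriv (amb_metric k) (riemann (amb_metric k)) [AInf, AInf, AX i, AX j, AInf] y
    = - (y $ AT)\<^sup>2 * Om2 (coords amb_index y) $ i $ j"
proof -
  let ?c = "coords amb_index y"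
  have C: "?c \<in> C" by (rule amb_domD(2)[OF y])
  have s: "smooth_at (\<lambda>z. Om1 z $ i $ j) ?c" by (rule msmoothD[OF msmooth_Om1 C])
  have 1: "pd AInf (riemann (amb_metric k) [AInf, AX i, AX j, AInf]) y = - (y $ AT)\<^sup>2 * dm Om1 ?c $ i $ j"
  proof -
    have "pd AInf (riemann (amb_metric k) [AInf, AX i, AX j, AInf]) y
      = pd AInf (\<lambda>y. - (y $ AT)\<^sup>2 * Om1 (coords amb_index y) $ i $ j) y"
      by (rule pd_cong_open[OF open_amb_dom y amb_riemann])
    then show ?thesis
      using smooth_at_coords[OF s] pd_amb_index(1)[OF s] by (simp add: pd_mult pd_minus pd_power)
  qed
  have t1: "(Hd 1 ?c ** Xd 0 ?c ** Om1 ?c) $ i $ j = (\<Sum>p\<in>UNIV. (Xd 0 ?c ** Hd 1 ?c) $ p $ i * Om1 ?c $ p $ j)"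
  proof -
    have "(Xd 0 ?c ** Hd 1 ?c) $ p $ i = (Hd 1 ?c ** Xd 0 ?c) $ i $ p" for p
      by (simp add: matrix_matrix_mult_def Xd_0_nth sym_Hi[OF C, of p] sym_Hd[OF C, of _ _ i] mult.commute)
    then show ?thesis by (simp add: matrix_mult_nth[of "Hd 1 ?c ** Xd 0 ?c"] del: One_nat_def)
  qed
  have t2: "(Om1 ?c ** Xd 0 ?c ** Hd 1 ?c) $ i $ j = (\<Sum>p\<in>UNIV. (Xd 0 ?c ** Hd 1 ?c) $ p $ j * Om1 ?c $ i $ p)"
    unfolding matrix_mul_assoc[symmetric] matrix_mult_nth[of "Om1 ?c"] by (simp add: mult.commute)
  show ?thesis
    unfolding cov_deriv_def list.case 1
    by (simp add: numeral_eq_Suc sum_amb amb_christoffel[OF y] amb_riemann[OF y] Om2_def t1 t2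
       sum.distrib sum_distrib_left sum_negf algebra_simps del: One_nat_def)
qed

lemma amb_point_dom: "x \<in> V \<Longrightarrow> amb_point 1 x 0 \<in> amb_dom"
  and coords_amb_point: "coords amb_index (amb_point t x \<rho>) = cyl_point \<rho> x"
proof -
  show "coords amb_index (amb_point t x \<rho>) = cyl_point \<rho> x" for t and x :: "real^'n" and \<rho>
    by (simp add: vec_eq_iff coords_def amb_point_def cyl_point_def split: option.split)
  then show "x \<in> V \<Longrightarrow> amb_point 1 x 0 \<in> amb_dom"
    by (simp add: amb_dom_def amb_point_def)
qed

lemma ext_obstruction_eq:
  assumes x: "x \<in> V"
  shows "ext_obstruction k 1 x = Om1 (cyl_point 0 x)" "ext_obstruction k 2 x = Om2 (cyl_point 0 x)"
proof -
  have t: "amb_point 1 x 0 $ AT = 1" by (simp add: amb_point_def)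
  show "ext_obstruction k 1 x = Om1 (cyl_point 0 x)" "ext_obstruction k 2 x = Om2 (cyl_point 0 x)"
    unfolding ext_obstruction_def
    using amb_riemann[OF amb_point_dom[OF x]] amb_cov_riemann[OF amb_point_dom[OF x]]
    by (simp_all add: vec_eq_iff t coords_amb_point)
qed

end

section \<open>The Einstein condition to leading order\<close>

context metric_family
begin

text \<open>The part of the cylinder where the Poincare-Einstein metric is defined; here the parameter of the
  family is \<open>r\<close>.\<close>

definition pe_dom :: "(real^('n option)) set" where
  "pe_dom = {y \<in> C. y $ None > 0}"

lemma open_pe_dom: "open pe_dom"
proof -
  have "open {y::real^('n option). 0 < y $ None}"
    by (intro open_Collect_less) (auto intro: continuous_intros)
  moreover have "pe_dom = C \<inter> {y. 0 < y $ None}" by (auto simp: pe_dom_def)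
  ultimately show ?thesis using open_C by auto
qed

lemma pe_domD: "y \<in> pe_dom \<Longrightarrow> y \<in> C" "y \<in> pe_dom \<Longrightarrow> y $ None > 0"
  by (auto simp: pe_dom_def)

lemma pe_metric_nth [simp]:
  "pe_metric k y $ None $ None = 1 / (y $ None)\<^sup>2"
  "pe_metric k y $ None $ Some j = 0" "pe_metric k y $ Some i $ None = 0"
  "pe_metric k y $ Some i $ Some j = H y $ i $ j / (y $ None)\<^sup>2"
  by (simp_all add: pe_metric_def H_def)

lemma pe_metric_inv:
  assumes y: "y \<in> pe_dom"
  shows "metric_inv (pe_metric k) y $ None $ None = (y $ None)\<^sup>2"
  "metric_inv (pe_metric k) y $ None $ Some j = 0" "metric_inv (pe_metric k) y $ Some i $ None = 0"
  "metric_inv (pe_metric k) y $ Some i $ Some j = (y $ None)\<^sup>2 * Hi i j y"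
proof -
  define B where "B = (\<chi> a b. case (a, b) of (None, None) \<Rightarrow> (y $ None)\<^sup>2
     | (Some i, Some j) \<Rightarrow> (y $ None)\<^sup>2 * Hi i j y | _ \<Rightarrow> 0)"
  have B: "B $ None $ None = (y $ None)\<^sup>2" "B $ None $ Some j = 0" "B $ Some i $ None = 0"
    "B $ Some i $ Some j = (y $ None)\<^sup>2 * Hi i j y" for i j by (simp_all add: B_def)
  have r: "y $ None \<noteq> 0" using pe_domD[OF y] by simp
  have "(pe_metric k y ** B) $ a $ b = mat 1 $ a $ b" for a b
    using r H_Hi[OF pe_domD(1)[OF y]]
    by (cases a; cases b) (simp_all add: matrix_mult_nth sum_option B mat_def)
  then have "pe_metric k y ** B = mat 1" by (simp add: vec_eq_iff)
  then have "metric_inv (pe_metric k) y = B" by (simp add: metric_inv_def matrix_inv_eqI(1))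
  then show "metric_inv (pe_metric k) y $ None $ None = (y $ None)\<^sup>2"
  "metric_inv (pe_metric k) y $ None $ Some j = 0" "metric_inv (pe_metric k) y $ Some i $ None = 0"
  "metric_inv (pe_metric k) y $ Some i $ Some j = (y $ None)\<^sup>2 * Hi i j y"
    by (simp_all add: B)
qed

text \<open>Christoffel symbols and Ricci curvature of the metrics of the family, as functions on the cylinder
  that are smooth across $r = 0$.\<close>

definition chr :: "'n \<Rightarrow> 'n \<Rightarrow> 'n \<Rightarrow> real^('n option) \<Rightarrow> real" where
  "chr m i j y = (1/2) * (\<Sum>l\<in>UNIV. Hi m l y *
     (pd (Some i) (\<lambda>y. H y $ j $ l) y + pd (Some j) (\<lambda>y. H y $ i $ l) y - pd (Some l) (\<lambda>y. H y $ i $ j) y))"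

definition ric :: "'n \<Rightarrow> 'n \<Rightarrow> real^('n option) \<Rightarrow> real" where
  "ric j l y = (\<Sum>i\<in>UNIV. pd (Some i) (chr i j l) y - pd (Some j) (chr i i l) y
     + (\<Sum>p\<in>UNIV. chr i i p y * chr p j l y - chr i j p y * chr p i l y))"

lemma smooth_at_chr [simp]: "y \<in> C \<Longrightarrow> smooth_at (chr m i j) y"
  unfolding chr_def[abs_def] by (simp add: smooth_at_H)

lemma smooth_at_ric [simp]: "y \<in> C \<Longrightarrow> smooth_at (ric j l) y"
  unfolding ric_def[abs_def] by simp

lemma smooth_at_H_pd [simp]: "y \<in> C \<Longrightarrow> smooth_at (\<lambda>z. H z $ i $ j) y"
  by (rule smooth_at_H)

lemma chr_slice:
  assumes x: "x \<in> V" and r: "\<bar>r\<bar> < \<eta>"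
  shows "christoffel (k r) m i j x = chr m i j (cyl_point r x)"
proof -
  have s: "smooth_at (\<lambda>z. H z $ i $ j) (cyl_point r x)" for i j
    using x r by (simp add: open_interval_C)
  have k: "k r = (\<lambda>x. H (cyl_point r x))" by (simp add: H_def fun_eq_iff)
  show ?thesis
    unfolding christoffel_def chr_def k metric_inv_def Hi_def using pd_slice[OF s] by simp
qed

lemma ric_slice:
  assumes x: "x \<in> V" and r: "\<bar>r\<bar> < \<eta>"
  shows "ricci (k r) x $ j $ l = ric j l (cyl_point r x)"
proof -
  have c: "pd a (christoffel (k r) m i j) x = pd (Some a) (chr m i j) (cyl_point r x)" for a m i j
  proof -
    have "pd a (christoffel (k r) m i j) x = pd a (\<lambda>x. chr m i j (cyl_point r x)) x"
      by (rule pd_cong_open[OF open_V x chr_slice[OF _ r]])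
    also have "\<dots> = pd (Some a) (chr m i j) (cyl_point r x)"
      using x r by (intro pd_slice) (simp add: open_interval_C)
    finally show ?thesis .
  qed
  show ?thesis
    unfolding ricci_def curv_up_def ric_def c chr_slice[OF x r] by simp
qed

lemma pd_inverse_square:
  assumes y: "y \<in> pe_dom" and f: "smooth_at f y"
  shows "pd None (\<lambda>y. f y / (y $ None)\<^sup>2) y = pd None f y / (y $ None)\<^sup>2 - 2 * f y / (y $ None) ^ 3"
    "pd (Some i) (\<lambda>y. f y / (y $ None)\<^sup>2) y = pd (Some i) f y / (y $ None)\<^sup>2"
proof -
  have r: "y $ None \<noteq> 0" using pe_domD[OF y] by simp
  have e: "pd a (\<lambda>y. f y / (y $ None)\<^sup>2) y = pd a f y / (y $ None)\<^sup>2 +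
      f y * (- (inverse ((y $ None)\<^sup>2))\<^sup>2 * (2 * y $ None * (if None = a then 1 else 0)))" for a
    using r f unfolding divide_inverse
    by (subst pd_mult) (simp_all add: pd_inverse pd_power)
  show "pd None (\<lambda>y. f y / (y $ None)\<^sup>2) y = pd None f y / (y $ None)\<^sup>2 - 2 * f y / (y $ None) ^ 3"
    "pd (Some i) (\<lambda>y. f y / (y $ None)\<^sup>2) y = pd (Some i) f y / (y $ None)\<^sup>2"
    unfolding e using r by (simp_all add: field_simps power2_eq_square power3_eq_cube)
qed

lemma pe_christoffel:
  assumes y: "y \<in> pe_dom"
  shows "christoffel (pe_metric k) None None None y = - 1 / y $ None"
    "christoffel (pe_metric k) None None (Some i) y = 0"
    "christoffel (pe_metric k) None (Some i) None y = 0"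
    "christoffel (pe_metric k) None (Some i) (Some j) y = H y $ i $ j / y $ None - (1/2) * Hd 1 y $ i $ j"
    "christoffel (pe_metric k) (Some p) None (Some j) y
      = - (if p = j then 1 else 0) / y $ None + (1/2) * (Xd 0 y ** Hd 1 y) $ p $ j"
    "christoffel (pe_metric k) (Some p) (Some j) None y
      = - (if p = j then 1 else 0) / y $ None + (1/2) * (Xd 0 y ** Hd 1 y) $ p $ j"
    "christoffel (pe_metric k) (Some p) (Some i) (Some j) y = chr p i j y"
proof -
  have C: "y \<in> C" and r: "y $ None \<noteq> 0" using pe_domD[OF y] by auto
  have one: "pd None (\<lambda>y. 1 / (y $ None)\<^sup>2) y = - 2 / (y $ None) ^ 3"
    "pd (Some i) (\<lambda>y. 1 / (y $ None)\<^sup>2) y = 0" for i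
    using pd_inverse_square[OF y, of "\<lambda>_. 1"] by simp_all
  note c = christoffel_def sum_option pe_metric_inv[OF y] pe_metric_nth pd_const one
    pd_inverse_square[OF y smooth_at_H[OF C]] Hd_1_nth
  have d: "(\<Sum>l\<in>UNIV. Hi p l y * H y $ l $ j) = (if p = j then 1 else 0)" for p j by (rule Hi_H[OF C])
  show "christoffel (pe_metric k) None None None y = - 1 / y $ None"
    unfolding c using r by (simp add: field_simps power2_eq_square power3_eq_cube)
  show "christoffel (pe_metric k) None None (Some i) y = 0" "christoffel (pe_metric k) None (Some i) None y = 0"
    unfolding c by simp_all
  show "christoffel (pe_metric k) None (Some i) (Some j) y = H y $ i $ j / y $ None - (1/2) * Hd 1 y $ i $ j"
    unfolding c using r by (simp add: field_simps power2_eq_square power3_eq_cube)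
  have 5: "(\<Sum>l\<in>UNIV. (y $ None)\<^sup>2 * Hi p l y * (Hd 1 y $ l $ j / (y $ None)\<^sup>2 - 2 * H y $ l $ j / (y $ None) ^ 3))
     = (Xd 0 y ** Hd 1 y) $ p $ j - (2 / y $ None) * (if p = j then 1 else 0)"
  proof -
    have "(\<Sum>l\<in>UNIV. (y $ None)\<^sup>2 * Hi p l y * (Hd 1 y $ l $ j / (y $ None)\<^sup>2 - 2 * H y $ l $ j / (y $ None) ^ 3))
      = (\<Sum>l\<in>UNIV. Hi p l y * Hd 1 y $ l $ j - (2 / y $ None) * (Hi p l y * H y $ l $ j))"
      using r by (intro sum.cong refl) (simp add: field_simps power2_eq_square power3_eq_cube)
    then show ?thesis by (simp only: sum_subtractf sum_distrib_left[symmetric] d matrix_mult_nth Xd_0_nth)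
  qed
  note s = sym_Hd[OF C, of 1 j] sym_H[OF C, of j]
  show "christoffel (pe_metric k) (Some p) None (Some j) y
      = - (if p = j then 1 else 0) / y $ None + (1/2) * (Xd 0 y ** Hd 1 y) $ p $ j"
    unfolding c using 5 by (simp add: s del: One_nat_def)
  show "christoffel (pe_metric k) (Some p) (Some j) None y
      = - (if p = j then 1 else 0) / y $ None + (1/2) * (Xd 0 y ** Hd 1 y) $ p $ j"
    unfolding c using 5 by (simp add: s del: One_nat_def)
  show "christoffel (pe_metric k) (Some p) (Some i) (Some j) y = chr p i j y"
  proof -
    have 7: "(y $ None)\<^sup>2 * a * (A / (y $ None)\<^sup>2 + B / (y $ None)\<^sup>2 - D / (y $ None)\<^sup>2) = a * (A + B - D)"
      for a A B D using r by (simp add: field_simps)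
    show ?thesis unfolding c chr_def by (simp only: 7 mult_zero_left add_0_left)
  qed
qed

text \<open>The tangential Einstein equation.  The terms in $r^{-2}$ cancel; those in $r^{-1}$ are multiplied by the first
  derivative of the family, which vanishes at $r = 0$ for an even family.\<close>

lemma pe_ricci:
  assumes y: "y \<in> pe_dom"
  shows "ricci (pe_metric k) y $ Some j $ Some l + real CARD('n) * pe_metric k y $ Some j $ Some l
    = ric j l y - (1/2) * Hd 2 y $ j $ l + (1/2) * (Hd 1 y ** Xd 0 y ** Hd 1 y) $ j $ l
      - (1/4) * trace (Xd 0 y ** Hd 1 y) * Hd 1 y $ j $ l
      + (real CARD('n) - 1) / 2 * (Hd 1 y $ j $ l / y $ None)
      + (1/2) * (trace (Xd 0 y ** Hd 1 y) / y $ None) * H y $ j $ l"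
proof -
  have C: "y \<in> C" and r: "y $ None \<noteq> 0" using pe_domD[OF y] by auto
  define h where "h = H y"
  define h1 where "h1 = Hd 1 y"
  define E where "E = Xd 0 y ** Hd 1 y"
  let ?r = "y $ None"
  note ch = pe_christoffel
  have d0: "pd None (christoffel (pe_metric k) None (Some j) (Some l)) y
     = h1 $ j $ l / ?r - h $ j $ l / ?r\<^sup>2 - (1/2) * Hd 2 y $ j $ l"
  proof -
    have s: "smooth_at (\<lambda>y. H y $ j $ l / y $ None) y" using C r by simp
    have s1: "smooth_at (\<lambda>y. Hd 1 y $ j $ l) y" by (rule msmoothD[OF msmooth_Hd C])
    have "pd None (\<lambda>y. H y $ j $ l / y $ None) y = h1 $ j $ l / ?r - h $ j $ l / ?r\<^sup>2"
      unfolding divide_inverse using C r by (simp add: pd_mult pd_inverse Hd_1_nth h_def h1_def power2_eq_square)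
    moreover have "pd None (\<lambda>y. Hd 1 y $ j $ l) y = Hd 2 y $ j $ l" by (simp add: Hd_def numeral_2_eq_2)
    moreover have "pd None (christoffel (pe_metric k) None (Some j) (Some l)) y
       = pd None (\<lambda>y. H y $ j $ l / y $ None - (1/2) * Hd 1 y $ j $ l) y"
      by (rule pd_cong_open[OF open_pe_dom y ch(4)])
    moreover have "pd None (\<lambda>y. H y $ j $ l / y $ None - (1/2) * Hd 1 y $ j $ l) y
       = pd None (\<lambda>y. H y $ j $ l / y $ None) y - (1/2) * pd None (\<lambda>y. Hd 1 y $ j $ l) y"
      unfolding pd_diff[OF s smooth_at_mult[OF smooth_at_const s1]] pd_cmult[OF s1] ..
    ultimately show ?thesis by simp
  qed
  have d1: "pd (Some j) (christoffel (pe_metric k) None None (Some l)) y = 0"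
  proof -
    have "pd (Some j) (christoffel (pe_metric k) None None (Some l)) y = pd (Some j) (\<lambda>y. 0) y"
      by (rule pd_cong_open[OF open_pe_dom y ch(2)])
    then show ?thesis by simp
  qed
  have d2: "pd (Some a) (christoffel (pe_metric k) (Some p) (Some i) (Some m)) y = pd (Some a) (chr p i m) y" for a p i m
    by (rule pd_cong_open[OF open_pe_dom y ch(7)])
  let ?\<delta> = "\<lambda>p j. (if p = j then 1 else 0 :: real)"
  have S1: "(\<Sum>p\<in>UNIV. (h $ j $ p / ?r - (1/2) * h1 $ j $ p) * (- ?\<delta> p l / ?r + (1/2) * E $ p $ l))
      = - h $ j $ l / ?r\<^sup>2 + h1 $ j $ l / ?r - (1/4) * (h1 ** E) $ j $ l"
  proof -
    have "h ** E = h1" using H_X[OF C] by (simp add: h_def h1_def E_def matrix_mul_assoc del: One_nat_def)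
    then have hE: "(\<Sum>p\<in>UNIV. h $ j $ p * E $ p $ l) = h1 $ j $ l" by (metis matrix_mult_nth)
    have "(\<Sum>p\<in>UNIV. (h $ j $ p / ?r - (1/2) * h1 $ j $ p) * (- ?\<delta> p l / ?r + (1/2) * E $ p $ l))
      = (\<Sum>p\<in>UNIV. - (1 / ?r\<^sup>2) * (if p = l then h $ j $ p else 0) + (1 / (2 * ?r)) * (if p = l then h1 $ j $ p else 0)
         + (1 / (2 * ?r)) * (h $ j $ p * E $ p $ l) - (1/4) * (h1 $ j $ p * E $ p $ l))"
      using r by (intro sum.cong refl) (auto simp: field_simps power2_eq_square)
    also have "\<dots> = - (1 / ?r\<^sup>2) * h $ j $ l + (1 / (2 * ?r)) * h1 $ j $ l + (1 / (2 * ?r)) * h1 $ j $ l - (1/4) * (h1 ** E) $ j $ l"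
      by (simp add: sum.distrib sum_subtractf sum_negf sum_distrib_left[symmetric] sum_divide_distrib[symmetric] hE matrix_mult_nth[of h1])
    finally show ?thesis by simp
  qed
  have S2: "(\<Sum>i\<in>UNIV. (- ?\<delta> i j / ?r + (1/2) * E $ i $ j) * (h $ i $ l / ?r - (1/2) * h1 $ i $ l))
      = - h $ j $ l / ?r\<^sup>2 + h1 $ j $ l / ?r - (1/4) * (h1 ** E) $ j $ l"
  proof -
    have Et: "E $ i $ j = (h1 ** Xd 0 y) $ j $ i" for i
      by (simp add: E_def h1_def matrix_mult_nth Xd_0_nth sym_Hi[OF C, of i] sym_Hd[OF C, of _ _ j] mult.commute)
    have "h1 ** Xd 0 y ** h = h1" using X_H[OF C] by (simp add: h_def flip: matrix_mul_assoc)
    then have hE: "(\<Sum>i\<in>UNIV. E $ i $ j * h $ i $ l) = h1 $ j $ l" unfolding Et by (metis matrix_mult_nth)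
    have "h1 ** Xd 0 y ** h1 = h1 ** E" by (simp add: E_def h1_def matrix_mul_assoc)
    then have hE1: "(\<Sum>i\<in>UNIV. E $ i $ j * h1 $ i $ l) = (h1 ** E) $ j $ l" unfolding Et by (metis matrix_mult_nth)
    have "(\<Sum>i\<in>UNIV. (- ?\<delta> i j / ?r + (1/2) * E $ i $ j) * (h $ i $ l / ?r - (1/2) * h1 $ i $ l))
      = (\<Sum>i\<in>UNIV. - (1 / ?r\<^sup>2) * (if i = j then h $ i $ l else 0) + (1 / (2 * ?r)) * (if i = j then h1 $ i $ l else 0)
         + (1 / (2 * ?r)) * (E $ i $ j * h $ i $ l) - (1/4) * (E $ i $ j * h1 $ i $ l))"
      using r by (intro sum.cong refl) (auto simp: field_simps power2_eq_square)
    also have "\<dots> = - (1 / ?r\<^sup>2) * h $ j $ l + (1 / (2 * ?r)) * h1 $ j $ l + (1 / (2 * ?r)) * h1 $ j $ l - (1/4) * (h1 ** E) $ j $ l"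
      by (simp add: sum.distrib sum_subtractf sum_negf sum_distrib_left[symmetric] sum_divide_distrib[symmetric] hE hE1)
    finally show ?thesis by simp
  qed
  have S3: "(\<Sum>i\<in>UNIV. (- ?\<delta> i i / ?r + (1/2) * E $ i $ i) * (h $ j $ l / ?r - (1/2) * h1 $ j $ l))
      = (- real CARD('n) / ?r + (1/2) * trace E) * (h $ j $ l / ?r - (1/2) * h1 $ j $ l)"
    by (simp add: trace_def sum_distrib_right[symmetric] sum_distrib_left[symmetric] sum_subtractf sum.distrib sum_divide_distrib[symmetric])
  have E': "Xd 0 y ** h1 = E" by (simp add: E_def h1_def)
  have alg: "(a / \<rho> - b / \<rho>\<^sup>2 - (1/2) * c) + (- 1 / \<rho>) * (b / \<rho> - (1/2) * a) - (- b / \<rho>\<^sup>2 + a / \<rho> - (1/4) * m)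
      + (R + (- N / \<rho> + (1/2) * \<tau>) * (b / \<rho> - (1/2) * a) - (- b / \<rho>\<^sup>2 + a / \<rho> - (1/4) * m)) + N * (b / \<rho>\<^sup>2)
    = R - (1/2) * c + (1/2) * m - (1/4) * \<tau> * a + (N - 1) / 2 * (a / \<rho>) + (1/2) * (\<tau> / \<rho>) * b"
    if "\<rho> \<noteq> 0" for a b c m N R \<tau> \<rho> :: real
    using that by (simp add: field_simps power2_eq_square)
  have e: "ricci (pe_metric k) y $ Some j $ Some l
    = (h1 $ j $ l / ?r - h $ j $ l / ?r\<^sup>2 - (1/2) * Hd 2 y $ j $ l)
      + (- 1 / ?r) * (h $ j $ l / ?r - (1/2) * h1 $ j $ l)
      - (\<Sum>p\<in>UNIV. (h $ j $ p / ?r - (1/2) * h1 $ j $ p) * (- ?\<delta> p l / ?r + (1/2) * E $ p $ l))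
      + (ric j l y + (\<Sum>i\<in>UNIV. (- ?\<delta> i i / ?r + (1/2) * E $ i $ i) * (h $ j $ l / ?r - (1/2) * h1 $ j $ l))
        - (\<Sum>i\<in>UNIV. (- ?\<delta> i j / ?r + (1/2) * E $ i $ j) * (h $ i $ l / ?r - (1/2) * h1 $ i $ l)))"
    unfolding ricci_def curv_up_def vec_lambda_beta sum_option d0 d1 d2 ch[OF y] ric_def
      h_def[symmetric] h1_def[symmetric] E'
    by (simp only: sum.distrib sum_subtractf mult_zero_left mult_zero_right sum_negf) (simp add: algebra_simps sum_negf)
  have m: "h1 ** E = Hd 1 y ** Xd 0 y ** Hd 1 y" by (simp add: E_def h1_def matrix_mul_assoc)
  show ?thesis
    unfolding e S1 S2 S3 pe_metric_nth h_def[symmetric] alg[OF r] m unfolding E_def h1_def ..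
qed


lemma cyl_point_line: "cyl_point r x = cyl_point 0 x + r *\<^sub>R axis None 1"
  by (simp add: vec_eq_iff cyl_point_def axis_def split: option.split)

lemma DERIV_cyl:
  assumes "smooth_at F (cyl_point r x)"
  shows "((\<lambda>r. F (cyl_point r x)) has_real_derivative pd None F (cyl_point r x)) (at r)"
  using has_real_derivative_line[of F "cyl_point 0 x" r None] assms by (simp flip: cyl_point_line)

lemma tendsto_cyl:
  assumes "smooth_at F (cyl_point 0 x)"
  shows "((\<lambda>r. F (cyl_point r x)) \<longlongrightarrow> F (cyl_point 0 x)) (at_right 0)"
  using DERIV_isCont[OF DERIV_cyl[OF assms]] by (simp add: isCont_def filterlim_at_split)

lemma Hd_1_eq_0:
  assumes x: "x \<in> V" and even: "\<And>r. \<bar>r\<bar> < \<eta> \<Longrightarrow> k (- r) x = k r x"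
  shows "Hd 1 (cyl_point 0 x) = 0"
proof -
  have "pd None (\<lambda>z. H z $ i $ j) (cyl_point 0 x) = 0" for i j
  proof -
    define f where "f = (\<lambda>r. H (cyl_point r x) $ i $ j)"
    define d where "d = pd None (\<lambda>z. H z $ i $ j) (cyl_point 0 x)"
    have d: "(f has_real_derivative d) (at 0)"
      unfolding f_def d_def using x by (intro DERIV_cyl) simp
    then have "((\<lambda>r. f (- r)) has_real_derivative d * (- 1)) (at 0)"
      by (intro DERIV_chain2[where g = uminus]) (auto intro!: derivative_eq_intros)
    then have "(f has_real_derivative d * (- 1)) (at 0)"
      by (rule has_field_derivative_transform_within_open[where S = "{- \<eta><..<\<eta>}"])
         (use eta even in \<open>auto simp: f_def H_def\<close>)
    then have "d = d * (- 1)" using d DERIV_unique by blast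
    then show ?thesis by (simp add: d_def)
  qed
  then show ?thesis unfolding Hd_1_nth by (simp add: vec_eq_iff del: One_nat_def)
qed

lemma Hd_1_quotient:
  assumes x: "x \<in> V" and 0: "Hd 1 (cyl_point 0 x) = 0"
  shows "((\<lambda>r. Hd 1 (cyl_point r x) $ i $ j / r) \<longlongrightarrow> Hd 2 (cyl_point 0 x) $ i $ j) (at_right 0)"
proof -
  have s: "smooth_at (\<lambda>z. Hd 1 z $ i $ j) (cyl_point 0 x)" using x by (intro msmoothD) auto
  have "pd None (\<lambda>z. Hd 1 z $ i $ j) (cyl_point 0 x) = Hd 2 (cyl_point 0 x) $ i $ j"
    by (simp add: Hd_def numeral_2_eq_2)
  then show ?thesis
    using DERIV_cyl[OF s] 0 by (simp add: has_field_derivative_iff filterlim_at_split del: One_nat_def)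
qed

text \<open>In the limit $r \to 0$, the first derivative divided by \<open>r\<close> becomes the second derivative, and the Einstein
  condition relates the latter to the Ricci curvature of the initial metric.\<close>

lemma einstein_limit:
  assumes x: "x \<in> V" and even: "\<And>r. \<bar>r\<bar> < \<eta> \<Longrightarrow> k (- r) x = k r x"
    and lim: "((\<lambda>r. einstein_defect k r x $ Some j $ Some l) \<longlongrightarrow> 0) (at_right 0)"
  shows "ricci (k 0) x $ j $ l + (real CARD('n) - 2) / 2 * Hd 2 (cyl_point 0 x) $ j $ l
    + (1/2) * trace (matrix_inv (k 0 x) ** Hd 2 (cyl_point 0 x)) * k 0 x $ j $ l = 0"
proof -
  have x0: "cyl_point 0 x \<in> C" using x by simp
  have h0: "Hd 1 (cyl_point 0 x) = 0" by (rule Hd_1_eq_0[OF x even])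
  define e where "e r = ric j l (cyl_point r x) - (1/2) * Hd 2 (cyl_point r x) $ j $ l
      + (1/2) * (Hd 1 (cyl_point r x) ** Xd 0 (cyl_point r x) ** Hd 1 (cyl_point r x)) $ j $ l
      - (1/4) * trace (Xd 0 (cyl_point r x) ** Hd 1 (cyl_point r x)) * Hd 1 (cyl_point r x) $ j $ l
      + (real CARD('n) - 1) / 2 * (Hd 1 (cyl_point r x) $ j $ l / r)
      + (1/2) * (trace (Xd 0 (cyl_point r x) ** Hd 1 (cyl_point r x)) / r) * H (cyl_point r x) $ j $ l" for r
  have tr: "trace (Xd 0 y ** D) = (\<Sum>a\<in>UNIV. \<Sum>b\<in>UNIV. Hi a b y * D $ b $ a)" for y D
    by (simp add: trace_def matrix_mult_nth Xd_0_nth)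
  have m: "((\<lambda>r. A (cyl_point r x) $ a $ b) \<longlongrightarrow> A (cyl_point 0 x) $ a $ b) (at_right 0)" if "msmooth A" for A a b
    using tendsto_cyl[OF msmoothD[OF that x0]] .
  have mH: "msmooth H" using msmooth_Hd[of 0] by simp
  have t1: "((\<lambda>r. trace (Xd 0 (cyl_point r x) ** Hd 1 (cyl_point r x))) \<longlongrightarrow> 0) (at_right 0)"
  proof -
    have "((\<lambda>r. \<Sum>a\<in>UNIV. \<Sum>b\<in>UNIV. Hi a b (cyl_point r x) * Hd 1 (cyl_point r x) $ b $ a)
       \<longlongrightarrow> (\<Sum>a\<in>UNIV. \<Sum>b\<in>UNIV. Hi a b (cyl_point 0 x) * Hd 1 (cyl_point 0 x) $ b $ a)) (at_right 0)"
      by (intro tendsto_sum tendsto_mult m tendsto_cyl) (use x0 in auto)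
    then show ?thesis unfolding tr h0 by simp
  qed
  have t2: "((\<lambda>r. trace (Xd 0 (cyl_point r x) ** Hd 1 (cyl_point r x)) / r)
      \<longlongrightarrow> trace (Xd 0 (cyl_point 0 x) ** Hd 2 (cyl_point 0 x))) (at_right 0)"
  proof -
    have "((\<lambda>r. \<Sum>a\<in>UNIV. \<Sum>b\<in>UNIV. Hi a b (cyl_point r x) * (Hd 1 (cyl_point r x) $ b $ a / r))
       \<longlongrightarrow> (\<Sum>a\<in>UNIV. \<Sum>b\<in>UNIV. Hi a b (cyl_point 0 x) * Hd 2 (cyl_point 0 x) $ b $ a)) (at_right 0)"
      by (intro tendsto_sum tendsto_mult Hd_1_quotient[OF x h0] tendsto_cyl) (use x0 in auto)
    then show ?thesis unfolding tr by (simp add: sum_divide_distrib)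
  qed
  have "(e \<longlongrightarrow> ric j l (cyl_point 0 x) - (1/2) * Hd 2 (cyl_point 0 x) $ j $ l
      + (1/2) * (Hd 1 (cyl_point 0 x) ** Xd 0 (cyl_point 0 x) ** Hd 1 (cyl_point 0 x)) $ j $ l
      - (1/4) * 0 * Hd 1 (cyl_point 0 x) $ j $ l
      + (real CARD('n) - 1) / 2 * Hd 2 (cyl_point 0 x) $ j $ l
      + (1/2) * trace (Xd 0 (cyl_point 0 x) ** Hd 2 (cyl_point 0 x)) * H (cyl_point 0 x) $ j $ l) (at_right 0)"
    unfolding e_def
    by (intro tendsto_add tendsto_diff tendsto_mult tendsto_const t1 t2 Hd_1_quotient[OF x h0] m mH
          tendsto_cyl[OF smooth_at_ric[OF x0]] msmooth_Hd m[OF msmooth_mult[OF msmooth_mult[OF msmooth_Hd msmooth_Xd] msmooth_Hd]])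
  moreover have "(e \<longlongrightarrow> 0) (at_right 0)"
  proof (rule Lim_transform_eventually[OF lim])
    have "einstein_defect k r x $ Some j $ Some l = e r" if "r \<in> {0<..<\<eta>}" for r
    proof -
      have "cyl_point r x \<in> pe_dom" using that x by (simp add: pe_dom_def mem_C)
      from pe_ricci[OF this] show ?thesis by (simp add: einstein_defect_def e_def)
    qed
    then show "\<forall>\<^sub>F r in at_right 0. einstein_defect k r x $ Some j $ Some l = e r"
      using eta by (auto simp: eventually_at_right_field)
  qed
  ultimately have "ric j l (cyl_point 0 x) - (1/2) * Hd 2 (cyl_point 0 x) $ j $ l
      + (1/2) * (Hd 1 (cyl_point 0 x) ** Xd 0 (cyl_point 0 x) ** Hd 1 (cyl_point 0 x)) $ j $ l
      - (1/4) * 0 * Hd 1 (cyl_point 0 x) $ j $ l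
      + (real CARD('n) - 1) / 2 * Hd 2 (cyl_point 0 x) $ j $ l
      + (1/2) * trace (Xd 0 (cyl_point 0 x) ** Hd 2 (cyl_point 0 x)) * H (cyl_point 0 x) $ j $ l = 0"
    using tendsto_unique[OF trivial_limit_at_right_real] by blast
  moreover have "ric j l (cyl_point 0 x) = ricci (k 0) x $ j $ l" using ric_slice[OF x] eta by simp
  ultimately show ?thesis
    unfolding h0 by (simp add: Xd_0 H_def field_simps)
qed

end

lemma christoffel_cong_open:
  assumes "open S" "x \<in> S" "\<And>y. y \<in> S \<Longrightarrow> G y = G' y"
  shows "christoffel G m i j x = christoffel G' m i j x"
proof -
  have "pd a (\<lambda>y. G y $ b $ c) x = pd a (\<lambda>y. G' y $ b $ c) x" for a b c
    by (rule pd_cong_open[OF assms(1,2)]) (simp add: assms(3))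
  then show ?thesis using assms by (simp add: christoffel_def metric_inv_def)
qed

lemma ricci_cong_open:
  assumes "open S" "x \<in> S" "\<And>y. y \<in> S \<Longrightarrow> G y = G' y"
  shows "ricci G x = ricci G' x"
proof -
  have c: "christoffel G m i j y = christoffel G' m i j y" if "y \<in> S" for m i j y
    by (rule christoffel_cong_open[OF assms(1) that assms(3)])
  have "pd a (christoffel G m i j) x = pd a (christoffel G' m i j) x" for a m i j
    by (rule pd_cong_open[OF assms(1,2) c])
  then show ?thesis using c[OF assms(2)] by (simp add: ricci_def curv_up_def)
qed

text \<open>Taking the trace of the equation identifies the trace of \<open>D\<close> with \<open>2 * J_scal\<close>, after which it can be
  solved for \<open>D\<close>.\<close>

lemma schouten_eqI:
  fixes G :: "real^'n::finite \<Rightarrow> real^'n^'n" and D :: "real^'n^'n"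
  assumes n: "CARD('n) \<ge> 3" and det: "det (G x) \<noteq> 0" and sym: "transpose (G x) = G x"
    and D: "\<And>i j. D $ i $ j = D $ j $ i"
    and eq: "\<And>j l. ricci G x $ j $ l = (real CARD('n) - 2) / 2 * D $ j $ l
        + (1/2) * trace (matrix_inv (G x) ** D) * G x $ j $ l"
  shows "D = 2 *\<^sub>R schouten G x"
proof -
  let ?X = "matrix_inv (G x)" and ?n = "real CARD('n)"
  define \<tau> where "\<tau> = trace (?X ** D)"
  have t1: "(\<Sum>i\<in>UNIV. \<Sum>j\<in>UNIV. ?X $ i $ j * D $ i $ j) = \<tau>"
    unfolding \<tau>_def trace_def matrix_mult_nth by (intro sum.cong refl) (simp add: D[of _ i for i])
  have Gs: "G x $ i $ j = G x $ j $ i" for i j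
  proof -
    have "G x $ i $ j = transpose (G x) $ j $ i" by (simp add: transpose_def)
    then show ?thesis by (simp add: sym)
  qed
  have t2: "(\<Sum>i\<in>UNIV. \<Sum>j\<in>UNIV. ?X $ i $ j * G x $ i $ j) = ?n"
  proof -
    have "(\<Sum>i\<in>UNIV. \<Sum>j\<in>UNIV. ?X $ i $ j * G x $ i $ j) = trace (?X ** G x)"
      unfolding trace_def matrix_mult_nth by (intro sum.cong refl) (simp add: Gs)
    then show ?thesis by (simp add: matrix_inv_mult[OF det] trace_def mat_def)
  qed
  have "scal G x = (\<Sum>i\<in>UNIV. \<Sum>j\<in>UNIV. (?n - 2) / 2 * (?X $ i $ j * D $ i $ j) + (1/2) * \<tau> * (?X $ i $ j * G x $ i $ j))"
    unfolding scal_def metric_inv_def eq \<tau>_def[symmetric] by (intro sum.cong refl) (simp add: algebra_simps)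
  also have "\<dots> = (?n - 2) / 2 * \<tau> + (1/2) * \<tau> * ?n"
    by (simp only: sum.distrib sum_distrib_left[symmetric] t1 t2)
  also have "\<dots> = (?n - 1) * \<tau>" by (simp add: field_simps)
  finally have sc: "scal G x = (?n - 1) * \<tau>" .
  have "2 * (?n - 1) \<noteq> 0" using n by simp
  then have J: "J_scal G x = \<tau> / 2"
    unfolding J_scal_def sc by (simp add: divide_eq_eq)
  have "D $ j $ l = (2 *\<^sub>R schouten G x) $ j $ l" for j l
  proof -
    have "schouten G x $ j $ l = 1 / (?n - 2) * ((?n - 2) / 2 * D $ j $ l)"
      by (simp add: schouten_def J eq \<tau>_def[symmetric])
    then show ?thesis using n by simp
  qed
  then show ?thesis by (simp add: vec_eq_iff)
qed

section \<open>Derivatives of functions of the square\<close>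

lemma deriv_funpow_chain:
  fixes g :: "real \<Rightarrow> real"
  assumes g: "\<And>r. \<bar>r\<bar> < d \<Longrightarrow> g r = e 0 r"
    and e: "\<And>m r. m < M \<Longrightarrow> \<bar>r\<bar> < d \<Longrightarrow> (e m has_real_derivative e (Suc m) r) (at r)"
  shows "m \<le> M \<Longrightarrow> \<bar>r\<bar> < d \<Longrightarrow> (deriv ^^ m) g r = e m r"
proof (induction m arbitrary: r)
  case (Suc m)
  have "((deriv ^^ m) g has_real_derivative e (Suc m) r) (at r)"
    by (rule has_field_derivative_transform_within_open[OF e, where S = "{-d<..<d}"])
       (use Suc in \<open>auto simp: abs_less_iff\<close>)
  then show ?case by (simp add: DERIV_imp_deriv)
qed (use g in auto)

text \<open>Derivatives at 0 of $F(-r^2/2)$.  Repeated application of the chain rule gives the polynomials in \<open>e\<close>; only the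
  term without a factor \<open>r\<close> survives at 0, with coefficient $(-1)^m(2m-1)!!$ in order \<open>2m\<close>.\<close>

lemma deriv_even:
  fixes g :: "real \<Rightarrow> real" and F :: "nat \<Rightarrow> real \<Rightarrow> real"
  assumes pos: "\<epsilon> > 0" "\<eta> > 0"
    and F: "\<And>j \<rho>. \<bar>\<rho>\<bar> < \<eta> \<Longrightarrow> (F j has_real_derivative F (Suc j) \<rho>) (at \<rho>)"
    and g: "\<And>r. \<bar>r\<bar> < \<epsilon> \<Longrightarrow> r\<^sup>2 / 2 < \<eta> \<Longrightarrow> g r = F 0 (- (r\<^sup>2 / 2))"
  shows "(deriv ^^ 2) g 0 = - F 1 0" "(deriv ^^ 4) g 0 = 3 * F 2 0"
    "(deriv ^^ 6) g 0 = - 15 * F 3 0" "(deriv ^^ 8) g 0 = 105 * F 4 0"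
proof -
  define d where "d = min \<epsilon> (min 1 \<eta>)"
  have d: "d > 0" using pos by (simp add: d_def)
  have small: "r\<^sup>2 / 2 < \<eta>" if "\<bar>r\<bar> < d" for r
  proof -
    have "r\<^sup>2 = \<bar>r\<bar> * \<bar>r\<bar>" by (simp add: power2_eq_square)
    also have "\<dots> \<le> \<bar>r\<bar> * 1" using that by (intro mult_left_mono) (auto simp: d_def)
    finally have "r\<^sup>2 \<le> \<bar>r\<bar>" by simp
    moreover have "\<bar>r\<bar> < \<eta>" using that by (simp add: d_def)
    ultimately show ?thesis using pos by linarith
  qed
  define f where "f j r = F j (- (r\<^sup>2 / 2))" for j r
  have fd: "(f j has_real_derivative (- (r * f (Suc j) r))) (at r)" if "\<bar>r\<bar> < d" for j r
  proof -
    have "((\<lambda>r. F j (- (r\<^sup>2 / 2))) has_real_derivative (F (Suc j) (- (r\<^sup>2 / 2)) * (- r))) (at r)"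
      by (rule DERIV_chain2[OF F]) (use small[OF that] in \<open>auto intro!: derivative_eq_intros\<close>)
    then show ?thesis unfolding f_def[abs_def] by (simp add: mult.commute)
  qed
  define e where "e = (\<lambda>m r. [f 0 r, - (r * f 1 r), r^2 * f 2 r - f 1 r, 3 * r * f 2 r - r^3 * f 3 r,
      3 * f 2 r - 6 * r^2 * f 3 r + r^4 * f 4 r, 10 * r^3 * f 4 r - 15 * r * f 3 r - r^5 * f 5 r,
      45 * r^2 * f 4 r - 15 * f 3 r - 15 * r^4 * f 5 r + r^6 * f 6 r,
      105 * r * f 4 r - 105 * r^3 * f 5 r + 21 * r^5 * f 6 r - r^7 * f 7 r,
      105 * f 4 r - 420 * r^2 * f 5 r + 210 * r^4 * f 6 r - 28 * r^6 * f 7 r + r^8 * f 8 r] ! m)"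
  have "(e m has_real_derivative e (Suc m) r) (at r)" if "m < 8" and r: "\<bar>r\<bar> < d" for m r
  proof -
    from that(1) have "m \<in> {0, 1, 2, 3, 4, 5, 6, 7}" by auto
    then show ?thesis
      by (elim insertE emptyE; simp add: e_def del: power_Suc)
         (auto intro!: derivative_eq_intros fd[OF r] simp: algebra_simps eval_nat_numeral)
  qed
  moreover have "g r = e 0 r" if "\<bar>r\<bar> < d" for r
    using g[of r] small[OF that] that by (simp add: e_def f_def d_def)
  ultimately have *: "(deriv ^^ m) g 0 = e m 0" if "m \<le> 8" for m
    using deriv_funpow_chain[of d g e 8 m 0] that d by auto
  show "(deriv ^^ 2) g 0 = - F 1 0" "(deriv ^^ 4) g 0 = 3 * F 2 0"
    "(deriv ^^ 6) g 0 = - 15 * F 3 0" "(deriv ^^ 8) g 0 = 105 * F 4 0"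
    by (simp_all add: * e_def f_def)
qed

section \<open>Charts\<close>

lemma atlas_chartD:
  assumes "smooth_atlas A" "c \<in> A"
  shows "open (cimg c)" "x \<in> cimg c \<Longrightarrow> cinv c x \<in> cdom c" "x \<in> cimg c \<Longrightarrow> coord c (cinv c x) = x"
    "p \<in> cdom c \<Longrightarrow> cinv c (coord c p) = p"
proof -
  have h: "open (cimg c)" "homeomorphism (cdom c) (cimg c) (coord c) (cinv c)"
    using assms by (auto simp: smooth_atlas_def)
  show "open (cimg c)" by (rule h)
  show "x \<in> cimg c \<Longrightarrow> cinv c x \<in> cdom c" "x \<in> cimg c \<Longrightarrow> coord c (cinv c x) = x"
    "p \<in> cdom c \<Longrightarrow> cinv c (coord c p) = p"
    using h(2) unfolding homeomorphism_def by blast+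
qed

lemma chart_atD:
  assumes "smooth_atlas A" shows "chart_at A p \<in> A" "p \<in> cdom (chart_at A p)"
proof -
  have "p \<in> (\<Union>c\<in>A. cdom c)" using assms by (simp add: smooth_atlas_def)
  then have "\<exists>c. c \<in> A \<and> p \<in> cdom c" by blast
  then have "chart_at A p \<in> A \<and> p \<in> cdom (chart_at A p)" unfolding chart_at_def by (rule someI_ex)
  then show "chart_at A p \<in> A" "p \<in> cdom (chart_at A p)" by auto
qed

lemma posdef_det:
  fixes M :: "real^'n^'n::finite"
  assumes "\<And>v. v \<noteq> 0 \<Longrightarrow> v \<bullet> (M *v v) > 0"
  shows "det M \<noteq> 0"
proof -
  have "v = 0" if "M *v v = 0" for v using assms[of v] that by force
  then have "invertible M" by (simp add: invertible_left_inverse matrix_left_invertible_ker)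
  then show ?thesis by (simp add: invertible_det_nz)
qed

lemma riemannian_metric_det:
  "riemannian_metric A g \<Longrightarrow> c \<in> A \<Longrightarrow> x \<in> cimg c \<Longrightarrow> det (g c x) \<noteq> 0"
  unfolding riemannian_metric_def by (intro posdef_det) blast

lemma metric_family_chart:
  assumes "smooth_atlas A" "0 < \<eta>" "smooth_metric_family A {-\<eta><..<\<eta>} k" "c \<in> A"
  shows "metric_family \<eta> (cimg c) (k c)"
proof
  have R: "riemannian_metric A (\<lambda>c. k c s)" if "\<bar>s\<bar> < \<eta>" for s
    using assms that by (auto simp: smooth_metric_family_def abs_less_iff)
  show "0 < \<eta>" "open (cimg c)" using assms(2) atlas_chartD(1)[OF assms(1,4)] by blast+
  show "smooth_on (cylinder {-\<eta><..<\<eta>} (cimg c)) (\<lambda>y. k c (y $ None) (xpart y) $ i $ j)" for i j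
    using assms by (simp add: smooth_metric_family_def)
  show "transpose (k c \<rho> x) = k c \<rho> x" if "\<bar>\<rho>\<bar> < \<eta>" "x \<in> cimg c" for \<rho> x
    using R[OF that(1)] that(2) assms(4) unfolding riemannian_metric_def by blast
  show "det (k c \<rho> x) \<noteq> 0" if "\<bar>\<rho>\<bar> < \<eta>" "x \<in> cimg c" for \<rho> x
    using riemannian_metric_det[OF R[OF that(1)] assms(4) that(2)] .
qed

text \<open>Both densities are multiplied by the absolute value of the same Jacobian determinant.\<close>

lemma vol_density_ratio:
  assumes g: "riemannian_metric A g" and G: "riemannian_metric A G"
    and c: "c \<in> A" "c' \<in> A" "p \<in> cdom c" "p \<in> cdom c'"
  shows "vol_density (G c) (coord c p) / vol_density (g c) (coord c p)
       = vol_density (G c') (coord c' p) / vol_density (g c') (coord c' p)"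
proof -
  let ?J = "transition_jacobian c c' p"
  have t: "B c (coord c p) = transpose ?J ** B c' (coord c' p) ** ?J" if "riemannian_metric A B" for B
    using that c unfolding riemannian_metric_def by blast
  have v: "vol_density (B c) (coord c p) = \<bar>det ?J\<bar> * vol_density (B c') (coord c' p)"
    if "riemannian_metric A B" for B
    unfolding vol_density_def t[OF that]
    by (simp add: det_mul det_transpose abs_mult real_sqrt_mult)
  have "det (g c (coord c p)) \<noteq> 0" by (rule riemannian_metric_det[OF g c(1) imageI[OF c(3)]])
  then have "det ?J \<noteq> 0" unfolding t[OF g] by (simp add: det_mul det_transpose)
  then show ?thesis unfolding v[OF g] v[OF G] by simp
qed

text \<open>The chart that was selected to define \<open>w_fun\<close> varies with the point.  That it can be replaced by any
  other chart makes \<open>w_fun\<close> a smooth function, to which operators can be applied.\<close>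

lemma w_fun_chart:
  assumes "smooth_atlas A" "riemannian_metric A g" "riemannian_metric A (\<lambda>c. G c s)" "c \<in> A" "p \<in> cdom c"
  shows "w_fun A g G s p = sqrt (vol_density (G c s) (coord c p) / vol_density (g c) (coord c p))"
  unfolding w_fun_def Let_def
  using vol_density_ratio[OF assms(2,3) chart_atD(1)[OF assms(1)] assms(4) chart_atD(2)[OF assms(1)] assms(5)]
  by simp

context metric_family
begin

lemma W_eq_sqrt: "W (cyl_point \<rho> x) = sqrt (vol_density (k \<rho>) x / vol_density (k 0) x)"
  by (simp add: W_def volratio_def H_def v0_def vol_density_def powr_half_sqrt)

lemma laplacian_funpow_cong:
  assumes "\<And>y. y \<in> amb_dom \<Longrightarrow> f y = f' y" "y \<in> amb_dom"
  shows "(laplacian G ^^ m) f y = (laplacian G ^^ m) f' y"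
  using assms(2)
proof (induction m arbitrary: y)
  case (Suc m)
  show ?case unfolding funpow.simps comp_apply
    by (rule laplacian_cong_open[OF open_amb_dom Suc.prems Suc.IH])
qed (use assms in auto)

lemma laplacian_amb_iterate_slice:
  assumes F: "smooth F" and x: "x \<in> V"
    and f: "\<And>y. y \<in> amb_dom \<Longrightarrow> f y = (y $ AT) powr (real m - real CARD('n) / 2) * (F (coords amb_index y) * \<beta> (coords amb_index y))"
  shows "(laplacian (amb_metric k) ^^ m) f (amb_point 1 x 0) = iterD m (2 * real m - 2) F (cyl_point 0 x)"
proof -
  have "\<beta> (cyl_point 0 x) = 1" using \<beta>_W[of "cyl_point 0 x"] W_cyl0[OF x] x by simp
  moreover have "amb_point 1 x 0 $ AT = 1" by (simp add: amb_point_def)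
  moreover have "2 * (real m - real CARD('n) / 2) + real CARD('n) - 2 = 2 * real m - 2" by simp
  moreover have "(laplacian (amb_metric k) ^^ m) f (amb_point 1 x 0) = (laplacian (amb_metric k) ^^ m)
      (\<lambda>y. (y $ AT) powr (real m - real CARD('n) / 2) * (F (coords amb_index y) * \<beta> (coords amb_index y))) (amb_point 1 x 0)"
    by (rule laplacian_funpow_cong[OF _ amb_point_dom[OF x]]) (rule f)
  ultimately show ?thesis
    using laplacian_amb_iterate[OF F amb_point_dom[OF x], of m "real m - real CARD('n) / 2"]
    by (simp add: coords_amb_point)
qed

lemma DERIV_W:
  assumes "x \<in> V" "\<bar>\<rho>\<bar> < \<eta>"
  shows "((\<lambda>\<rho>. (pd None ^^ j) W (cyl_point \<rho> x)) has_real_derivative (pd None ^^ Suc j) W (cyl_point \<rho> x)) (at \<rho>)"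
  using DERIV_cyl[of "(pd None ^^ j) W" \<rho> x] assms open_interval_C by simp

text \<open>The factor \<open>a\<close> accommodates the normalization of the tensor.  Subtracting the value on constants
  removes the potential and leaves the divergence part of \<open>mop\<close>.\<close>

lemma mop_codiff:
  assumes u: "smooth_on V u" and x: "x \<in> V"
    and G: "\<And>x. x \<in> V \<Longrightarrow> G x = k 0 x"
    and T: "\<And>x. x \<in> V \<Longrightarrow> metric_inv G x ** T x = a *\<^sub>R Xd m (cyl_point 0 x)"
  shows "codiff G (\<lambda>x. T x *v dform u x) x = - a * (mop m u x - mop m (\<lambda>x. 1) x * u x)"
proof -
  define Z where "Z i x = (\<Sum>j\<in>UNIV. (pd None ^^ m) (Hi i j) (cyl_point 0 x) * pd j u x)" for i x
  have su: "smooth_at u x" if "x \<in> V" for x using u that by (simp add: smooth_V_iff)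
  have sZ: "smooth_at (Z i) x" if "x \<in> V" for i x unfolding Z_def[abs_def] using su[OF that] that by simp
  have v: "vol_density G x = v0 x" if "x \<in> V" for x by (simp add: vol_density_def v0_def G[OF that])
  have f: "vol_density G y * (metric_inv G y *v (T y *v dform u y)) $ i = a * (v0 y * Z i y)" if "y \<in> V" for y i
    unfolding matrix_vector_mul_assoc T[OF that] v[OF that]
    by (simp add: matrix_vector_mult_def Z_def dform_def Xd_nth sum_distrib_left mult_ac)
  have p: "pd i (\<lambda>y. vol_density G y * (metric_inv G y *v (T y *v dform u y)) $ i) x
      = a * (pd i v0 x * Z i x + v0 x * pd i (Z i) x)" for i
  proof -
    have "pd i (\<lambda>y. vol_density G y * (metric_inv G y *v (T y *v dform u y)) $ i) x = pd i (\<lambda>y. a * (v0 y * Z i y)) x"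
      by (rule pd_cong_open[OF open_V x f])
    then show ?thesis using sZ[OF x] smooth_at_v0[OF x] by (simp add: pd_cmult pd_mult)
  qed
  have m1: "mop m (\<lambda>x. 1) x = (pd None ^^ m) Q (cyl_point 0 x)"
    using x by (simp add: mop_def)
  have "mop m u x - mop m (\<lambda>x. 1) x * u x = (\<Sum>i\<in>UNIV. pd i (Z i) x + pd i v0 x / v0 x * Z i x)"
    unfolding m1 using x by (simp add: mop_def Z_def[abs_def])
  moreover have "codiff G (\<lambda>x. T x *v dform u x) x = - a * (\<Sum>i\<in>UNIV. pd i (Z i) x + pd i v0 x / v0 x * Z i x)"
  proof -
    have q: "a * (pd i v0 x * Z i x + v0 x * pd i (Z i) x) = v0 x * (a * (pd i (Z i) x + pd i v0 x / v0 x * Z i x))" for i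
      using v0_pos[OF x] by (simp add: field_simps)
    show ?thesis
      unfolding codiff_def p v[OF x] q sum_distrib_left[symmetric] using v0_pos[OF x] by simp
  qed
  ultimately show ?thesis by simp
qed

end

section \<open>GJMS-operators on the manifold\<close>

lemma bigo_power_tendsto_0:
  fixes f :: "real \<Rightarrow> real"
  assumes "f \<in> O[at_right 0](\<lambda>r. r ^ m)" "m \<ge> 1"
  shows "(f \<longlongrightarrow> 0) (at_right 0)"
proof -
  obtain b where b: "eventually (\<lambda>r. norm (f r) \<le> b * norm (r ^ m)) (at_right 0)"
    using landau_o.bigE[OF assms(1)] by blast
  have "((\<lambda>r::real. r ^ m) \<longlongrightarrow> 0 ^ m) (at_right 0)" by (intro tendsto_power tendsto_ident_at)
  then have "((\<lambda>r::real. b * norm (r ^ m)) \<longlongrightarrow> b * norm (0 ^ m :: real)) (at_right 0)"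
    by (intro tendsto_mult tendsto_const tendsto_norm)
  then have "((\<lambda>r::real. b * norm (r ^ m)) \<longlongrightarrow> 0) (at_right 0)" using assms(2) by (simp add: zero_power)
  with b show ?thesis by (rule Lim_null_comparison)
qed

locale poincare_einstein_setting =
  fixes A :: "('m::{t2_space,second_countable_topology}, 'n::finite) chart set"
    and g :: "('m, 'n) tensor2" and h k :: "('m, 'n) tensor2_family" and \<epsilon> \<eta> :: real
  assumes atlas: "smooth_atlas A" and metric: "riemannian_metric A g"
    and dim: "even CARD('n) \<and> CARD('n) \<ge> 8 \<or> odd CARD('n) \<and> CARD('n) \<ge> 3"
    and pe: "poincare_einstein A g \<epsilon> h" and amb: "ambient_family A \<epsilon> h \<eta> k"
begin

lemma eps: "\<epsilon> > 0" and h_family: "smooth_metric_family A {-\<epsilon><..<\<epsilon>} h"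
  and h0: "c \<in> A \<Longrightarrow> x \<in> cimg c \<Longrightarrow> h c 0 x = g c x"
  using pe unfolding poincare_einstein_def by blast+

lemma h_even:
  assumes "c \<in> A" "x \<in> cimg c" "\<bar>r\<bar> < \<epsilon>" shows "h c (- r) x = h c r x"
proof -
  have "r \<in> {-\<epsilon><..<\<epsilon>}" using assms(3) by auto
  then show ?thesis using pe assms(1,2) unfolding poincare_einstein_def by blast
qed

lemma eta: "\<eta> > 0" and k_family: "smooth_metric_family A {-\<eta><..<\<eta>} k"
  using amb unfolding ambient_family_def by blast+

lemma h_eq_k:
  assumes "c \<in> A" "x \<in> cimg c" "\<bar>r\<bar> < \<epsilon>" "r\<^sup>2 / 2 < \<eta>"
  shows "h c r x = k c (- (r\<^sup>2 / 2)) x"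
proof -
  have "r \<in> {-\<epsilon><..<\<epsilon>}" using assms(3) by auto
  then have "k c (- (r\<^sup>2 / 2)) x = h c r x"
    using amb assms(1,2,4) unfolding ambient_family_def by blast
  then show ?thesis by simp
qed

lemma k0: "c \<in> A \<Longrightarrow> x \<in> cimg c \<Longrightarrow> k c 0 x = g c x"
  using h_eq_k[of c x 0] h0[of c x] eps eta by simp

lemma k_chart: "c \<in> A \<Longrightarrow> metric_family \<eta> (cimg c) (k c)"
  by (rule metric_family_chart[OF atlas eta k_family])

lemma h_chart: "c \<in> A \<Longrightarrow> metric_family \<epsilon> (cimg c) (h c)"
  by (rule metric_family_chart[OF atlas eps h_family])

lemma metric_k: "\<bar>s\<bar> < \<eta> \<Longrightarrow> riemannian_metric A (\<lambda>c. k c s)"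
  using k_family by (auto simp: smooth_metric_family_def abs_less_iff)

lemma metric_h: "\<bar>s\<bar> < \<epsilon> \<Longrightarrow> riemannian_metric A (\<lambda>c. h c s)"
  using h_family by (auto simp: smooth_metric_family_def abs_less_iff)

text \<open>In every admitted dimension the defect vanishes at least to first order: for even dimensions the
  order is $n-2$.\<close>

lemma einstein_defect_tendsto:
  assumes "c \<in> A" "x \<in> cimg c"
  shows "((\<lambda>r. einstein_defect (h c) r x $ a $ b) \<longlongrightarrow> 0) (at_right 0)"
proof (cases "odd CARD('n)")
  case True
  then have "(\<lambda>r. einstein_defect (h c) r x $ a $ b) \<in> O[at_right 0](\<lambda>r. r ^ 1)"
    using pe assms unfolding poincare_einstein_def by blast
  then show ?thesis by (rule bigo_power_tendsto_0) simp
next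
  case False
  then have "(\<lambda>r. einstein_defect (h c) r x $ a $ b) \<in> O[at_right 0](\<lambda>r. r ^ (CARD('n) - 2))"
    using pe assms unfolding poincare_einstein_def by blast
  then show ?thesis by (rule bigo_power_tendsto_0) (use dim False in linarith)
qed

text \<open>The only use of the Einstein condition: $g'(0) = 2P$.  Because of $\rho=-r^2/2$, the second $r$-derivative of $g_r$ is
  minus the first $\rho$-derivative of $g(\rho)$ at 0.\<close>

lemma Hd_1_schouten:
  assumes c: "c \<in> A" and x: "x \<in> cimg c"
  shows "metric_family.Hd (k c) 1 (cyl_point 0 x) = 2 *\<^sub>R schouten (g c) x"
proof -
  interpret K: metric_family \<eta> "cimg c" "k c" by (rule k_chart[OF c])
  interpret E: metric_family \<epsilon> "cimg c" "h c" by (rule h_chart[OF c])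
  have H2: "E.Hd 2 (cyl_point 0 x) = - K.Hd 1 (cyl_point 0 x)"
  proof -
    have "E.Hd 2 (cyl_point 0 x) $ i $ j = - K.Hd 1 (cyl_point 0 x) $ i $ j" for i j
    proof -
      define f where "f r = E.H (cyl_point r x) $ i $ j" for r
      define F where "F m \<rho> = (pd None ^^ m) (\<lambda>z. K.H z $ i $ j) (cyl_point \<rho> x)" for m \<rho>
      define e where "e m r = (pd None ^^ m) (\<lambda>z. E.H z $ i $ j) (cyl_point r x)" for m r
      have dF: "(F m has_real_derivative F (Suc m) \<rho>) (at \<rho>)" if "\<bar>\<rho>\<bar> < \<eta>" for m \<rho>
        unfolding F_def[abs_def] funpow.simps comp_apply
        by (intro K.DERIV_cyl smooth_at_pd_funpow K.smooth_at_H K.open_interval_C x that)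
      have de: "(e m has_real_derivative e (Suc m) r) (at r)" if "\<bar>r\<bar> < \<epsilon>" for m r
        unfolding e_def[abs_def] funpow.simps comp_apply
        by (intro E.DERIV_cyl smooth_at_pd_funpow E.smooth_at_H E.open_interval_C x that)
      have e0: "e 0 r = E.H (cyl_point r x) $ i $ j" for r by (simp add: e_def)
      have "(deriv ^^ 2) f 0 = e 2 0"
        by (rule deriv_funpow_chain[where M = 2 and d = \<epsilon> and e = e])
           (use eps in \<open>simp_all only: f_def e0 de abs_zero order_refl\<close>)
      moreover have "(deriv ^^ 2) f 0 = - F 1 0"
        by (rule deriv_even[where F = F, OF eps eta dF]) (use h_eq_k[OF c x] in \<open>auto simp: f_def F_def E.H_def K.H_def\<close>)
      ultimately show ?thesis by (simp add: e_def F_def E.Hd_nth K.Hd_nth)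
    qed
    then show ?thesis by (simp add: vec_eq_iff del: One_nat_def)
  qed
  have R: "ricci (h c 0) x = ricci (g c) x"
    by (rule ricci_cong_open[OF K.open_V x h0[OF c]])
  have tr: "trace (- M) = - trace M" for M :: "real^'n^'n" by (simp add: trace_def sum_negf)
  have "ricci (g c) x $ j $ l = (real CARD('n) - 2) / 2 * K.Hd 1 (cyl_point 0 x) $ j $ l
        + (1/2) * trace (matrix_inv (g c x) ** K.Hd 1 (cyl_point 0 x)) * g c x $ j $ l" for j l
    using E.einstein_limit[OF x h_even[OF c x] einstein_defect_tendsto[OF c x], of j l]
    unfolding R h0[OF c x] H2 matrix_minus_right tr by (simp del: One_nat_def)
  then show ?thesis
  proof (intro schouten_eqI)
    show "CARD('n) \<ge> 3" using dim by auto
    show "det (g c x) \<noteq> 0" by (rule riemannian_metric_det[OF metric c x])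
    show "transpose (g c x) = g c x" using metric c x unfolding riemannian_metric_def by blast
    show "K.Hd 1 (cyl_point 0 x) $ i $ j = K.Hd 1 (cyl_point 0 x) $ j $ i" for i j
      using x by (intro K.sym_Hd) simp
  qed
qed

lemma smooth_hat: "smooth_fun A u \<Longrightarrow> c \<in> A \<Longrightarrow> smooth_on (cimg c) (\<lambda>x. u (cinv c x))"
  by (simp add: smooth_fun_def)

lemma w_fun_k:
  assumes c: "c \<in> A" and x: "x \<in> cimg c" and \<rho>: "\<bar>\<rho>\<bar> < \<eta>"
  shows "w_fun A g k \<rho> (cinv c x) = metric_family.W (k c) (cyl_point \<rho> x)"
proof -
  interpret K: metric_family \<eta> "cimg c" "k c" by (rule k_chart[OF c])
  have "vol_density (g c) x = vol_density (k c 0) x" by (simp add: vol_density_def k0[OF c x])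
  then show ?thesis
    using w_fun_chart[where G = k and s = \<rho>, OF atlas metric metric_k[OF \<rho>] c atlas_chartD(2)[OF atlas c x]]
    by (simp add: atlas_chartD(3)[OF atlas c x] K.W_eq_sqrt)
qed

lemma w_fun_h:
  assumes c: "c \<in> A" and x: "x \<in> cimg c" and r: "\<bar>r\<bar> < \<epsilon>" "r\<^sup>2 / 2 < \<eta>"
  shows "w_fun A g h r (cinv c x) = metric_family.W (k c) (cyl_point (- (r\<^sup>2 / 2)) x)"
proof -
  interpret K: metric_family \<eta> "cimg c" "k c" by (rule k_chart[OF c])
  have "vol_density (g c) x = vol_density (k c 0) x" by (simp add: vol_density_def k0[OF c x])
  moreover have "vol_density (h c r) x = vol_density (k c (- (r\<^sup>2 / 2))) x"
    by (simp add: vol_density_def h_eq_k[OF c x r])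
  ultimately show ?thesis
    using w_fun_chart[where G = h and s = r, OF atlas metric metric_h[OF r(1)] c atlas_chartD(2)[OF atlas c x]]
    by (simp add: atlas_chartD(3)[OF atlas c x] K.W_eq_sqrt)
qed

lemma w_coeff_chart:
  assumes c: "c \<in> A" and x: "x \<in> cimg c"
  shows "w_coeff A g h 2 (cinv c x) = - (1/2) * metric_family.jet (cimg c) 1 (metric_family.W (k c)) x"
    "w_coeff A g h 4 (cinv c x) = (1/8) * metric_family.jet (cimg c) 2 (metric_family.W (k c)) x"
    "w_coeff A g h 6 (cinv c x) = - (1/48) * metric_family.jet (cimg c) 3 (metric_family.W (k c)) x"
    "w_coeff A g h 8 (cinv c x) = (1/384) * metric_family.jet (cimg c) 4 (metric_family.W (k c)) x"
proof -
  interpret K: metric_family \<eta> "cimg c" "k c" by (rule k_chart[OF c])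
  note d = deriv_even[OF eps eta, where F = "\<lambda>j \<rho>. (pd None ^^ j) K.W (cyl_point \<rho> x)",
      OF K.DERIV_W[OF x], of "\<lambda>r. w_fun A g h r (cinv c x)"]
  have w: "w_fun A g h r (cinv c x) = (pd None ^^ 0) K.W (cyl_point (- (r\<^sup>2 / 2)) x)"
    if "\<bar>r\<bar> < \<epsilon>" "r\<^sup>2 / 2 < \<eta>" for r using w_fun_h[OF c x that] by simp
  have j: "K.jet j K.W x = (pd None ^^ j) K.W (cyl_point 0 x)" for j using x by (simp add: K.jet_def)
  show "w_coeff A g h 2 (cinv c x) = - (1/2) * K.jet 1 K.W x"
    "w_coeff A g h 4 (cinv c x) = (1/8) * K.jet 2 K.W x"
    "w_coeff A g h 6 (cinv c x) = - (1/48) * K.jet 3 K.W x"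
    "w_coeff A g h 8 (cinv c x) = (1/384) * K.jet 4 K.W x"
    unfolding w_coeff_def j using d(1)[OF _ w] d(2)[OF _ w] d(3)[OF _ w] d(4)[OF _ w]
    by (simp_all add: fact_numeral)
qed

lemma smooth_fun_iff_chart:
  assumes "\<And>c. c \<in> A \<Longrightarrow> \<exists>f. smooth_on (cimg c) f \<and> (\<forall>x\<in>cimg c. u (cinv c x) = f x)"
  shows "smooth_fun A u"
  unfolding smooth_fun_def
proof
  fix c assume "c \<in> A"
  then obtain f where "smooth_on (cimg c) f" "\<forall>x\<in>cimg c. u (cinv c x) = f x" using assms by blast
  then show "smooth_on (cimg c) (\<lambda>x. u (cinv c x))" by (metis (no_types, lifting) smooth_on_cong)
qed

lemma smooth_jet_W:
  assumes c: "c \<in> A" shows "smooth_on (cimg c) (metric_family.jet (cimg c) j (metric_family.W (k c)))"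
proof -
  interpret K: metric_family \<eta> "cimg c" "k c" by (rule k_chart[OF c])
  have "smooth_on (cimg c) (\<lambda>x. (pd None ^^ j) K.W (cyl_point 0 x))"
    unfolding K.smooth_V_iff by (intro ballI smooth_at_slice smooth_at_pd_funpow K.smooth_at_W K.cyl0_C)
  then show ?thesis by (rule smooth_on_cong) (simp add: K.jet_def)
qed

lemma smooth_fun_w_coeff:
  "smooth_fun A (w_coeff A g h 2)" "smooth_fun A (w_coeff A g h 4)" "smooth_fun A (w_coeff A g h 6)"
proof -
  have "\<exists>f. smooth_on (cimg c) f \<and> (\<forall>x\<in>cimg c. w_coeff A g h 2 (cinv c x) = f x)"
    "\<exists>f. smooth_on (cimg c) f \<and> (\<forall>x\<in>cimg c. w_coeff A g h 4 (cinv c x) = f x)"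
    "\<exists>f. smooth_on (cimg c) f \<and> (\<forall>x\<in>cimg c. w_coeff A g h 6 (cinv c x) = f x)" if c: "c \<in> A" for c
    using metric_family.smooth_V_cmult[OF k_chart[OF c] smooth_jet_W[OF c]] w_coeff_chart[OF c] by blast+
  then show "smooth_fun A (w_coeff A g h 2)" "smooth_fun A (w_coeff A g h 4)" "smooth_fun A (w_coeff A g h 6)"
    by (intro smooth_fun_iff_chart; blast)+
qed

text \<open>The value of a GJMS-operator may be computed with any extension.  The extension \<open>u / W\<close> becomes independent
  of $\rho$ after the conjugation.\<close>

lemma gjms_eval:
  assumes P: "gjms_operator A \<eta> k N P" and u: "smooth_fun A u" and c: "c \<in> A" and x: "x \<in> cimg c"
  shows "P u (cinv c x) = metric_family.iterD (k c) N (2 * real N - 2) (\<lambda>y. u (cinv c (xpart y))) (cyl_point 0 x)"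
proof -
  define U where "U p \<rho> = u p / w_fun A g k \<rho> p" for p \<rho>
  have U: "U (cinv c (xpart y)) (y $ None) = u (cinv c (xpart y)) * metric_family.\<beta> (k c) y"
    if c: "c \<in> A" and y: "y \<in> metric_family.C \<eta> (cimg c)" for c y
  proof -
    interpret K: metric_family \<eta> "cimg c" "k c" by (rule k_chart[OF c])
    have "w_fun A g k (y $ None) (cinv c (xpart y)) = K.W y"
      using w_fun_k[OF c, of "xpart y" "y $ None"] y by (simp add: K.mem_C cyl_point_xpart)
    moreover have "K.\<beta> y = 1 / K.W y" using K.\<beta>_W[OF y] by (metis mult_eq_0_iff nonzero_eq_divide_eq zero_neq_one)
    ultimately show ?thesis by (simp add: U_def)
  qed
  have "smooth_extension A \<eta> u U"
    unfolding smooth_extension_def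
  proof (intro conjI ballI allI)
    fix c assume c: "c \<in> A"
    interpret K: metric_family \<eta> "cimg c" "k c" by (rule k_chart[OF c])
    have "smooth_on K.C (\<lambda>y. u (cinv c (xpart y)) * K.\<beta> y)"
      using K.smooth_lift[OF smooth_hat[OF u c]] by (simp add: K.smooth_iff)
    then have "smooth_on K.C (\<lambda>y. U (cinv c (xpart y)) (y $ None))"
      by (rule smooth_on_cong) (simp add: U[OF c])
    then show "smooth_on (cylinder {-\<eta><..<\<eta>} (cimg c)) (\<lambda>y. U (cinv c (xpart y)) (y $ None))"
      by (simp add: K.C_def)
  next
    fix p
    let ?c = "chart_at A p"
    have c: "?c \<in> A" "p \<in> cdom ?c" using chart_atD[OF atlas] by auto
    interpret K: metric_family \<eta> "cimg ?c" "k ?c" by (rule k_chart[OF c(1)])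
    have "coord ?c p \<in> cimg ?c" using c by blast
    then show "U p 0 = u p"
      using w_fun_k[OF c(1), of "coord ?c p" 0] K.W_cyl0[of "coord ?c p"] eta
      by (simp add: U_def atlas_chartD(4)[OF atlas c])
  qed
  then have "P u (cinv c x) = (laplacian (amb_metric (k c)) ^^ N)
       (\<lambda>y. (y $ AT) powr (real N - real CARD('n) / 2) * U (cinv c (amb_x y)) (y $ AInf))
       (amb_point 1 (coord c (cinv c x)) 0)"
    using P u c atlas_chartD(2)[OF atlas c x] unfolding gjms_operator_def by blast
  also have "coord c (cinv c x) = x" by (rule atlas_chartD(3)[OF atlas c x])
  also have "(laplacian (amb_metric (k c)) ^^ N)
       (\<lambda>y. (y $ AT) powr (real N - real CARD('n) / 2) * U (cinv c (amb_x y)) (y $ AInf)) (amb_point 1 x 0)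
     = metric_family.iterD (k c) N (2 * real N - 2) (\<lambda>y. u (cinv c (xpart y))) (cyl_point 0 x)"
  proof -
    interpret K: metric_family \<eta> "cimg c" "k c" by (rule k_chart[OF c])
    show ?thesis
    proof (rule K.laplacian_amb_iterate_slice[OF K.smooth_lift[OF smooth_hat[OF u c]] x])
      show "(y $ AT) powr (real N - real CARD('n) / 2) * U (cinv c (amb_x y)) (y $ AInf)
        = (y $ AT) powr (real N - real CARD('n) / 2)
          * (u (cinv c (xpart (coords amb_index y))) * K.\<beta> (coords amb_index y))" if "y \<in> K.amb_dom" for y
        using U[OF c K.amb_domD(2)[OF that]] by (simp add: xpart_coords_amb_index)
    qed
  qed
  finally show ?thesis .
qed

text \<open>In every chart, the operator is the multiple by \<open>a\<close> of the \<open>m\<close>-th derivative at $\rho=0$ of the tangential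
  part of the conjugated Laplacian.  This is the form in which $M_2$, $M_4$ and $M_6$ can be composed.\<close>

definition acts :: "(('m \<Rightarrow> real) \<Rightarrow> 'm \<Rightarrow> real) \<Rightarrow> real \<Rightarrow> nat \<Rightarrow> bool" where
  "acts M a m \<longleftrightarrow> (\<forall>v. smooth_fun A v \<longrightarrow> (\<forall>c\<in>A. \<forall>x\<in>cimg c.
     M v (cinv c x) = a * metric_family.mop (cimg c) (k c) m (\<lambda>x. v (cinv c x)) x))"

lemma actsD: "acts M a m \<Longrightarrow> smooth_fun A v \<Longrightarrow> c \<in> A \<Longrightarrow> x \<in> cimg c \<Longrightarrow>
    M v (cinv c x) = a * metric_family.mop (cimg c) (k c) m (\<lambda>x. v (cinv c x)) x"
  unfolding acts_def by blast

lemma smooth_fun_acts: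
  assumes M: "acts M a m" and v: "smooth_fun A v" shows "smooth_fun A (M v)"
proof (rule smooth_fun_iff_chart)
  fix c assume c: "c \<in> A"
  interpret K: metric_family \<eta> "cimg c" "k c" by (rule k_chart[OF c])
  show "\<exists>f. smooth_on (cimg c) f \<and> (\<forall>x\<in>cimg c. M v (cinv c x) = f x)"
    using actsD[OF M v c] K.smooth_V_cmult[OF K.smooth_on_mop[OF smooth_hat[OF v c]]] by blast
qed

lemma mop_acts:
  assumes M: "acts M a m'" and v: "smooth_fun A v" and c: "c \<in> A"
  shows "metric_family.mop (cimg c) (k c) m (\<lambda>x. M v (cinv c x)) =
    (\<lambda>x. a * metric_family.mop (cimg c) (k c) m (metric_family.mop (cimg c) (k c) m' (\<lambda>x. v (cinv c x))) x)"
proof -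
  interpret K: metric_family \<eta> "cimg c" "k c" by (rule k_chart[OF c])
  have "K.mop m (\<lambda>x. M v (cinv c x)) = K.mop m (\<lambda>x. a * K.mop m' (\<lambda>x. v (cinv c x)) x)"
    by (rule K.mop_cong) (rule actsD[OF M v c])
  then show ?thesis by (simp add: K.mop_cmult K.smooth_on_mop smooth_hat[OF v c])
qed

lemma acts_M2:
  assumes "gjms_operator A \<eta> k 1 P2" shows "acts P2 1 0"
  unfolding acts_def
proof (intro allI impI ballI)
  fix v c x assume v: "smooth_fun A v" and c: "c \<in> A" and x: "x \<in> cimg c"
  interpret K: metric_family \<eta> "cimg c" "k c" by (rule k_chart[OF c])
  show "P2 v (cinv c x) = 1 * K.mop 0 (\<lambda>x. v (cinv c x)) x"
    using gjms_eval[OF assms v c x] K.gjms_slice(1)[OF smooth_hat[OF v c] x] by simp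
qed

lemma gjms_4_chart:
  assumes "gjms_operator A \<eta> k 2 P4" "smooth_fun A v" "c \<in> A" "x \<in> cimg c"
  shows "P4 v (cinv c x) = metric_family.mop (cimg c) (k c) 0 (metric_family.mop (cimg c) (k c) 0 (\<lambda>x. v (cinv c x))) x
    + (- 2) * metric_family.mop (cimg c) (k c) 1 (\<lambda>x. v (cinv c x)) x"
  using gjms_eval[OF assms] metric_family.gjms_slice(2)[OF k_chart smooth_hat] assms by simp

text \<open>The combinations $M_{2N}$ of GJMS-operators are made so that the products of lower operators cancel: what
  remains is of second order.\<close>

lemma acts_M4:
  assumes P2: "gjms_operator A \<eta> k 1 P2" and P4: "gjms_operator A \<eta> k 2 P4"
  shows "acts (\<lambda>u p. P4 u p - P2 (P2 u) p) (- 2) 1"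
  unfolding acts_def
proof (intro allI impI ballI)
  fix v c x assume v: "smooth_fun A v" and c: "c \<in> A" and x: "x \<in> cimg c"
  note a = acts_M2[OF P2]
  show "P4 v (cinv c x) - P2 (P2 v) (cinv c x) = - 2 * metric_family.mop (cimg c) (k c) 1 (\<lambda>x. v (cinv c x)) x"
    unfolding gjms_4_chart[OF P4 v c x] actsD[OF a smooth_fun_acts[OF a v] c x] mop_acts[OF a v c] by simp
qed

lemma smooth_fun_gjms_4:
  assumes P4: "gjms_operator A \<eta> k 2 P4" and v: "smooth_fun A v" shows "smooth_fun A (P4 v)"
proof (rule smooth_fun_iff_chart)
  fix c assume c: "c \<in> A"
  interpret K: metric_family \<eta> "cimg c" "k c" by (rule k_chart[OF c])
  have "smooth_on (cimg c) (\<lambda>x. K.mop 0 (K.mop 0 (\<lambda>x. v (cinv c x))) x + (- 2) * K.mop 1 (\<lambda>x. v (cinv c x)) x)"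
    by (intro K.smooth_V_add K.smooth_V_cmult K.smooth_on_mop smooth_hat[OF v c])
  then show "\<exists>f. smooth_on (cimg c) f \<and> (\<forall>x\<in>cimg c. P4 v (cinv c x) = f x)"
    using gjms_4_chart[OF P4 v c] by blast
qed

lemma acts_M6:
  assumes P2: "gjms_operator A \<eta> k 1 P2" and P4: "gjms_operator A \<eta> k 2 P4" and P6: "gjms_operator A \<eta> k 3 P6"
  shows "acts (\<lambda>u p. P6 u p - 2 * P2 (P4 u) p - 2 * P4 (P2 u) p + 3 * P2 (P2 (P2 u)) p) 8 2"
  unfolding acts_def
proof (intro allI impI ballI)
  fix v c x assume v: "smooth_fun A v" and c: "c \<in> A" and x: "x \<in> cimg c"
  interpret K: metric_family \<eta> "cimg c" "k c" by (rule k_chart[OF c])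
  let ?v = "\<lambda>x. v (cinv c x)"
  note a = acts_M2[OF P2]
  have s: "smooth_fun A (P2 v)" "smooth_fun A (P2 (P2 v))" "smooth_fun A (P4 v)"
    using smooth_fun_acts[OF a] smooth_fun_gjms_4[OF P4] v by auto
  note sm = K.smooth_on_mop[OF smooth_hat[OF v c]]
  have m4: "K.mop 0 (\<lambda>x. P4 v (cinv c x)) = (\<lambda>x. K.mop 0 (K.mop 0 (K.mop 0 ?v)) x + (- 2) * K.mop 0 (K.mop 1 ?v) x)"
  proof -
    have "K.mop 0 (\<lambda>x. P4 v (cinv c x)) = K.mop 0 (\<lambda>x. K.mop 0 (K.mop 0 ?v) x + (- 2) * K.mop 1 ?v x)"
      by (rule K.mop_cong) (rule gjms_4_chart[OF P4 v c])
    then show ?thesis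
      by (simp only: K.mop_add K.mop_cmult K.smooth_on_mop K.smooth_V_cmult sm)
  qed
  have 6: "P6 v (cinv c x) = K.mop 0 (K.mop 0 (K.mop 0 ?v)) x - 4 * K.mop 1 (K.mop 0 ?v) x
       - 4 * K.mop 0 (K.mop 1 ?v) x + 8 * K.mop 2 ?v x"
    using gjms_eval[OF P6 v c x] K.gjms_slice(3)[OF smooth_hat[OF v c] x] by simp
  have 24: "P2 (P4 v) (cinv c x) = K.mop 0 (K.mop 0 (K.mop 0 ?v)) x + (- 2) * K.mop 0 (K.mop 1 ?v) x"
    unfolding actsD[OF a s(3) c x] m4 by simp
  have 42: "P4 (P2 v) (cinv c x) = K.mop 0 (K.mop 0 (K.mop 0 ?v)) x + (- 2) * K.mop 1 (K.mop 0 ?v) x"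
    unfolding gjms_4_chart[OF P4 s(1) c x] mop_acts[OF a v c] by simp
  have 222: "P2 (P2 (P2 v)) (cinv c x) = K.mop 0 (K.mop 0 (K.mop 0 ?v)) x"
    unfolding actsD[OF a s(2) c x] mop_acts[OF a s(1) c] mop_acts[OF a v c] by simp
  show "P6 v (cinv c x) - 2 * P2 (P4 v) (cinv c x) - 2 * P4 (P2 v) (cinv c x) + 3 * P2 (P2 (P2 v)) (cinv c x)
    = 8 * K.mop 2 ?v x"
    unfolding 6 24 42 222 by simp
qed

lemma endo_identity:
  assumes c: "c \<in> A" and x: "x \<in> cimg c"
  defines "Psch \<equiv> endo (g c) (schouten (g c))" and "\<Omega>1 \<equiv> endo (g c) (ext_obstruction (k c) 1)"
    and "\<Omega>2 \<equiv> endo (g c) (ext_obstruction (k c) 2)"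
  shows "metric_inv (g c) x ** (\<Omega>2 x - 4 *\<^sub>R (Psch x ** \<Omega>1 x + \<Omega>1 x ** Psch x) + 12 *\<^sub>R (Psch x ** Psch x ** Psch x))
    = (- (1/2)) *\<^sub>R metric_family.Xd (k c) 3 (cyl_point 0 x)"
proof -
  interpret K: metric_family \<eta> "cimg c" "k c" by (rule k_chart[OF c])
  have X: "K.Xd 0 (cyl_point 0 x) = metric_inv (g c) x"
    by (simp add: K.Xd_0 K.H_def k0[OF c x] metric_inv_def)
  show ?thesis
    unfolding K.Xd_3_eq[OF K.cyl0_C[OF x] Hd_1_schouten[OF c x]] X Psch_def \<Omega>1_def \<Omega>2_def endo_def
      K.ext_obstruction_eq[OF x] by simp
qed

text \<open>The noncommutative polynomial in the operators $M_{2N}$ absorbs all of the expression for $P_8$ except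
  $-48\,m_3$, whose divergence part is the term with the tensors and whose potential is $\mu_8$.\<close>

lemma gjms_8_formula:
  assumes P8: "gjms_operator A \<eta> k 4 P8"
    and M2: "acts M2 1 0" and M4: "acts M4 (- 2) 1" and M6: "acts M6 8 2" and u: "smooth_fun A u"
  defines "w \<equiv> w_coeff A g h"
    and "Psch \<equiv> \<lambda>c. endo (g c) (schouten (g c))"
    and "\<Omega>1 \<equiv> \<lambda>c. endo (g c) (ext_obstruction (k c) 1)"
    and "\<Omega>2 \<equiv> \<lambda>c. endo (g c) (ext_obstruction (k c) 2)"
  shows "P8 u p = M2 (M2 (M2 (M2 u))) p + 3 * (M2 (M2 (M4 u)) p + M4 (M2 (M2 u)) p)
     + 4 * M2 (M4 (M2 u)) p + 9 * M4 (M4 u) p + 3 * (M2 (M6 u) p + M6 (M2 u) p)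
     - 96 * delta_endo_d A g (\<lambda>c x. \<Omega>2 c x - 4 *\<^sub>R (Psch c x ** \<Omega>1 c x + \<Omega>1 c x ** Psch c x)
            + 12 *\<^sub>R (Psch c x ** Psch c x ** Psch c x)) u p
     + ((real CARD('n) / 2 - 4) * fact 3 * fact 4 * 2^8 * w 8 p
            - 48\<^sup>2 * M2 (w 6) p - 24\<^sup>2 * M4 (w 4) p - 6\<^sup>2 * M6 (w 2) p) * u p"
proof -
  define c where "c = chart_at A p"
  define x where "x = coord c p"
  have c: "c \<in> A" "p \<in> cdom c" using chart_atD[OF atlas] by (auto simp: c_def)
  have x: "x \<in> cimg c" unfolding x_def using c(2) by blast
  have p: "p = cinv c x" unfolding x_def by (rule atlas_chartD(4)[OF atlas c, symmetric])
  interpret K: metric_family \<eta> "cimg c" "k c" by (rule k_chart[OF c(1)])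
  let ?u = "\<lambda>x. u (cinv c x)"
  define T where "T = (\<lambda>c x. \<Omega>2 c x - 4 *\<^sub>R (Psch c x ** \<Omega>1 c x + \<Omega>1 c x ** Psch c x)
            + 12 *\<^sub>R (Psch c x ** Psch c x ** Psch c x))"
  note su = smooth_hat[OF u c(1)]
  note s = smooth_fun_acts[OF M2] smooth_fun_acts[OF M4] smooth_fun_acts[OF M6] u
  note sm = K.smooth_on_mop su
  note ev = actsD[OF M2 _ c(1) x] actsD[OF M4 _ c(1) x] actsD[OF M6 _ c(1) x]
    mop_acts[OF M2 _ c(1)] mop_acts[OF M4 _ c(1)] mop_acts[OF M6 _ c(1)]
  have neg: "K.mop m (\<lambda>x. - (a * f x)) = (\<lambda>x. - (a * K.mop m f x))" if "smooth_on (cimg c) f" for m a f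
    using K.mop_cmult[OF that, of m "- a"] by simp
  have e: "M2 (M2 (M2 (M2 u))) p = K.mop 0 (K.mop 0 (K.mop 0 (K.mop 0 ?u))) x"
    "M2 (M2 (M4 u)) p = - 2 * K.mop 0 (K.mop 0 (K.mop 1 ?u)) x"
    "M4 (M2 (M2 u)) p = - 2 * K.mop 1 (K.mop 0 (K.mop 0 ?u)) x"
    "M2 (M4 (M2 u)) p = - 2 * K.mop 0 (K.mop 1 (K.mop 0 ?u)) x"
    "M4 (M4 u) p = 4 * K.mop 1 (K.mop 1 ?u) x"
    "M2 (M6 u) p = 8 * K.mop 0 (K.mop 2 ?u) x" "M6 (M2 u) p = 8 * K.mop 2 (K.mop 0 ?u) x"
    unfolding p by (simp_all add: ev s sm K.mop_cmult neg del: One_nat_def)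
  have sJ: "smooth_on (cimg c) (K.jet j K.W)" for j by (rule smooth_jet_W[OF c(1)])
  have w: "M2 (w 6) p = - (1/48) * K.mop 0 (K.jet 3 K.W) x"
    "M4 (w 4) p = - (1/4) * K.mop 1 (K.jet 2 K.W) x" "M6 (w 2) p = - 4 * K.mop 2 (K.jet 1 K.W) x"
    "w 8 p = (1/384) * K.jet 4 K.W x"
  proof -
    have "K.mop 0 (\<lambda>x. w 6 (cinv c x)) = K.mop 0 (\<lambda>x. - (1/48) * K.jet 3 K.W x)"
      "K.mop 1 (\<lambda>x. w 4 (cinv c x)) = K.mop 1 (\<lambda>x. (1/8) * K.jet 2 K.W x)"
      "K.mop 2 (\<lambda>x. w 2 (cinv c x)) = K.mop 2 (\<lambda>x. - (1/2) * K.jet 1 K.W x)"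
      unfolding w_def by (rule K.mop_cong, rule w_coeff_chart[OF c(1)], assumption)+
    note m = this[unfolded K.mop_cmult[OF sJ]]
    show "M2 (w 6) p = - (1/48) * K.mop 0 (K.jet 3 K.W) x"
      unfolding p ev(1)[OF smooth_fun_w_coeff(3)[folded w_def]] m by simp
    show "M4 (w 4) p = - (1/4) * K.mop 1 (K.jet 2 K.W) x"
      unfolding p ev(2)[OF smooth_fun_w_coeff(2)[folded w_def]] m by simp
    show "M6 (w 2) p = - 4 * K.mop 2 (K.jet 1 K.W) x"
      unfolding p ev(3)[OF smooth_fun_w_coeff(1)[folded w_def]] m by simp
    show "w 8 p = (1/384) * K.jet 4 K.W x"
      unfolding p w_def by (rule w_coeff_chart(4)[OF c(1) x])
  qed
  have d: "delta_endo_d A g T u p = 1/2 * (K.mop 3 ?u x - K.mop 3 (\<lambda>x. 1) x * u p)"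
  proof -
    have "delta_endo_d A g T u p = codiff (g c) (\<lambda>x. T c x *v dform ?u x) x"
      by (simp add: delta_endo_d_def Let_def c_def x_def)
    also have "\<dots> = - (- (1/2)) * (K.mop 3 ?u x - K.mop 3 (\<lambda>x. 1) x * ?u x)"
    proof (rule K.mop_codiff[OF su x])
      show "g c x = k c 0 x" if "x \<in> cimg c" for x using k0[OF c(1) that] by simp
      show "metric_inv (g c) x ** T c x = (- (1/2)) *\<^sub>R K.Xd 3 (cyl_point 0 x)" if "x \<in> cimg c" for x
        unfolding T_def Psch_def \<Omega>1_def \<Omega>2_def by (rule endo_identity[OF c(1) that])
    qed
    finally show ?thesis unfolding p by simp
  qed
  have P: "P8 u p = K.mop 0 (K.mop 0 (K.mop 0 (K.mop 0 ?u))) x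
       - 6 * (K.mop 1 (K.mop 0 (K.mop 0 ?u)) x + K.mop 0 (K.mop 0 (K.mop 1 ?u)) x) - 8 * K.mop 0 (K.mop 1 (K.mop 0 ?u)) x
       + 36 * K.mop 1 (K.mop 1 ?u) x + 24 * (K.mop 2 (K.mop 0 ?u) x + K.mop 0 (K.mop 2 ?u) x) - 48 * K.mop 3 ?u x"
    using gjms_eval[OF P8 u c(1) x] K.gjms_slice(4)[OF su x] p by simp
  have m3: "K.mop 3 (\<lambda>x. 1) x = (8 - real CARD('n)) * K.jet 4 K.W x - 3 * K.mop 2 (K.jet 1 K.W) x
       - 3 * K.mop 1 (K.jet 2 K.W) x - K.mop 0 (K.jet 3 K.W) x"
    using K.mop_W[OF x] by linarith
  show ?thesis
    unfolding T_def[symmetric] P e w d m3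
    by (simp add: fact_numeral algebra_simps del: One_nat_def)
qed

end

theorem theorem10p4:
  fixes A :: "('m::{t2_space,second_countable_topology}, 'n::finite) chart set"
    and g :: "('m, 'n) tensor2"
    and h k :: "('m, 'n) tensor2_family"
    and \<epsilon> \<eta> :: real
    and P2 P4 P6 P8 :: "('m \<Rightarrow> real) \<Rightarrow> 'm \<Rightarrow> real"
  assumes "smooth_atlas A"
    and "riemannian_metric A g"
    and "even CARD('n) \<and> CARD('n) \<ge> 8 \<or> odd CARD('n) \<and> CARD('n) \<ge> 3"
    and "poincare_einstein A g \<epsilon> h"
    and "ambient_family A \<epsilon> h \<eta> k"
    and "gjms_operator A \<eta> k 1 P2"
    and "gjms_operator A \<eta> k 2 P4"
    and "gjms_operator A \<eta> k 3 P6"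
    and "gjms_operator A \<eta> k 4 P8"
  shows
    "let M2 = P2;
         M4 = (\<lambda>u p. P4 u p - P2 (P2 u) p);
         M6 = (\<lambda>u p. P6 u p - 2 * P2 (P4 u) p - 2 * P4 (P2 u) p + 3 * P2 (P2 (P2 u)) p);
         w = w_coeff A g h;
         Psch = (\<lambda>c. endo (g c) (schouten (g c)));
         \<Omega>1 = (\<lambda>c. endo (g c) (ext_obstruction (k c) 1));
         \<Omega>2 = (\<lambda>c. endo (g c) (ext_obstruction (k c) 2));
         T = (\<lambda>c x. \<Omega>2 c x - 4 *\<^sub>R (Psch c x ** \<Omega>1 c x + \<Omega>1 c x ** Psch c x)
                + 12 *\<^sub>R (Psch c x ** Psch c x ** Psch c x));
         \<mu>8 = (\<lambda>p. (real CARD('n) / 2 - 4) * fact 3 * fact 4 * 2^8 * w 8 p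
                - 48\<^sup>2 * M2 (w 6) p - 24\<^sup>2 * M4 (w 4) p - 6\<^sup>2 * M6 (w 2) p)
     in \<forall>u. smooth_fun A u \<longrightarrow> (\<forall>p. P8 u p =
          M2 (M2 (M2 (M2 u))) p
          + 3 * (M2 (M2 (M4 u)) p + M4 (M2 (M2 u)) p)
          + 4 * M2 (M4 (M2 u)) p
          + 9 * M4 (M4 u) p
          + 3 * (M2 (M6 u) p + M6 (M2 u) p)
          - 96 * delta_endo_d A g T u p
          + \<mu>8 p * u p)"
proof -
  interpret poincare_einstein_setting A g h k \<epsilon> \<eta>
    using assms by unfold_locales
  show ?thesis
    unfolding Let_def
    by (intro allI impI gjms_8_formula[OF assms(9) acts_M2[OF assms(6)] acts_M4[OF assms(6,7)]
          acts_M6[OF assms(6,7,8)]])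
qed

end
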